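(* Let $\Gamma$ be a Carleson Jordan curve and let $p:\Gamma\to(1,\infty)$ be a continuous function such that \[ |p(\tau)-p(t)|\le -\frac{A_\Gamma}{\log|\tau-t|}\quad\text{whenever } |\tau-t|\le 1/2, \] where $A_\Gamma$ is a positive constant depending only on $\Gamma$. Let $t_1,\dots,t_n\in\Gamma$ be pairwise distinct points, let $w_1,\dots,w_n\in\mathbb{W}$, and let \[ w(t):=\prod_{k=1}^n w_k(|t-t_k|),\qquad t\in\Gamma . \] If the Cauchy singular integral operator $S$ is bounded on the weighted variable Lebesgue space $L^{p(\cdot)}(\Gamma,w)$, then \[ 0<\frac1{p(t_k)}+m(w_k),\qquad \frac1{p(t_k)}+M(w_k)<1\qquad\text{for all } k\in\{1,\dots,n\}. \]
   Context: **Curves and the operator $S$.** A Jordan curve $\Gamma\subset\mathbb{C}$ is a curve homeomorphic to a circle; it is assumed rectifiable, equipped with Lebesgue length measure $|d\tau|$ and counter-clockwise orientation. $|\Omega|$ denotes the length measure of a measurable $\Omega\subset\Gamma$, and $\Gamma(t,R):=\{\tau\in\Gamma:|\tau-t|<R\}$. $\Gamma$ is a Carleson curve if $\sup_{t\in\Gamma}\sup_{R>0}|\Gamma(t,R)|/R<\infty$. The Cauchy singular integral is \[ (Sf)(t):=\lim_{R\to0}\frac1{\pi i}\int_{\Gamma\setminus\Gamma(t,R)}\frac{f(\tau)}{\tau-t}\,d\tau\quad(t\in\Gamma). \] **Variable Lebesgue spaces.** A weight is a measurable function $w:\Gamma\to[0,\infty]$ with $0<w<\infty$ a.e. For a continuous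 $p:\Gamma\to(1,\infty)$, $L^{p(\cdot)}(\Gamma,w)$ is the Banach space of all measurable $f:\Gamma\to\mathbb{C}$ with $\int_\Gamma|f(\tau)w(\tau)/\lambda|^{p(\tau)}|d\tau|<\infty$ for some $\lambda>0$, with norm $\|f\|_{p(\cdot),w}:=\inf\{\lambda>0:\int_\Gamma|f(\tau)w(\tau)/\lambda|^{p(\tau)}|d\tau|\le1\}$. **The class $\mathbb{W}$.** $W$ is the class of all continuous functions $\varrho:[0,|\Gamma|]\to[0,\infty)$ with $\varrho(0)=0$, $\varrho(x)>0$ for $0<x\le|\Gamma|$, and $\varrho$ almost increasing, i.e. there is $C>0$ with $\varrho(x)\le C\varrho(y)$ whenever $x\le y$. $\mathbb{W}$ is the set of all $\varrho:[0,|\Gamma|]\to[0,\infty]$ such that $x^\alpha\varrho(x)\in W$ and $x^\beta/\varrho(x)\in W$ for some $\alpha,\beta\in\mathbb{R}$ (values of these products at $x=0$ are understood as limits as $x\to 0$, so that e.g. $x^\gamma\in\mathbb{W}$ for all $\gamma\in\mathbb{R}$). **Matuszewska–Orlicz indices.** For $\varrho\in\mathbb{W}$ put $\Phi_\varrho^0(x):=\limsup_{y\to0}\varrho(xy)/\varrho(y)$, $x\in(0,\infty)$, and \[ m(\varrho):=\lim_{x\to0}\frac{\log\Phi_\varrho^0(x)}{\log x},\qquad M(\varrho):=\lim_{x\to\infty}\frac{\log\Phi_\varrho^0(x)}{\log x}; \] these limits exist and $-\infty<m(\varrho)\le M(\varrho)<\infty$. *)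

theory Defs
  imports "HOL-Complex_Analysis.Complex_Analysis"
begin

section \<open>Rectifiable Jordan curves\<close>

text \<open>
  A Jordan curve \<open>\<Gamma>\<close> is given by a continuous parametrization \<open>g\<close> over \<open>{0..1}\<close> that is injective
  up to the common endpoint, so that \<open>\<Gamma> = path_image g\<close>.
\<close>

definition polygonal_lengths :: "(real \<Rightarrow> complex) \<Rightarrow> real \<Rightarrow> real \<Rightarrow> real set" where
  "polygonal_lengths g a b =
     {(\<Sum>i<n. dist (g (u i)) (g (u (Suc i)))) | (n :: nat) (u :: nat \<Rightarrow> real).
        u 0 = a \<and> u n = b \<and> (\<forall>i<n. u i \<le> u (Suc i))}"

definition path_length :: "(real \<Rightarrow> complex) \<Rightarrow> real \<Rightarrow> real \<Rightarrow> real" where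
  "path_length g a b = Sup (polygonal_lengths g a b)"

definition rectifiable_path :: "(real \<Rightarrow> complex) \<Rightarrow> bool" where
  "rectifiable_path g \<longleftrightarrow> bdd_above (polygonal_lengths g 0 1)"

definition rectifiable_jordan_curve :: "(real \<Rightarrow> complex) \<Rightarrow> bool" where
  "rectifiable_jordan_curve g \<longleftrightarrow>
     simple_path g \<and> pathfinish g = pathstart g \<and> rectifiable_path g"

definition counterclockwise :: "(real \<Rightarrow> complex) \<Rightarrow> bool" where
  "counterclockwise g \<longleftrightarrow> (\<forall>z\<in>inside (path_image g). winding_number g z = 1)"

abbreviation curve_length :: "(real \<Rightarrow> complex) \<Rightarrow> real" where
  "curve_length g \<equiv> path_length g 0 1"

text \<open>
  For a rectifiable Jordan curve, \<open>\<lambda>x. path_length g 0 x\<close> is an increasing bijection of \<open>{0..1}\<close> onto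
  \<open>{0..curve_length g}\<close>; composing \<open>g\<close> with its inverse gives the parametrization by arc length.
\<close>

definition arclength_param :: "(real \<Rightarrow> complex) \<Rightarrow> real \<Rightarrow> complex" where
  "arclength_param g s = g (inv_into {0..1} (path_length g 0) s)"

text \<open>
  The length measure \<open>|d\<tau>|\<close> on \<open>\<Gamma>\<close>; the completion is taken so that measurable means Lebesgue
  measurable.
\<close>

definition length_measure :: "(real \<Rightarrow> complex) \<Rightarrow> complex measure" where
  "length_measure g =
     completion (distr (restrict_space lborel {0..curve_length g})
                       (restrict_space borel (path_image g)) (arclength_param g))"

definition portion :: "(real \<Rightarrow> complex) \<Rightarrow> complex \<Rightarrow> real \<Rightarrow> complex set" where
  "portion g t R = {\<tau> \<in> path_image g. cmod (\<tau> - t) < R}"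

definition carleson_curve :: "(real \<Rightarrow> complex) \<Rightarrow> bool" where
  "carleson_curve g \<longleftrightarrow>
     bdd_above {measure (length_measure g) (portion g t R) / R | t R. t \<in> path_image g \<and> 0 < R}"


section \<open>The Cauchy singular integral\<close>

text \<open>
  In arc length, \<open>d\<tau> = \<gamma>'(s) ds\<close> with \<open>\<gamma> = arclength_param g\<close>; the derivative exists almost
  everywhere because \<open>\<gamma>\<close> is Lipschitz continuous.
\<close>

definition cauchy_integrand ::
    "(real \<Rightarrow> complex) \<Rightarrow> (complex \<Rightarrow> complex) \<Rightarrow> complex \<Rightarrow> real \<Rightarrow> complex" where
  "cauchy_integrand g f t s =
     f (arclength_param g s) / (arclength_param g s - t) * vector_derivative (arclength_param g) (at s)"

definition truncated_domain :: "(real \<Rightarrow> complex) \<Rightarrow> complex \<Rightarrow> real \<Rightarrow> real set" where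
  "truncated_domain g t R =
     {s \<in> {0..curve_length g}. arclength_param g s \<in> path_image g - portion g t R}"

definition truncated_cauchy_integral ::
    "(real \<Rightarrow> complex) \<Rightarrow> (complex \<Rightarrow> complex) \<Rightarrow> complex \<Rightarrow> real \<Rightarrow> complex" where
  "truncated_cauchy_integral g f t R =
     1 / (complex_of_real pi * \<i>) *
     set_lebesgue_integral lebesgue (truncated_domain g t R) (cauchy_integrand g f t)"

definition cauchy_singular_integral ::
    "(real \<Rightarrow> complex) \<Rightarrow> (complex \<Rightarrow> complex) \<Rightarrow> complex \<Rightarrow> complex" where
  "cauchy_singular_integral g f t = Lim (at_right 0) (truncated_cauchy_integral g f t)"

definition cauchy_singular_integral_exists ::
    "(real \<Rightarrow> complex) \<Rightarrow> (complex \<Rightarrow> complex) \<Rightarrow> complex \<Rightarrow> bool" where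
  "cauchy_singular_integral_exists g f t \<longleftrightarrow>
     (\<forall>R>0. set_integrable lebesgue (truncated_domain g t R) (cauchy_integrand g f t)) \<and>
     (\<exists>l. (truncated_cauchy_integral g f t \<longlongrightarrow> l) (at_right 0))"


section \<open>Weighted variable Lebesgue spaces\<close>

text \<open>
  A weight may be infinite on a null set; \<^const>\<open>enn2real\<close> replaces these values by \<open>0\<close>, which does
  not affect the integral.
\<close>

definition modular ::
    "(real \<Rightarrow> complex) \<Rightarrow> (complex \<Rightarrow> real) \<Rightarrow> (complex \<Rightarrow> ennreal) \<Rightarrow> (complex \<Rightarrow> complex) \<Rightarrow> real \<Rightarrow> ennreal"
  where
  "modular g p w f r =
     (\<integral>\<^sup>+\<tau>. ennreal ((cmod (f \<tau>) * enn2real (w \<tau>) / r) powr p \<tau>) \<partial>length_measure g)"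

definition variable_Lp ::
    "(real \<Rightarrow> complex) \<Rightarrow> (complex \<Rightarrow> real) \<Rightarrow> (complex \<Rightarrow> ennreal) \<Rightarrow> (complex \<Rightarrow> complex) set" where
  "variable_Lp g p w =
     {f \<in> borel_measurable (length_measure g). \<exists>r>0. modular g p w f r < \<infinity>}"

definition variable_Lp_norm ::
    "(real \<Rightarrow> complex) \<Rightarrow> (complex \<Rightarrow> real) \<Rightarrow> (complex \<Rightarrow> ennreal) \<Rightarrow> (complex \<Rightarrow> complex) \<Rightarrow> real" where
  "variable_Lp_norm g p w f = Inf {r. 0 < r \<and> modular g p w f r \<le> 1}"

text \<open>
  Existence of the principal value almost everywhere is part of boundedness, because \<^const>\<open>Lim\<close> and
  the Lebesgue integral are total functions.
\<close>

definition cauchy_singular_operator_bounded ::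
    "(real \<Rightarrow> complex) \<Rightarrow> (complex \<Rightarrow> real) \<Rightarrow> (complex \<Rightarrow> ennreal) \<Rightarrow> bool" where
  "cauchy_singular_operator_bounded g p w \<longleftrightarrow>
     (\<exists>C. \<forall>f\<in>variable_Lp g p w.
        (AE t in length_measure g. cauchy_singular_integral_exists g f t) \<and>
        cauchy_singular_integral g f \<in> variable_Lp g p w \<and>
        variable_Lp_norm g p w (cauchy_singular_integral g f) \<le> C * variable_Lp_norm g p w f)"


section \<open>Radial weights and Matuszewska--Orlicz indices\<close>

definition class_W :: "real \<Rightarrow> (real \<Rightarrow> real) set" where
  "class_W L = {\<phi>. continuous_on {0..L} \<phi> \<and> \<phi> 0 = 0 \<and> (\<forall>x. 0 < x \<and> x \<le> L \<longrightarrow> 0 < \<phi> x) \<and>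
     (\<exists>C>0. \<forall>x y. 0 \<le> x \<and> x \<le> y \<and> y \<le> L \<longrightarrow> \<phi> x \<le> C * \<phi> y)}"

text \<open>
  The functions \<open>\<phi>\<close> and \<open>\<psi>\<close> are \<open>x\<^sup>\<alpha> \<rho>(x)\<close> and \<open>x\<^sup>\<beta> / \<rho>(x)\<close>, with the value at \<open>0\<close> taken as the limit
  by continuity; the value of \<open>\<rho>\<close> at \<open>0\<close> is unrestricted.
\<close>

definition class_WW :: "real \<Rightarrow> (real \<Rightarrow> ennreal) set" where
  "class_WW L = {\<rho>. \<exists>\<alpha> \<beta>. \<exists>\<phi>\<in>class_W L. \<exists>\<psi>\<in>class_W L. \<forall>x. 0 < x \<and> x \<le> L \<longrightarrow>
     ennreal (\<phi> x) = ennreal (x powr \<alpha>) * \<rho> x \<and> ennreal (\<psi> x) = ennreal (x powr \<beta>) / \<rho> x}"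

definition Phi0 :: "(real \<Rightarrow> ennreal) \<Rightarrow> real \<Rightarrow> ennreal" where
  "Phi0 \<rho> x = Limsup (at_right 0) (\<lambda>y. \<rho> (x * y) / \<rho> y)"

definition lower_index :: "(real \<Rightarrow> ennreal) \<Rightarrow> real" where
  "lower_index \<rho> = Lim (at_right 0) (\<lambda>x. ln (enn2real (Phi0 \<rho> x)) / ln x)"

definition upper_index :: "(real \<Rightarrow> ennreal) \<Rightarrow> real" where
  "upper_index \<rho> = Lim at_top (\<lambda>x. ln (enn2real (Phi0 \<rho> x)) / ln x)"

end

theory Submission
  imports Defs
begin

text \<open>
  Multiplication by the independent variable almost commutes with \<open>S\<close>: the factor
  \<open>(\<tau> - c) - (t - c)\<close> cancels the Cauchy kernel, so that for every point \<open>c\<close>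
  \<open>S((\<tau> - c)f)(t) - (t - c)(Sf)(t) = (1/(\<pi>i)) \<integral> f d\<tau>\<close>
  is a constant function of \<open>t\<close>. If \<open>f\<close> vanishes outside \<open>\<Gamma>(c, R)\<close>, then on \<open>\<Gamma>(c, R)\<close> both terms on
  the left have norm at most a constant times \<open>R\<parallel>f\<parallel>\<close>. A bounded \<open>S\<close> therefore satisfies
  \<open>\<parallel>\<chi>\<parallel> \<bar>\<integral> f d\<tau>\<bar> \<le> C R \<parallel>f\<parallel>\<close> with \<open>\<chi>\<close> the indicator of \<open>\<Gamma>(c, R)\<close>, which is a Muckenhoupt type
  condition at \<open>c\<close> (lemmas \<open>cauchy_singular_integral_commutator\<close> and \<open>bounded_operator_localized\<close>).

  Take \<open>c = t\<^sub>k\<close>, put \<open>p\<^sub>0 = p(t\<^sub>k)\<close>, and write \<open>r\<close> for \<open>w\<^sub>k\<close>. The other factors of the weight are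
  bounded above and below near \<open>t\<^sub>k\<close>. A subarc of \<open>\<Gamma>\<close> that crosses the annulus
  \<open>R/2 < \<bar>\<tau> - c\<bar> < R\<close> has length comparable to \<open>R\<close>: at least \<open>R/2\<close> because it crosses, at most a
  constant times \<open>R\<close> by the Carleson condition. On it the weight is comparable to \<open>r(R)\<close>, and
  logarithmic continuity of \<open>p\<close> makes \<open>R\<^sup>p\<close> comparable to the power with exponent \<open>p\<^sub>0\<close>. Hence the
  indicator of the subarc has norm comparable to \<open>\<psi>(R) = r(R) R powr (1/p\<^sub>0)\<close>, while the integral
  of \<open>d\<tau>\<close> over it is the difference of its end points and has modulus at least \<open>R/2\<close>. Step
  functions on the subarcs of radii \<open>R/2\<^sup>i\<close> turn the Muckenhoupt type condition into an inequality
  about the numbers \<open>\<psi>(R/2\<^sup>i)\<close> only (lemma \<open>dyadic_muckenhoupt\<close>).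

  This inequality is incompatible with \<open>\<psi>(R/2\<^sup>i) > \<psi>(R)/2\<close> for \<open>i = 1, \<dots>, m\<close> when \<open>m\<close> is large,
  since \<open>m\<close> subarcs of comparable weighted norm would make the norm of \<open>\<chi>\<close> too large. The same
  holds with \<open>R/\<psi>(R)\<close> in place of \<open>\<psi>(R)\<close>: a sum of \<open>m\<close> normalized step functions has norm at most of
  order \<open>m powr (1/q)\<close> with \<open>q = min p > 1\<close>, but an integral of order \<open>m\<close>. So both functions are halved within a
  bounded number of dyadic steps and decay geometrically (lemma \<open>halving_iterate\<close>). For suitable \<open>N\<close>
  this reads \<open>\<Phi>(x) \<le> x powr (-1/p\<^sub>0) / 2\<close> at \<open>x = 1/2\<^sup>N\<close> and \<open>\<Phi>(x) \<le> x powr (1 - 1/p\<^sub>0) / 2\<close> at \<open>x = 2\<^sup>N\<close>,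
  where \<open>\<Phi>\<close> is the function that defines the indices of \<open>w\<^sub>k\<close>. Since \<open>\<Phi>\<close> is submultiplicative, the
  lower index is the supremum of \<open>ln \<Phi>(x) / ln x\<close> over \<open>x < 1\<close> and the upper index is its infimum over
  \<open>x > 1\<close>, and one such \<open>x\<close> on either side suffices for a strict inequality
  (lemma \<open>index_bounds_from_dyadic\<close>).

  The argument integrates \<open>d\<tau> = \<gamma>'(s) ds\<close> over subarcs. This rests on two facts about
  the arc length parametrization \<open>\<gamma>\<close>: the length of a rectifiable path depends continuously on the
  end point, which makes \<open>\<gamma>\<close> a Lipschitz map onto \<open>\<Gamma>\<close>; and a Lipschitz map is differentiable almost
  everywhere and is the integral of its derivative.
\<close>

section \<open>Differentiation of Lipschitz functions\<close>

text \<open>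
  Vitali's theorem covers almost all of \<open>E\<close> by disjoint intervals of slope at most \<open>q\<close> inside an open
  set of nearly the same measure; a Lipschitz function maps the uncovered null set to a null set. The
  lemma is also applied to the inverse function, where it bounds \<open>emeasure lborel (f ` E)\<close>
  from below.
\<close>
lemma emeasure_image_slope_le:
  fixes f h :: "real \<Rightarrow> real"
  assumes lip: "C-lipschitz_on UNIV f" and mono: "strict_mono f"
    and hf: "\<And>x. h (f x) = x" and fh: "\<And>y. f (h y) = y" and hcont: "continuous_on UNIV h"
    and E: "E \<in> sets borel" and q: "0 \<le> q"
    and cov: "\<And>x d. x \<in> E \<Longrightarrow> 0 < d \<Longrightarrow> \<exists>a b. a < x \<and> x < b \<and> b - a < d \<and> f b - f a \<le> q * (b - a)"
  shows "emeasure lborel (f ` E) \<le> ennreal q * emeasure lborel E"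
proof -
  have hmono: "h x < h y \<longleftrightarrow> x < y" for x y
    using mono fh by (metis strict_mono_less)
  have image_vimage: "f ` X = h -` X" for X
    using hf fh by (auto simp: image_iff) metis
  have img_sets[measurable]: "f ` X \<in> sets borel" if "X \<in> sets borel" for X
    unfolding image_vimage using that borel_measurable_continuous_onI[OF hcont]
    by (metis measurable_sets_borel)
  have open_bound: "emeasure lborel (f ` E) \<le> ennreal q * emeasure lborel U"
    if U: "open U" "E \<subseteq> U" for U
  proof -
    define K where "K = {(a, b). a < b \<and> {a<..<b} \<subseteq> U \<and> f b - f a \<le> q * (b - a)}"
    define I where "I = (\<lambda>(a::real, b). {a<..<b})"
    define c r where "c = (\<lambda>(a::real, b). (a + b) / 2)" and "r = (\<lambda>(a::real, b). (b - a) / 2)"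
    have ball_I: "ball (c i) (r i) = I i" for i
      by (cases i) (auto simp: ball_eq_greaterThanLessThan c_def r_def I_def field_simps)
    have "\<exists>i. i \<in> K \<and> x \<in> ball (c i) (r i) \<and> r i < d" if x: "x \<in> E" and d: "0 < d" for x d
    proof -
      obtain e where e: "e > 0" "ball x e \<subseteq> U"
        using U x by (meson openE subsetD)
      obtain a b where ab: "a < x" "x < b" "b - a < min d e" "f b - f a \<le> q * (b - a)"
        using cov[OF x, of "min d e"] d e by auto
      have "{a<..<b} \<subseteq> ball x e"
        using ab by (auto simp: dist_real_def)
      then have "(a, b) \<in> K"
        using ab e by (auto simp: K_def)
      then show ?thesis
        unfolding ball_I using ab d by (intro exI[of _ "(a, b)"]) (auto simp: I_def r_def)
    qed
    then obtain F where F: "countable F" "F \<subseteq> K"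
      and disj: "pairwise (\<lambda>i j. disjnt (ball (c i) (r i)) (ball (c j) (r j))) F"
      and neg: "negligible (E - (\<Union>i\<in>F. ball (c i) (r i)))"
      by (rule Vitali_covering_theorem_balls)
    define N where "N = E - (\<Union>i\<in>F. I i)"
    have I_sets[measurable]: "I i \<in> sets borel" for i
      by (cases i) (auto simp: I_def)
    have N_sets: "N \<in> sets borel"
      unfolding N_def using E F by (intro sets.Diff sets.countable_UN'') auto
    have "negligible (f ` N)"
    proof (rule negligible_locally_Lipschitz_image)
      show "negligible N"
        using neg by (simp add: N_def ball_I)
      show "\<exists>T B. open T \<and> x \<in> T \<and> (\<forall>y\<in>N \<inter> T. norm (f y - f x) \<le> B * norm (y - x))" for x
        using lip by (intro exI[of _ UNIV] exI[of _ C]) (auto simp: lipschitz_on_def dist_norm)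
    qed auto
    then have fN: "emeasure lborel (f ` N) = 0"
      using img_sets[OF N_sets] by (simp add: negligible_iff_null_sets null_sets_def)
    have dI: "disjoint_family_on I F"
      using disj unfolding ball_I by (auto simp: disjoint_family_on_def pairwise_def disjnt_def)
    have dfI: "disjoint_family_on (\<lambda>i. f ` I i) F"
      using dI unfolding image_vimage disjoint_family_on_def by (metis vimage_Int vimage_empty)
    have le_I: "emeasure lborel (f ` I i) \<le> ennreal q * emeasure lborel (I i)" if "i \<in> F" for i
    proof -
      obtain a b where ab: "i = (a, b)" "a < b" "f b - f a \<le> q * (b - a)"
        using \<open>i \<in> F\<close> F by (auto simp: K_def)
      have "f ` I i = {f a<..<f b}"
        unfolding ab I_def image_vimage using hmono[of "f a"] hmono[of _ "f b"] hf by auto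
      moreover have "f a < f b"
        using mono ab by (simp add: strict_mono_def)
      ultimately show ?thesis
        using ab q by (simp add: I_def flip: ennreal_mult)
    qed
    have "f ` E \<subseteq> (\<Union>i\<in>F. f ` I i) \<union> f ` N"
      unfolding N_def by blast
    then have "emeasure lborel (f ` E) \<le> emeasure lborel ((\<Union>i\<in>F. f ` I i) \<union> f ` N)"
      using F N_sets by (intro emeasure_mono) (auto intro!: sets.countable_UN'')
    also have "\<dots> \<le> emeasure lborel (\<Union>i\<in>F. f ` I i) + emeasure lborel (f ` N)"
      using F N_sets by (intro emeasure_subadditive) (auto intro!: sets.countable_UN'')
    also have "\<dots> = (\<integral>\<^sup>+i. emeasure lborel (f ` I i) \<partial>count_space F)"
      using F dfI by (simp add: fN emeasure_UN_countable)
    also have "\<dots> \<le> (\<integral>\<^sup>+i. ennreal q * emeasure lborel (I i) \<partial>count_space F)"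
      using le_I by (intro nn_integral_mono) auto
    also have "\<dots> = ennreal q * emeasure lborel (\<Union>i\<in>F. I i)"
      using F dI by (simp add: nn_integral_cmult emeasure_UN_countable)
    also have "\<dots> \<le> ennreal q * emeasure lborel U"
      using F U by (intro mult_left_mono emeasure_mono) (auto simp: K_def I_def)
    finally show ?thesis .
  qed
  show ?thesis
  proof (rule ennreal_le_epsilon)
    fix e :: real assume e: "0 < e"
    have "0 < e / (q + 1)"
      using e q by simp
    then obtain U where U: "open U" "E \<subseteq> U" "emeasure lborel (U - E) < ennreal (e / (q + 1))"
      by (rule outer_regular_lborel[OF E])
    have "emeasure lborel U = emeasure lborel E + emeasure lborel (U - E)"
      using U E by (subst plus_emeasure) (auto simp: Un_absorb1)
    also have "\<dots> \<le> emeasure lborel E + ennreal (e / (q + 1))"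
      using U by (intro add_left_mono) auto
    finally have "ennreal q * emeasure lborel U \<le> ennreal q * (emeasure lborel E + ennreal (e / (q + 1)))"
      by (intro mult_left_mono) auto
    also have "\<dots> \<le> ennreal q * emeasure lborel E + ennreal e"
      using q e by (auto simp: distrib_left field_simps simp flip: ennreal_mult intro!: add_left_mono ennreal_leI)
    finally show "emeasure lborel (f ` E) \<le> ennreal q * emeasure lborel E + ennreal e"
      using open_bound[OF U(1,2)] by simp
  qed
qed

text \<open>
  Adding a linear term makes the function bi-Lipschitz and increasing. At a point of
  non-differentiability two rationals \<open>p < q\<close> separate the slopes of arbitrarily short intervals around the point.
  On the set \<open>E p q\<close> of these points the previous lemma, applied to the function and to its inverse,
  gives \<open>q \<mu>(E) \<le> \<mu>(F ` E) \<le> p \<mu>(E)\<close>, so \<open>E p q\<close> is a null set.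
\<close>
lemma lipschitz_negligible_not_differentiable:
  fixes f :: "real \<Rightarrow> real"
  assumes lip: "C-lipschitz_on UNIV f"
  shows "negligible {x. \<not> f differentiable (at x)}"
proof -
  have C: "0 \<le> C"
    using lip by (rule lipschitz_on_nonneg)
  have flip: "\<bar>f x - f y\<bar> \<le> C * \<bar>x - y\<bar>" for x y
    using lipschitz_onD[OF lip, of x y] by (simp add: dist_real_def)
  define F where "F x = f x + (C + 1) * x" for x
  have F_ge: "b - a \<le> F b - F a" and F_le: "F b - F a \<le> (2 * C + 1) * (b - a)" if "a \<le> b" for a b
    using flip[of b a] that by (auto simp: F_def algebra_simps)
  have mono: "strict_mono F"
  proof (rule strict_monoI)
    fix x y :: real assume "x < y"
    then show "F x < F y" using F_ge[of x y] by simp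
  qed
  have Flip: "(2 * C + 1)-lipschitz_on UNIV F"
  proof (rule lipschitz_onI)
    fix x y :: real
    show "dist (F x) (F y) \<le> (2 * C + 1) * dist x y"
      using F_ge[of x y] F_le[of x y] F_ge[of y x] F_le[of y x]
      by (cases "x \<le> y") (auto simp: dist_real_def abs_if)
  qed (use C in auto)
  have Fcont: "continuous_on UNIV F"
    using Flip by (rule lipschitz_on_continuous_on)
  have surj: "\<exists>x. F x = y" for y
  proof -
    define a where "a = - \<bar>y - F 0\<bar>"
    define b where "b = \<bar>y - F 0\<bar>"
    have "F a \<le> y" "y \<le> F b" "a \<le> b"
      using F_ge[of a 0] F_ge[of 0 b] by (auto simp: a_def b_def)
    then show ?thesis
      using IVT'[of F a y b] Fcont continuous_on_subset by blast
  qed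
  define h where "h = inv F"
  have Fh: "F (h y) = y" for y
    unfolding h_def using surj by (metis f_inv_into_f rangeI)
  have hF: "h (F x) = x" for x
    using mono Fh by (metis strict_mono_eq)
  have hlip: "1-lipschitz_on UNIV h"
  proof (rule lipschitz_onI)
    fix x y :: real
    show "dist (h x) (h y) \<le> 1 * dist x y"
      using F_ge[of "h x" "h y"] F_ge[of "h y" "h x"]
      by (cases "h x \<le> h y") (auto simp: dist_real_def Fh abs_if)
  qed auto
  have hcont: "continuous_on UNIV h"
    using hlip by (rule lipschitz_on_continuous_on)
  have hmono: "strict_mono h"
    using mono Fh by (metis strict_mono_def strict_mono_less)
  define G where "G q n = \<Union> {{a<..<b} | a b. a < b \<and> b - a < 1 / Suc n \<and> F b - F a < q * (b - a)}" for q n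
  define H where "H q n = \<Union> {{a<..<b} | a b. a < b \<and> b - a < 1 / Suc n \<and> F b - F a > q * (b - a)}" for q n
  define E where "E p q = (\<Inter>n. G p n) \<inter> (\<Inter>n. H q n)" for p q
  have GI: "x \<in> G q n" if "a < x" "x < b" "b - a < 1 / real (Suc n)" "F b - F a < q * (b - a)" for x a b q n
    unfolding G_def using that by (intro UnionI[of "{a<..<b}"] CollectI exI[of _ a] exI[of _ b]) auto
  have HI: "x \<in> H q n" if "a < x" "x < b" "b - a < 1 / real (Suc n)" "F b - F a > q * (b - a)" for x a b q n
    unfolding H_def using that by (intro UnionI[of "{a<..<b}"] CollectI exI[of _ a] exI[of _ b]) auto
  \<comment> \<open>Open intervals around the point, rather than intervals with the point as an end, make \<open>E p q\<close> a Borel set.\<close>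
  have GH_open: "open (G q n)" "open (H q n)" for q n
    unfolding G_def H_def by (auto intro!: open_Union)
  have small: "\<exists>n. 1 / real (Suc n) < d" if "0 < d" for d :: real
    using nat_approx_posE[OF that] by metis
  have E_sets: "E p q \<in> sets borel" for p q
    unfolding E_def using GH_open by (intro sets.Int sets.countable_INT'') auto
  have E_null: "emeasure lborel (E p q) = 0" if pq: "0 < p" "p < q" for p q
  proof -
    define B where "B k = E p q \<inter> {- real k..real k}" for k :: nat
    have B_sets: "B k \<in> sets borel" for k
      unfolding B_def using E_sets by auto
    have "emeasure lborel (B k) = 0" for k
    proof -
      have le1: "emeasure lborel (F ` B k) \<le> ennreal p * emeasure lborel (B k)"
      proof (rule emeasure_image_slope_le[OF Flip mono hF Fh hcont B_sets])
        fix x d :: real assume x: "x \<in> B k" and d: "0 < d"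
        obtain n where n: "1 / real (Suc n) < d" using small d by blast
        have "x \<in> G p n" using x by (auto simp: B_def E_def)
        then obtain a b where "a < x" "x < b" "b - a < 1 / Suc n" "F b - F a < p * (b - a)"
          unfolding G_def by auto
        then show "\<exists>a b. a < x \<and> x < b \<and> b - a < d \<and> F b - F a \<le> p * (b - a)"
          using n by (intro exI[of _ a] exI[of _ b]) auto
      qed (use pq in auto)
      have FB_sets: "F ` B k \<in> sets borel"
      proof -
        have "F ` B k = h -` B k" using hF Fh by (auto simp: image_iff) metis
        then show ?thesis
          using borel_measurable_continuous_onI[OF hcont] B_sets by (metis measurable_sets_borel)
      qed
      have le2: "emeasure lborel (h ` (F ` B k)) \<le> ennreal (1 / q) * emeasure lborel (F ` B k)"
      proof (rule emeasure_image_slope_le[OF hlip hmono Fh hF Fcont FB_sets])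
        fix y d :: real assume y: "y \<in> F ` B k" and d: "0 < d"
        obtain x where x: "x \<in> B k" "y = F x" using y by auto
        obtain n where n: "1 / real (Suc n) < d / (2 * C + 1)"
          using small[of "d / (2 * C + 1)"] d C by auto
        have "x \<in> H q n" using x by (auto simp: B_def E_def)
        then obtain a b where ab: "a < x" "x < b" "b - a < 1 / Suc n" "F b - F a > q * (b - a)"
          unfolding H_def by auto
        have "F b - F a \<le> (2 * C + 1) * (b - a)"
          using ab by (intro F_le) auto
        also have "\<dots> < (2 * C + 1) * (d / (2 * C + 1))"
          using ab n C by (intro mult_strict_left_mono) auto
        finally have "F b - F a < d" using C by auto
        moreover have "F a < y" "y < F b"
          using ab x mono by (auto simp: strict_mono_def)
        moreover have "h (F b) - h (F a) \<le> 1 / q * (F b - F a)"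
          using ab pq by (simp add: hF field_simps)
        ultimately show "\<exists>a b. a < y \<and> y < b \<and> b - a < d \<and> h b - h a \<le> 1 / q * (b - a)"
          by blast
      qed (use pq in auto)
      have hFB: "h ` (F ` B k) = B k"
        using hF by (auto simp: image_image)
      have fin: "emeasure lborel (B k) < \<infinity>"
      proof -
        have "emeasure lborel (B k) \<le> emeasure lborel {- real k..real k}"
          unfolding B_def by (intro emeasure_mono) auto
        also have "\<dots> < \<infinity>" by simp
        finally show ?thesis .
      qed
      obtain m where m: "emeasure lborel (B k) = ennreal m" "0 \<le> m"
        using fin by (cases "emeasure lborel (B k)") auto
      have "ennreal m \<le> ennreal (1 / q) * (ennreal p * ennreal m)"
        using order_trans[OF le2 mult_left_mono[OF le1, of "ennreal (1 / q)"]] m hFB by simp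
      also have "\<dots> = ennreal (1 / q * (p * m))"
        using pq m by (simp flip: ennreal_mult)
      finally have "m \<le> 1 / q * (p * m)"
        using pq m by (subst (asm) ennreal_le_iff) auto
      then have "(q - p) * m \<le> 0"
        using pq by (simp add: field_simps)
      then have "m = 0"
        using pq m by (simp add: mult_le_0_iff)
      then show ?thesis using m by simp
    qed
    moreover have "E p q = (\<Union>k. B k)"
    proof -
      have "\<exists>k::nat. x \<in> {- real k..real k}" for x :: real
        using real_arch_simple[of "\<bar>x\<bar>"] by (auto simp: abs_le_iff) (metis minus_le_iff)
      then show ?thesis by (auto simp: B_def)
    qed
    ultimately show ?thesis
      using B_sets by (simp add: emeasure_UN_eq_0 image_subset_iff)
  qed
  have diff: "F differentiable (at x)"
    if x: "\<And>p q. p \<in> \<rat> \<Longrightarrow> q \<in> \<rat> \<Longrightarrow> 0 < p \<Longrightarrow> p < q \<Longrightarrow> x \<notin> E p q" for x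
  proof -
    define S where "S = {q. \<forall>n. x \<in> H q n}"
    have SI: "0 \<in> S"
    proof -
      have "x \<in> H 0 n" for n
      proof -
        define e where "e = 1 / (4 * Suc n :: real)"
        have e: "0 < e" "e + e < 1 / Suc n" by (auto simp: e_def field_simps)
        have "F (x + e) - F (x - e) > 0 * ((x + e) - (x - e))"
          using mono e by (simp add: strict_mono_def)
        then show ?thesis
          using e by (intro HI[of "x - e" _ "x + e"]) auto
      qed
      then show ?thesis by (simp add: S_def)
    qed
    have S_le: "q \<le> 2 * C + 1" if "q \<in> S" for q
    proof -
      obtain a b where ab: "a < b" "F b - F a > q * (b - a)"
      proof -
        have "x \<in> H q 0" using \<open>q \<in> S\<close> by (simp add: S_def)
        then show thesis using that unfolding H_def by auto
      qed
      then have "q * (b - a) < (2 * C + 1) * (b - a)"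
        using F_le[of a b] by (intro less_le_trans[OF ab(2)]) simp
      then have "q < 2 * C + 1"
        using ab(1) by (subst (asm) mult_less_cancel_right_pos) auto
      then show ?thesis by simp
    qed
    then have bdd: "bdd_above S" by (auto simp: bdd_above_def)
    define D where "D = Sup S"
    have upper: "\<exists>d>0. \<forall>a b. a < x \<longrightarrow> x < b \<longrightarrow> b - a < d \<longrightarrow> F b - F a \<le> (D + e) * (b - a)"
      if e: "0 < e" for e
    proof -
      have "D + e \<notin> S" using cSup_upper[OF _ bdd, of "D + e"] e by (auto simp: D_def)
      then obtain n where n: "x \<notin> H (D + e) n" by (auto simp: S_def)
      show ?thesis
      proof (intro exI[of _ "1 / real (Suc n)"] conjI allI impI)
        fix a b :: real assume ab: "a < x" "x < b" "b - a < 1 / real (Suc n)"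
        show "F b - F a \<le> (D + e) * (b - a)"
        proof (rule ccontr)
          assume "\<not> F b - F a \<le> (D + e) * (b - a)"
          then show False using n HI[OF ab, of "D + e"] by linarith
        qed
      qed auto
    qed
    have D_ge: "1 \<le> D + e" if "0 < e" for e
    proof -
      obtain d where d: "d > 0" "\<And>a b. a < x \<Longrightarrow> x < b \<Longrightarrow> b - a < d \<Longrightarrow> F b - F a \<le> (D + e) * (b - a)"
        using upper[of e] \<open>0 < e\<close> by auto
      define w where "w = (x + d / 3) - (x - d / 3)"
      have w: "0 < w" "F (x + d / 3) - F (x - d / 3) \<le> (D + e) * w" "w \<le> F (x + d / 3) - F (x - d / 3)"
        using d(2)[of "x - d / 3" "x + d / 3"] F_ge[of "x - d / 3" "x + d / 3"] d(1) by (auto simp: w_def)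
      then have "1 * w \<le> (D + e) * w" by linarith
      then show ?thesis using w(1) by (subst (asm) mult_le_cancel_right_pos) auto
    qed
    then have D1: "1 \<le> D" by (rule field_le_epsilon)
    have lower: "\<exists>d>0. \<forall>a b. a < x \<longrightarrow> x < b \<longrightarrow> b - a < d \<longrightarrow> (D - e) * (b - a) \<le> F b - F a"
      if e: "0 < e" for e
    proof -
      obtain q0 where q0: "q0 \<in> S" "max (1/2) (D - e) < q0"
        using less_cSupD[of S "max (1/2) (D - e)"] SI D1 e by (auto simp: D_def)
      obtain q where q: "q \<in> \<rat>" "max (1/2) (D - e) < q" "q < q0"
        using Rats_dense_in_real q0 by blast
      obtain p where p: "p \<in> \<rat>" "max (1/2) (D - e) < p" "p < q"
        using Rats_dense_in_real q by blast
      have "x \<in> H q n" for n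
      proof -
        have "x \<in> H q0 n" using q0 by (auto simp: S_def)
        then obtain a b where ab: "a < b" "b - a < 1 / Suc n" "F b - F a > q0 * (b - a)" "a < x" "x < b"
          unfolding H_def by auto
        have "q * (b - a) < q0 * (b - a)" using ab q by (intro mult_strict_right_mono) auto
        then show ?thesis
          using ab by (intro HI[of a _ b]) linarith+
      qed
      moreover have "x \<notin> E p q" using x p q by auto
      ultimately obtain n where n: "x \<notin> G p n" by (auto simp: E_def)
      show ?thesis
      proof (intro exI[of _ "1 / real (Suc n)"] conjI allI impI)
        fix a b :: real assume ab: "a < x" "x < b" "b - a < 1 / real (Suc n)"
        have "p * (b - a) \<le> F b - F a"
        proof (rule ccontr)
          assume "\<not> p * (b - a) \<le> F b - F a"
          then show False using n GI[OF ab, of p] by linarith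
        qed
        moreover have "(D - e) * (b - a) \<le> p * (b - a)" using ab p by (intro mult_right_mono) auto
        ultimately show "(D - e) * (b - a) \<le> F b - F a" by linarith
      qed auto
    qed
    \<comment> \<open>The slopes over intervals around \<open>x\<close> converge to \<open>D\<close>; letting one end of the interval tend to \<open>x\<close> gives the derivative.\<close>
    have "(F has_derivative (\<lambda>y. y * D)) (at x)"
      unfolding has_derivative_at_alt
    proof (intro conjI allI impI)
      fix e :: real assume e: "0 < e"
      obtain d1 where d1: "d1 > 0" "\<And>a b. a < x \<Longrightarrow> x < b \<Longrightarrow> b - a < d1 \<Longrightarrow> F b - F a \<le> (D + e) * (b - a)"
        using upper[OF e] by auto
      obtain d2 where d2: "d2 > 0" "\<And>a b. a < x \<Longrightarrow> x < b \<Longrightarrow> b - a < d2 \<Longrightarrow> (D - e) * (b - a) \<le> F b - F a"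
        using lower[OF e] by auto
      define d where "d = min d1 d2"
      have d: "d > 0" and near: "\<And>a b. a < x \<Longrightarrow> x < b \<Longrightarrow> b - a < d \<Longrightarrow> \<bar>F b - F a - D * (b - a)\<bar> \<le> e * (b - a)"
        using d1 d2 by (fastforce simp: d_def abs_le_iff algebra_simps)+
      have Ft: "(F \<longlongrightarrow> F x) (at x within T)" for T
        using Fcont by (meson UNIV_I continuous_on_def subset_UNIV tendsto_within_subset)
      have "norm (F y - F x - (y - x) * D) \<le> e * norm (y - x)" if y: "norm (y - x) < d" for y
      proof (cases y x rule: linorder_cases)
        case less
        have "((\<lambda>b. e * (b - y) - \<bar>F b - F y - D * (b - y)\<bar>) \<longlongrightarrow> e * (x - y) - \<bar>F x - F y - D * (x - y)\<bar>) (at_right x)"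
          by (intro tendsto_intros Ft)
        moreover have "eventually (\<lambda>b. 0 \<le> e * (b - y) - \<bar>F b - F y - D * (b - y)\<bar>) (at_right x)"
          unfolding eventually_at_right_field using near[of y] less y
          by (intro exI[of _ "y + d"]) auto
        ultimately have "0 \<le> e * (x - y) - \<bar>F x - F y - D * (x - y)\<bar>"
          by (rule tendsto_lowerbound) auto
        then show ?thesis using less by (auto simp: abs_if algebra_simps split: if_splits)
      next
        case greater
        have "((\<lambda>a. e * (y - a) - \<bar>F y - F a - D * (y - a)\<bar>) \<longlongrightarrow> e * (y - x) - \<bar>F y - F x - D * (y - x)\<bar>) (at_left x)"
          by (intro tendsto_intros Ft)
        moreover have "eventually (\<lambda>a. 0 \<le> e * (y - a) - \<bar>F y - F a - D * (y - a)\<bar>) (at_left x)"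
          unfolding eventually_at_left_field using near[of _ y] greater y
          by (intro exI[of _ "y - d"]) auto
        ultimately have "0 \<le> e * (y - x) - \<bar>F y - F x - D * (y - x)\<bar>"
          by (rule tendsto_lowerbound) auto
        then show ?thesis using greater by (auto simp: abs_if algebra_simps split: if_splits)
      qed auto
      then show "\<exists>d>0. \<forall>y. norm (y - x) < d \<longrightarrow> norm (F y - F x - (y - x) * D) \<le> e * norm (y - x)"
        using d by blast
    qed (rule bounded_linear_mult_left)
    then show ?thesis by (auto simp: differentiable_def)
  qed
  have sub: "{x. \<not> f differentiable (at x)} \<subseteq> (\<Union>p\<in>\<rat> \<inter> {0<..}. \<Union>q\<in>\<rat> \<inter> {p<..}. E p q)"
  proof
    fix x assume "x \<in> {x. \<not> f differentiable (at x)}"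
    then have nd: "\<not> f differentiable (at x)" by simp
    have "\<not> F differentiable (at x)"
    proof
      assume "F differentiable (at x)"
      then have "(\<lambda>y. F y - (C + 1) * y) differentiable (at x)"
        by (intro derivative_intros) auto
      then show False using nd by (simp add: F_def)
    qed
    then show "x \<in> (\<Union>p\<in>\<rat> \<inter> {0<..}. \<Union>q\<in>\<rat> \<inter> {p<..}. E p q)"
      using diff by fastforce
  qed
  have null: "E p q \<in> null_sets lborel" if "0 < p" "p < q" for p q
    using E_null[OF that] E_sets by (auto simp: null_sets_def)
  have cR: "countable (\<rat> \<inter> A)" for A :: "real set"
    using countable_rat by (rule countable_subset[rotated]) auto
  have "(\<Union>p\<in>\<rat> \<inter> {0<..}. \<Union>q\<in>\<rat> \<inter> {p<..}. E p q) \<in> null_sets lborel"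
    using null cR by (intro null_sets_UN' ) auto
  then have "negligible (\<Union>p\<in>\<rat> \<inter> {0<..}. \<Union>q\<in>\<rat> \<inter> {p<..}. E p q)"
    by (simp add: negligible_iff_null_sets null_sets_completionI)
  then show ?thesis
    using sub negligible_subset by blast
qed

lemma lipschitz_AE_has_vector_derivative:
  fixes f :: "real \<Rightarrow> complex"
  assumes lip: "C-lipschitz_on UNIV f"
  shows "AE s in lebesgue. (f has_vector_derivative vector_derivative f (at s)) (at s)"
proof -
  have "dist (Re (f x)) (Re (f y)) \<le> C * dist x y" "dist (Im (f x)) (Im (f y)) \<le> C * dist x y" for x y
  proof -
    have "dist (Re (f x)) (Re (f y)) \<le> dist (f x) (f y)" "dist (Im (f x)) (Im (f y)) \<le> dist (f x) (f y)"
      using abs_Re_le_cmod[of "f x - f y"] abs_Im_le_cmod[of "f x - f y"]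
      by (auto simp: dist_real_def dist_norm)
    then show "dist (Re (f x)) (Re (f y)) \<le> C * dist x y" "dist (Im (f x)) (Im (f y)) \<le> C * dist x y"
      using lipschitz_onD[OF lip, of x y] by auto
  qed
  then have "C-lipschitz_on UNIV (\<lambda>x. Re (f x))" "C-lipschitz_on UNIV (\<lambda>x. Im (f x))"
    using lipschitz_on_nonneg[OF lip] by (auto intro!: lipschitz_onI)
  from this[THEN lipschitz_negligible_not_differentiable]
  have "AE s in lebesgue. (\<lambda>x. Re (f x)) differentiable (at s) \<and> (\<lambda>x. Im (f x)) differentiable (at s)"
    by (auto simp: negligible_iff_null_sets dest!: AE_not_in)
  then show ?thesis
  proof eventually_elim
    case (elim s)
    then obtain d1 d2 where d: "((\<lambda>x. Re (f x)) has_field_derivative d1) (at s)"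
        "((\<lambda>x. Im (f x)) has_field_derivative d2) (at s)"
      by (auto simp: real_differentiable_def)
    then have "(f has_vector_derivative Complex d1 d2) (at s)"
      by (simp add: has_vector_derivative_complex_iff)
    then show ?case
      by (simp add: vector_derivative_at)
  qed
qed

lemma has_vector_derivative_imp_LIMSEQ:
  fixes f :: "real \<Rightarrow> complex"
  assumes "(f has_vector_derivative d) (at x)"
  shows "(\<lambda>n. (f (x + 1 / Suc n) - f x) * of_nat (Suc n)) \<longlonglongrightarrow> d"
proof -
  have h: "filterlim (\<lambda>n. 1 / real (Suc n)) (at 0) sequentially"
    unfolding filterlim_at using lim_inverse_n' filterlim_compose[OF lim_inverse_n' filterlim_Suc]
    by (auto simp: o_def)
  have *: "(\<lambda>n. (k (x + 1 / Suc n) - k x) * real (Suc n)) \<longlonglongrightarrow> c"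
    if "(k has_field_derivative c) (at x)" for k :: "real \<Rightarrow> real" and c
    using filterlim_compose[OF that[unfolded DERIV_def] h] by (simp add: divide_inverse del: of_nat_Suc)
  from assms have "((\<lambda>x. Re (f x)) has_field_derivative Re d) (at x)" "((\<lambda>x. Im (f x)) has_field_derivative Im d) (at x)"
    by (auto simp: has_vector_derivative_complex_iff)
  from this[THEN *] show ?thesis
    by (simp add: tendsto_complex_iff del: of_nat_Suc)
qed

locale lipschitz_curve =
  fixes L :: real and \<gamma> :: "real \<Rightarrow> complex"
  assumes L: "0 < L" and lip: "1-lipschitz_on {0..L} \<gamma>"
begin

abbreviation D :: "real \<Rightarrow> complex" where "D s \<equiv> vector_derivative \<gamma> (at s)"

text \<open>
  Difference quotients near the ends of \<open>{0..L}\<close> use values outside the interval; the constant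
  extension keeps the Lipschitz constant.
\<close>
definition clamped :: "real \<Rightarrow> complex" where "clamped s = \<gamma> (max 0 (min s L))"

lemma clamped_eq: "s \<in> {0..L} \<Longrightarrow> clamped s = \<gamma> s"
  by (auto simp: clamped_def min_def max_def)

lemma clamped_lipschitz: "1-lipschitz_on UNIV clamped"
proof (rule lipschitz_onI)
  fix x y :: real
  have "dist (clamped x) (clamped y) \<le> 1 * dist (max 0 (min x L)) (max 0 (min y L))"
    unfolding clamped_def using L by (intro lipschitz_onD[OF lip]) auto
  also have "\<dots> \<le> 1 * dist x y" by (auto simp: dist_real_def)
  finally show "dist (clamped x) (clamped y) \<le> 1 * dist x y" .
qed simp

lemma continuous_clamped: "continuous_on A clamped"
  using lipschitz_on_continuous_on[OF clamped_lipschitz] continuous_on_subset by blast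

definition quot :: "nat \<Rightarrow> real \<Rightarrow> complex" where
  "quot n s = (clamped (s + 1 / Suc n) - clamped s) * of_nat (Suc n)"

lemma norm_quot_le: "norm (quot n s) \<le> 1"
proof -
  have "dist (clamped (s + 1 / Suc n)) (clamped s) \<le> 1 * dist (s + 1 / Suc n) s"
    by (rule lipschitz_onD[OF clamped_lipschitz]) auto
  then show ?thesis
    by (simp add: quot_def norm_mult norm_of_nat dist_norm pos_le_divide_eq del: of_nat_Suc)
qed

lemma quot_tendsto_AE: "AE s in lebesgue. s \<in> {0<..<L} \<longrightarrow> (\<lambda>n. quot n s) \<longlonglongrightarrow> D s"
  using lipschitz_AE_has_vector_derivative[OF clamped_lipschitz]
proof eventually_elim
  case (elim s)
  show ?case
  proof
    assume s: "s \<in> {0<..<L}"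
    define d where "d = vector_derivative clamped (at s)"
    have "(\<gamma> has_vector_derivative d) (at s)"
      using elim unfolding d_def
      by (rule has_vector_derivative_transform_within_open[of _ _ _ "{0<..<L}"]) (use s clamped_eq in auto)
    then have d: "D s = d" by (simp add: vector_derivative_at)
    show "(\<lambda>n. quot n s) \<longlonglongrightarrow> D s"
      using has_vector_derivative_imp_LIMSEQ[OF elim] by (simp add: quot_def d d_def del: of_nat_Suc)
  qed
qed

lemma AE_interior: "AE s in lebesgue. s \<in> {0..L} \<longrightarrow> s \<in> {0<..<L}"
proof -
  have "{0, L} \<in> null_sets lebesgue"
    by (auto simp flip: negligible_iff_null_sets)
  from AE_not_in[OF this] show ?thesis by eventually_elim auto
qed

lemma quot_measurable: "quot n \<in> borel_measurable borel"
  unfolding quot_def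
  by (intro borel_measurable_continuous_onI continuous_intros continuous_on_compose2[OF continuous_clamped]) auto

lemma D_measurable: "(\<lambda>s. indicator {0..L} s *\<^sub>R D s) \<in> borel_measurable lebesgue"
proof (rule borel_measurable_AE)
  show "(\<lambda>s. lim (\<lambda>n. indicator {0..L} s *\<^sub>R quot n s)) \<in> borel_measurable lebesgue"
    by (intro borel_measurable_lim_metric measurable_completion)
      (auto intro!: borel_measurable_scaleR quot_measurable)
  show "AE s in lebesgue. lim (\<lambda>n. indicator {0..L} s *\<^sub>R quot n s) = indicator {0..L} s *\<^sub>R D s"
    using quot_tendsto_AE AE_interior
    by eventually_elim (auto intro!: limI simp: indicator_def)
qed

lemma norm_D_le: "AE s in lebesgue. norm (indicator {0..L} s *\<^sub>R D s) \<le> 1"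
  using quot_tendsto_AE AE_interior
proof eventually_elim
  case (elim s)
  show ?case
  proof (cases "s \<in> {0..L}")
    case True
    then have "(\<lambda>n. quot n s) \<longlonglongrightarrow> D s" using elim by auto
    then have "(\<lambda>n. norm (quot n s)) \<longlonglongrightarrow> norm (D s)" by (rule tendsto_norm)
    then have "norm (D s) \<le> 1" by (rule LIMSEQ_le_const2) (use norm_quot_le in auto)
    then show ?thesis using True by simp
  qed auto
qed

text \<open>
  The difference quotients are bounded by \<open>1\<close> and converge to \<open>D\<close> almost everywhere, so their
  integrals converge to that of \<open>D\<close>; on the other hand these integrals are difference quotients of an
  antiderivative of the continuous function \<open>clamped\<close>.
\<close>
lemma integral_D:
  assumes ab: "0 \<le> a" "a \<le> b" "b \<le> L"
  shows "(LINT s:{a..b}|lebesgue. D s) = \<gamma> b - \<gamma> a"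
proof -
  define P where "P x = integral {-1..x} clamped" for x
  have P: "(P has_vector_derivative clamped x) (at x)" if "x \<in> {-1<..<L+2}" for x
  proof -
    have "(P has_vector_derivative clamped x) (at x within {-1..L+2})"
      unfolding P_def using that by (intro integral_has_vector_derivative continuous_clamped) auto
    then show ?thesis using that by (metis at_within_Icc_at greaterThanLessThan_iff)
  qed
  have int_shift: "integral {a..b} (\<lambda>s. clamped (s + h)) = P (b + h) - P (a + h)" if h: "0 \<le> h" "h \<le> 1" for h
  proof (rule integral_unique, rule fundamental_theorem_of_calculus[OF ab(2)])
    fix x assume x: "x \<in> {a..b}"
    have "((P \<circ> (\<lambda>s. s + h)) has_vector_derivative 1 *\<^sub>R clamped (x + h)) (at x within {a..b})"
      using x ab h by (intro vector_diff_chain_within derivative_eq_intros has_vector_derivative_at_within[OF P]) auto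
    then show "((\<lambda>s. P (s + h)) has_vector_derivative clamped (x + h)) (at x within {a..b})"
      by (simp add: o_def)
  qed
  have set_int: "set_integrable lebesgue {a..b} (\<lambda>s. clamped (s + h))" for h
    by (intro absolutely_integrable_continuous_real continuous_on_compose2[OF continuous_clamped] continuous_intros) auto
  have int_quot: "(LINT s:{a..b}|lebesgue. quot n s) =
      (P (b + 1 / Suc n) - P b) * of_nat (Suc n) - (P (a + 1 / Suc n) - P a) * of_nat (Suc n)" for n
  proof -
    have "(LINT s:{a..b}|lebesgue. quot n s) =
        ((LINT s:{a..b}|lebesgue. clamped (s + 1 / Suc n)) - (LINT s:{a..b}|lebesgue. clamped (s + 0))) * of_nat (Suc n)"
      unfolding quot_def using set_int[of "1 / Suc n"] set_int[of 0]
      by (simp add: set_integral_diff)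
    also have "\<dots> = (integral {a..b} (\<lambda>s. clamped (s + 1 / Suc n)) - integral {a..b} (\<lambda>s. clamped (s + 0))) * of_nat (Suc n)"
      by (simp only: set_lebesgue_integral_eq_integral(2)[OF set_int])
    also have "\<dots> = ((P (b + 1 / Suc n) - P (a + 1 / Suc n)) - (P (b + 0) - P (a + 0))) * of_nat (Suc n)"
      by (subst (1 2) int_shift) auto
    finally show ?thesis by (simp add: algebra_simps)
  qed
  have P_quot: "(\<lambda>n. (P (x + 1 / Suc n) - P x) * of_nat (Suc n)) \<longlonglongrightarrow> clamped x" if "x \<in> {0..L}" for x
    using that L by (intro has_vector_derivative_imp_LIMSEQ P) auto
  have lim1: "(\<lambda>n. LINT s:{a..b}|lebesgue. quot n s) \<longlonglongrightarrow> clamped b - clamped a"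
    unfolding int_quot using ab by (intro tendsto_diff P_quot) auto
  have lim2: "(\<lambda>n. LINT s:{a..b}|lebesgue. quot n s) \<longlonglongrightarrow> (LINT s:{a..b}|lebesgue. D s)"
    unfolding set_lebesgue_integral_def
  proof (rule integral_dominated_convergence)
    have "(\<lambda>s. indicator {a..b} s *\<^sub>R (indicator {0..L} s *\<^sub>R D s)) \<in> borel_measurable lebesgue"
      by (rule borel_measurable_scaleR[OF measurable_completion D_measurable]) simp
    moreover have "(\<lambda>s. indicator {a..b} s *\<^sub>R (indicator {0..L} s *\<^sub>R D s)) = (\<lambda>s. indicator {a..b} s *\<^sub>R D s)"
      using ab by (auto simp: indicator_def)
    ultimately show "(\<lambda>s. indicator {a..b} s *\<^sub>R D s) \<in> borel_measurable lebesgue" by simp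
    show "(\<lambda>s. indicator {a..b} s *\<^sub>R quot n s) \<in> borel_measurable lebesgue" for n
      using quot_measurable by (intro borel_measurable_scaleR measurable_completion) auto
    show "integrable lebesgue (indicator {a..b} :: real \<Rightarrow> real)"
      by (intro integrable_completion[THEN iffD2] integrable_real_indicator) (use ab in auto)
    show "AE s in lebesgue. (\<lambda>n. indicator {a..b} s *\<^sub>R quot n s) \<longlonglongrightarrow> indicator {a..b} s *\<^sub>R D s"
      using quot_tendsto_AE AE_interior
      by eventually_elim (use ab in \<open>auto simp: indicator_def\<close>)
    show "AE s in lebesgue. norm (indicator {a..b} s *\<^sub>R quot n s) \<le> indicator {a..b} s" for n
      using norm_quot_le by (auto simp: indicator_def)
  qed
  show ?thesis
    using LIMSEQ_unique[OF lim2 lim1] clamped_eq ab by simp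
qed

end

section \<open>Arc length on a rectifiable Jordan curve\<close>

lemma polygonal_lengths_monotone:
  fixes u :: "nat \<Rightarrow> real"
  assumes "\<forall>i<n. u i \<le> u (Suc i)" "i \<le> j" "j \<le> n"
  shows "u i \<le> u j"
  using assms(2,3)
proof (induction j rule: dec_induct)
  case (step k)
  then show ?case using assms(1) by (meson Suc_le_lessD less_imp_le order_trans)
qed simp

lemma dist_in_polygonal_lengths:
  assumes "a \<le> b"
  shows "dist (g a) (g b) \<in> polygonal_lengths g a b"
  unfolding polygonal_lengths_def using assms
  by (intro CollectI exI[of _ 1] exI[of _ "\<lambda>i. if i = 0 then a else b"]) auto

lemma polygonal_lengths_concat:
  assumes "x \<in> polygonal_lengths g a b" "y \<in> polygonal_lengths g b c"
  shows "x + y \<in> polygonal_lengths g a c"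
proof -
  obtain n u where u: "x = (\<Sum>i<n. dist (g (u i)) (g (u (Suc i))))" "u 0 = a" "u n = b" "\<forall>i<n. u i \<le> u (Suc i)"
    using assms(1) unfolding polygonal_lengths_def by blast
  obtain m v where v: "y = (\<Sum>i<m. dist (g (v i)) (g (v (Suc i))))" "v 0 = b" "v m = c" "\<forall>i<m. v i \<le> v (Suc i)"
    using assms(2) unfolding polygonal_lengths_def by blast
  define w where "w i = (if i \<le> n then u i else v (i - n))" for i
  have w2: "w (n + i) = v i" for i
    using u v by (auto simp: w_def)
  have "(\<Sum>i<n + m. dist (g (w i)) (g (w (Suc i)))) =
      (\<Sum>i<n. dist (g (w i)) (g (w (Suc i)))) + (\<Sum>i<m. dist (g (w (n + i))) (g (w (n + Suc i))))"
    by (induction m) auto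
  also have "\<dots> = x + y"
    unfolding w2 u(1) v(1) by (auto intro!: sum.cong simp: w_def)
  finally have "x + y = (\<Sum>i<n + m. dist (g (w i)) (g (w (Suc i))))" ..
  moreover have "w i \<le> w (Suc i)" if "i < n + m" for i
  proof (cases "i < n")
    case True
    then show ?thesis using u by (auto simp: w_def)
  next
    case False
    then obtain k where "i = n + k" using le_Suc_ex not_less by metis
    then show ?thesis using v that w2[of k] w2[of "Suc k"] by auto
  qed
  moreover have "w 0 = a" "w (n + m) = c"
    using u v w2[of m] by (auto simp: w_def)
  ultimately show ?thesis
    unfolding polygonal_lengths_def by blast
qed

lemma polygonal_lengths_split:
  assumes "z \<in> polygonal_lengths g a c" "a \<le> b" "b \<le> c"
  shows "\<exists>x\<in>polygonal_lengths g a b. \<exists>y\<in>polygonal_lengths g b c. z \<le> x + y"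
proof -
  obtain n u where u: "z = (\<Sum>i<n. dist (g (u i)) (g (u (Suc i))))" "u 0 = a" "u n = c" "\<forall>i<n. u i \<le> u (Suc i)"
    using assms(1) unfolding polygonal_lengths_def by blast
  \<comment> \<open>Cutting the partition points off at \<open>b\<close> from above and from below inserts \<open>b\<close> as a new partition point.\<close>
  define x where "x = (\<Sum>i<n. dist (g (min (u i) b)) (g (min (u (Suc i)) b)))"
  define y where "y = (\<Sum>i<n. dist (g (max (u i) b)) (g (max (u (Suc i)) b)))"
  have "x \<in> polygonal_lengths g a b"
    unfolding polygonal_lengths_def x_def using u assms
    by (intro CollectI exI[of _ n] exI[of _ "\<lambda>i. min (u i) b"]) (auto simp: min_def intro: order_trans)
  moreover have "y \<in> polygonal_lengths g b c"
    unfolding polygonal_lengths_def y_def using u assms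
    by (intro CollectI exI[of _ n] exI[of _ "\<lambda>i. max (u i) b"]) (auto simp: max_def intro: order_trans)
  moreover have "z \<le> x + y"
    unfolding u(1) x_def y_def sum.distrib[symmetric]
  proof (rule sum_mono)
    fix i assume i: "i \<in> {..<n}"
    then have "u i \<le> u (Suc i)" using u by auto
    then consider "u (Suc i) \<le> b" | "b \<le> u i" | "u i \<le> b" "b \<le> u (Suc i)" by linarith
    then show "dist (g (u i)) (g (u (Suc i))) \<le>
        dist (g (min (u i) b)) (g (min (u (Suc i)) b)) + dist (g (max (u i) b)) (g (max (u (Suc i)) b))"
    proof cases
      case 3
      then have "min (u i) b = u i" "min (u (Suc i)) b = b" "max (u i) b = b" "max (u (Suc i)) b = u (Suc i)"
        by auto
      then show ?thesis by (simp add: dist_triangle)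
    qed (use \<open>u i \<le> u (Suc i)\<close> in \<open>auto simp: min_def max_def\<close>)
  qed
  ultimately show ?thesis by blast
qed

context
  fixes g :: "real \<Rightarrow> complex"
  assumes rect: "rectifiable_path g"
begin

lemma bdd_above_polygonal_lengths:
  assumes "0 \<le> a" "a \<le> b" "b \<le> 1"
  shows "bdd_above (polygonal_lengths g a b)"
proof -
  obtain M where M: "\<And>z. z \<in> polygonal_lengths g 0 1 \<Longrightarrow> z \<le> M"
    using rect unfolding rectifiable_path_def bdd_above_def by blast
  have "x \<le> M" if "x \<in> polygonal_lengths g a b" for x
  proof -
    have "dist (g 0) (g a) + x + dist (g b) (g 1) \<in> polygonal_lengths g 0 1"
      using that assms by (intro polygonal_lengths_concat[of _ _ 0 b] polygonal_lengths_concat[of _ _ 0 a]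
          dist_in_polygonal_lengths) auto
    from M[OF this] show ?thesis
      using zero_le_dist[of "g 0" "g a"] zero_le_dist[of "g b" "g 1"] by linarith
  qed
  then show ?thesis by (auto simp: bdd_above_def)
qed

lemma polygonal_length_le:
  assumes "x \<in> polygonal_lengths g a b" "0 \<le> a" "a \<le> b" "b \<le> 1"
  shows "x \<le> path_length g a b"
  unfolding path_length_def using assms bdd_above_polygonal_lengths by (intro cSup_upper) auto

lemma dist_le_path_length:
  assumes "0 \<le> a" "a \<le> b" "b \<le> 1"
  shows "dist (g a) (g b) \<le> path_length g a b"
  using assms by (intro polygonal_length_le dist_in_polygonal_lengths)

lemma path_length_le:
  assumes "0 \<le> a" "a \<le> b" "b \<le> 1" "\<And>x. x \<in> polygonal_lengths g a b \<Longrightarrow> x \<le> M"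
  shows "path_length g a b \<le> M"
  unfolding path_length_def using assms dist_in_polygonal_lengths[of a b g] by (intro cSup_least) auto

lemma path_length_add:
  assumes "0 \<le> a" "a \<le> b" "b \<le> c" "c \<le> 1"
  shows "path_length g a c = path_length g a b + path_length g b c"
proof (rule antisym)
  show "path_length g a c \<le> path_length g a b + path_length g b c"
  proof (rule path_length_le)
    fix z assume "z \<in> polygonal_lengths g a c"
    then obtain x y where "x \<in> polygonal_lengths g a b" "y \<in> polygonal_lengths g b c" "z \<le> x + y"
      using polygonal_lengths_split assms by meson
    then show "z \<le> path_length g a b + path_length g b c"
      using polygonal_length_le[of x a b] polygonal_length_le[of y b c] assms by simp
  qed (use assms in auto)
  have "path_length g a b \<le> path_length g a c - path_length g b c"
  proof (rule path_length_le)
    fix x assume x: "x \<in> polygonal_lengths g a b"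
    have "path_length g b c \<le> path_length g a c - x"
    proof (rule path_length_le)
      fix y assume "y \<in> polygonal_lengths g b c"
      then have "x + y \<le> path_length g a c"
        using x assms by (intro polygonal_length_le polygonal_lengths_concat) auto
      then show "y \<le> path_length g a c - x" by simp
    qed (use assms in auto)
    then show "x \<le> path_length g a c - path_length g b c" by simp
  qed (use assms in auto)
  then show "path_length g a b + path_length g b c \<le> path_length g a c" by simp
qed

lemma path_length_nonneg:
  assumes "0 \<le> a" "a \<le> b" "b \<le> 1"
  shows "0 \<le> path_length g a b"
  using dist_le_path_length[OF assms] zero_le_dist order_trans by blast

lemma path_length_refl:
  assumes "0 \<le> a" "a \<le> 1"
  shows "path_length g a a = 0"
  using path_length_add[of a a a] assms by simp

text \<open>
  A fixed partition, cut off at \<open>y\<close>, gives a polygonal length that depends continuously on \<open>y\<close>; as a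
  supremum of such functions the length is lower semicontinuous. Applied to the part before \<open>x\<close> this
  is continuity of the length from the left; the next lemma treats the part after \<open>x\<close>, which yields
  continuity from the right because the two parts add up to the total length.
\<close>
lemma path_length_left_near:
  assumes cont: "continuous_on {0..1} g" and x: "0 \<le> x" "x \<le> 1" and e: "0 < e"
  shows "\<exists>d>0. \<forall>y\<in>{0..x}. dist y x < d \<longrightarrow> path_length g 0 x - e < path_length g 0 y"
proof -
  obtain z where z: "z \<in> polygonal_lengths g 0 x" "path_length g 0 x - e < z"
    using less_cSupD[of "polygonal_lengths g 0 x" "path_length g 0 x - e"] e
      dist_in_polygonal_lengths[of 0 x g] x unfolding path_length_def by fastforce
  obtain n u where u: "z = (\<Sum>i<n. dist (g (u i)) (g (u (Suc i))))" "u 0 = 0" "u n = x" "\<forall>i<n. u i \<le> u (Suc i)"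
    using z(1) unfolding polygonal_lengths_def by blast
  have u01: "0 \<le> u i" "u i \<le> x" if "i \<le> n" for i
    using polygonal_lengths_monotone[OF u(4), of 0 i] polygonal_lengths_monotone[OF u(4), of i n] that u by auto
  define s where "s y = (\<Sum>i<n. dist (g (min (u i) y)) (g (min (u (Suc i)) y)))" for y
  have "continuous_on {0..x} s"
    unfolding s_def using x u01
    by (intro continuous_intros continuous_on_compose2[OF cont]) (auto simp: min_le_iff_disj Suc_le_eq)
  moreover have "s x = z"
    unfolding s_def u(1) using u01 by (intro sum.cong) (auto simp: min_absorb1)
  ultimately obtain d where d: "d > 0" "\<And>y. y \<in> {0..x} \<Longrightarrow> dist y x < d \<Longrightarrow> dist (s y) z < z - (path_length g 0 x - e)"
    using z(2) x unfolding continuous_on_iff by (metis atLeastAtMost_iff diff_gt_0_iff_gt order_refl)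
  have "path_length g 0 x - e < path_length g 0 y" if y: "y \<in> {0..x}" "dist y x < d" for y
  proof -
    have "s y \<in> polygonal_lengths g 0 y"
      unfolding polygonal_lengths_def s_def using u y
      by (intro CollectI exI[of _ n] exI[of _ "\<lambda>i. min (u i) y"]) (auto simp: min_def intro: order_trans)
    then have "s y \<le> path_length g 0 y"
      using y x by (intro polygonal_length_le) auto
    then show ?thesis using d(2)[OF y] by (auto simp: dist_real_def abs_if split: if_splits)
  qed
  then show ?thesis using d(1) by blast
qed

lemma path_length_right_near:
  assumes cont: "continuous_on {0..1} g" and x: "0 \<le> x" "x \<le> 1" and e: "0 < e"
  shows "\<exists>d>0. \<forall>y\<in>{x..1}. dist y x < d \<longrightarrow> path_length g x 1 - e < path_length g y 1"
proof -
  obtain z where z: "z \<in> polygonal_lengths g x 1" "path_length g x 1 - e < z"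
    using less_cSupD[of "polygonal_lengths g x 1" "path_length g x 1 - e"] e
      dist_in_polygonal_lengths[of x 1 g] x unfolding path_length_def by fastforce
  obtain n u where u: "z = (\<Sum>i<n. dist (g (u i)) (g (u (Suc i))))" "u 0 = x" "u n = 1" "\<forall>i<n. u i \<le> u (Suc i)"
    using z(1) unfolding polygonal_lengths_def by blast
  have u01: "x \<le> u i" "u i \<le> 1" if "i \<le> n" for i
    using polygonal_lengths_monotone[OF u(4), of 0 i] polygonal_lengths_monotone[OF u(4), of i n] that u by auto
  define s where "s y = (\<Sum>i<n. dist (g (max (u i) y)) (g (max (u (Suc i)) y)))" for y
  have "continuous_on {x..1} s"
    unfolding s_def using x u01
    by (intro continuous_intros continuous_on_compose2[OF cont]) (auto simp: le_max_iff_disj Suc_le_eq)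
  moreover have "s x = z"
    unfolding s_def u(1) using u01 by (intro sum.cong) (auto simp: max_absorb1)
  ultimately obtain d where d: "d > 0" "\<And>y. y \<in> {x..1} \<Longrightarrow> dist y x < d \<Longrightarrow> dist (s y) z < z - (path_length g x 1 - e)"
    using z(2) x unfolding continuous_on_iff by (metis atLeastAtMost_iff diff_gt_0_iff_gt order_refl)
  have "path_length g x 1 - e < path_length g y 1" if y: "y \<in> {x..1}" "dist y x < d" for y
  proof -
    have "s y \<in> polygonal_lengths g y 1"
      unfolding polygonal_lengths_def s_def using u y
      by (intro CollectI exI[of _ n] exI[of _ "\<lambda>i. max (u i) y"]) (auto simp: max_def intro: order_trans)
    then have "s y \<le> path_length g y 1"
      using y x by (intro polygonal_length_le) auto
    then show ?thesis using d(2)[OF y] by (auto simp: dist_real_def abs_if split: if_splits)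
  qed
  then show ?thesis using d(1) by blast
qed

lemma path_length_mono:
  assumes "0 \<le> x" "x \<le> y" "y \<le> 1"
  shows "path_length g 0 x \<le> path_length g 0 y"
  using path_length_add[of 0 x y] path_length_nonneg[of x y] assms by simp

lemma continuous_on_path_length:
  assumes cont: "continuous_on {0..1} g"
  shows "continuous_on {0..1} (path_length g 0)"
  unfolding continuous_on_iff
proof (intro ballI allI impI)
  fix x e :: real assume x: "x \<in> {0..1}" and e: "0 < e"
  obtain d1 where d1: "d1 > 0" "\<And>y. y \<in> {0..x} \<Longrightarrow> dist y x < d1 \<Longrightarrow> path_length g 0 x - e < path_length g 0 y"
    using path_length_left_near[OF cont _ _ e, of x] x by auto
  obtain d2 where d2: "d2 > 0" "\<And>y. y \<in> {x..1} \<Longrightarrow> dist y x < d2 \<Longrightarrow> path_length g x 1 - e < path_length g y 1"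
    using path_length_right_near[OF cont _ _ e, of x] x by auto
  have "dist (path_length g 0 y) (path_length g 0 x) < e" if y: "y \<in> {0..1}" "dist y x < min d1 d2" for y
  proof (cases "y \<le> x")
    case True
    then show ?thesis
      using d1(2)[of y] path_length_mono[of y x] x y by (auto simp: dist_real_def)
  next
    case False
    then show ?thesis
      using d2(2)[of y] path_length_mono[of x y] path_length_add[of 0 x 1] path_length_add[of 0 y 1] x y
      by (auto simp: dist_real_def)
  qed
  then show "\<exists>d>0. \<forall>x'\<in>{0..1}. dist x' x < d \<longrightarrow> dist (path_length g 0 x') (path_length g 0 x) < e"
    using d1 d2 by (intro exI[of _ "min d1 d2"]) auto
qed

end

locale jordan_arclength =
  fixes g :: "real \<Rightarrow> complex"
  assumes curve: "rectifiable_jordan_curve g"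
begin

abbreviation G :: "real \<Rightarrow> complex" where "G \<equiv> arclength_param g"

abbreviation L :: real where "L \<equiv> curve_length g"

lemma rect: "rectifiable_path g"
  and cont_g: "continuous_on {0..1} g"
  and inj_g: "\<And>x y. x \<in> {0..1} \<Longrightarrow> y \<in> {0..1} \<Longrightarrow> g x = g y \<Longrightarrow> x = y \<or> x = 0 \<and> y = 1 \<or> x = 1 \<and> y = 0"
  and closed_g: "g 1 = g 0"
  using curve by (auto simp: rectifiable_jordan_curve_def simple_path_def path_def loop_free_def
      pathstart_def pathfinish_def)

lemma path_length_strict:
  assumes "0 \<le> x" "x < y" "y \<le> 1"
  shows "path_length g 0 x < path_length g 0 y"
proof (rule ccontr)
  assume "\<not> ?thesis"
  then have 0: "path_length g x y = 0"
    using path_length_add[OF rect, of 0 x y] path_length_nonneg[OF rect, of x y] assms by simp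
  have "g z = g x" if "x \<le> z" "z \<le> y" for z
  proof -
    have "path_length g x z = 0"
      using path_length_add[OF rect, of x z y] path_length_nonneg[OF rect, of x z]
        path_length_nonneg[OF rect, of z y] assms that 0 by linarith
    then show ?thesis
      using dist_le_path_length[OF rect, of x z] assms that by simp
  qed
  from this[of "(x + y) / 2"] show False
    using inj_g[of x "(x + y) / 2"] assms by auto
qed

lemma path_length_bij: "bij_betw (path_length g 0) {0..1} {0..L}"
proof -
  have "inj_on (path_length g 0) {0..1}"
    by (rule linorder_inj_onI) (use path_length_strict in \<open>force+\<close>)
  moreover have "path_length g 0 ` {0..1} = {0..L}"
  proof (intro antisym subsetI)
    fix s assume "s \<in> path_length g 0 ` {0..1}"
    then show "s \<in> {0..L}"
      using path_length_nonneg[OF rect, of 0] path_length_mono[OF rect, of _ 1] by auto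
  next
    fix s assume "s \<in> {0..L}"
    then show "s \<in> path_length g 0 ` {0..1}"
      using IVT'[of "path_length g 0" 0 s 1] path_length_refl[OF rect, of 0]
        continuous_on_path_length[OF rect cont_g] by (auto simp: image_iff)
  qed
  ultimately show ?thesis by (simp add: bij_betw_def)
qed

lemma G_path_length:
  assumes "0 \<le> x" "x \<le> 1"
  shows "G (path_length g 0 x) = g x"
  unfolding arclength_param_def using path_length_bij assms by (simp add: bij_betw_def)

lemma L_pos: "0 < L"
  using path_length_strict[of 0 1] path_length_refl[OF rect, of 0] by simp

lemma path_length_parameter:
  assumes "s \<in> {0..L}"
  obtains x where "0 \<le> x" "x \<le> 1" "path_length g 0 x = s"
  using path_length_bij assms unfolding bij_betw_def by (metis atLeastAtMost_iff imageE)

lemma image_G: "G ` {0..L} = path_image g"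
proof -
  have "G ` path_length g 0 ` {0..1} = g ` {0..1}"
    unfolding image_image by (intro image_cong refl) (simp add: G_path_length)
  then show ?thesis
    using path_length_bij by (simp add: bij_betw_def path_image_def)
qed

lemma G_lipschitz: "1-lipschitz_on {0..L} G"
proof (rule lipschitz_onI)
  have *: "dist (G s) (G t) \<le> t - s" if st: "s \<in> {0..L}" "t \<in> {0..L}" "s \<le> t" for s t
  proof -
    obtain x where x: "0 \<le> x" "x \<le> 1" "path_length g 0 x = s" using path_length_parameter[OF st(1)] .
    obtain y where y: "0 \<le> y" "y \<le> 1" "path_length g 0 y = t" using path_length_parameter[OF st(2)] .
    have xy: "x \<le> y"
      using path_length_strict[of y x] x y st by force
    have "dist (g x) (g y) \<le> path_length g x y"
      using x y xy by (intro dist_le_path_length[OF rect])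
    also have "\<dots> = t - s"
      using path_length_add[OF rect, of 0 x y] x y xy by simp
    finally show ?thesis using x y G_path_length by metis
  qed
  fix s t assume "s \<in> {0..L}" "t \<in> {0..L}"
  then show "dist (G s) (G t) \<le> 1 * dist s t"
    using *[of s t] *[of t s] by (cases "s \<le> t") (auto simp: dist_real_def dist_commute)
qed simp

lemma G_closed: "G L = G 0"
  using G_path_length[of 0] G_path_length[of 1] path_length_refl[OF rect, of 0] closed_g by simp

lemma G_inj:
  assumes "s \<in> {0..L}" "t \<in> {0..L}" "G s = G t"
  shows "s = t \<or> s = 0 \<and> t = L \<or> s = L \<and> t = 0"
proof -
  obtain x where x: "0 \<le> x" "x \<le> 1" "path_length g 0 x = s" using path_length_parameter[OF assms(1)] .
  obtain y where y: "0 \<le> y" "y \<le> 1" "path_length g 0 y = t" using path_length_parameter[OF assms(2)] .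
  have "g x = g y" using assms x y G_path_length by metis
  then show ?thesis
    using inj_g[of x y] x y path_length_refl[OF rect, of 0] by auto
qed

lemma continuous_on_G: "continuous_on {0..L} G"
  using G_lipschitz by (rule lipschitz_on_continuous_on)

end

section \<open>The length measure and the commutator identity\<close>

context jordan_arclength
begin

sublocale arc: lipschitz_curve L G
  by unfold_locales (rule L_pos, rule G_lipschitz)

abbreviation \<Gamma> :: "complex set" where "\<Gamma> \<equiv> path_image g"

abbreviation \<mu> :: "complex measure" where "\<mu> \<equiv> length_measure g"

lemma G_measurable: "G \<in> restrict_space lborel {0..L} \<rightarrow>\<^sub>M restrict_space borel \<Gamma>"
proof (rule measurable_restrict_space2)
  show "G \<in> space (restrict_space lborel {0..L}) \<rightarrow> \<Gamma>"
    using image_G by auto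
  show "G \<in> borel_measurable (restrict_space lborel {0..L})"
    using borel_measurable_continuous_on_restrict[OF continuous_on_G]
    by (simp add: measurable_cong_sets[OF sets_restrict_space_cong[OF sets_lborel]])
qed

lemma space_length_measure: "space \<mu> = \<Gamma>"
  by (simp add: length_measure_def space_restrict_space)

lemma length_measure_measurable: "f \<in> restrict_space borel \<Gamma> \<rightarrow>\<^sub>M N \<Longrightarrow> f \<in> \<mu> \<rightarrow>\<^sub>M N"
  unfolding length_measure_def by (intro measurable_completion) (simp add: measurable_distr_eq1)

lemma length_measure_borel_measurable: "f \<in> borel_measurable borel \<Longrightarrow> f \<in> borel_measurable \<mu>"
  by (intro length_measure_measurable measurable_restrict_space1)

lemma emeasure_length_measure:
  assumes "B \<in> sets borel" "B \<subseteq> \<Gamma>"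
  shows "emeasure \<mu> B = emeasure lborel {s \<in> {0..L}. G s \<in> B}" "B \<in> sets \<mu>"
proof -
  have B: "B \<in> sets (restrict_space borel \<Gamma>)"
    using assms by (auto simp: sets_restrict_space image_iff intro!: bexI[of _ B])
  have eq: "G -` B \<inter> space (restrict_space lborel {0..L}) = {s \<in> {0..L}. G s \<in> B}"
    by (auto simp: space_restrict_space)
  show "B \<in> sets \<mu>"
    unfolding length_measure_def using B by simp
  show "emeasure \<mu> B = emeasure lborel {s \<in> {0..L}. G s \<in> B}"
  proof -
    have "emeasure \<mu> B = emeasure (restrict_space lborel {0..L}) {s \<in> {0..L}. G s \<in> B}"
      unfolding length_measure_def using B G_measurable eq by (simp add: emeasure_distr)
    also have "\<dots> = emeasure lborel {s \<in> {0..L}. G s \<in> B}"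
      by (rule emeasure_restrict_space) auto
    finally show ?thesis .
  qed
qed

lemma G_dist_le_L:
  assumes "z \<in> \<Gamma>" "w \<in> \<Gamma>" shows "cmod (z - w) \<le> L"
proof -
  obtain s t where st: "s \<in> {0..L}" "t \<in> {0..L}" "z = G s" "w = G t"
    using assms image_G by (metis imageE)
  then have "dist z w \<le> 1 * dist s t"
    using lipschitz_onD[OF G_lipschitz] by simp
  also have "\<dots> \<le> L" using st by (auto simp: dist_real_def abs_if)
  finally show ?thesis by (simp add: dist_norm)
qed

lemma truncated_domain_eq: "truncated_domain g t R = {s \<in> {0..L}. R \<le> cmod (G s - t)}"
  using image_G by (auto simp: truncated_domain_def portion_def)

lemma truncated_domain_sets: "truncated_domain g t R \<in> sets borel"
proof -
  have "closed ({0..L} \<inter> (\<lambda>s. cmod (G s - t)) -` {R..})"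
    by (intro continuous_closed_preimage continuous_intros continuous_on_G)
  moreover have "{0..L} \<inter> (\<lambda>s. cmod (G s - t)) -` {R..} = truncated_domain g t R"
    by (auto simp: truncated_domain_eq)
  ultimately show ?thesis by simp
qed

text \<open>
  For the truncated integrals the factor \<open>(G s - c) - (t - c) = G s - t\<close> cancels the kernel and leaves
  the integral of \<open>f\<close> over the truncated curve, which converges to the integral over the whole curve
  because \<open>G\<close> takes the value \<open>t\<close> at finitely many parameters only.
\<close>
lemma cauchy_singular_integral_commutator:
  assumes f: "f \<in> borel_measurable borel" and B: "\<And>\<tau>. cmod (f \<tau>) \<le> B"
    and ex: "cauchy_singular_integral_exists g f t" "cauchy_singular_integral_exists g (\<lambda>\<tau>. (\<tau> - c) * f \<tau>) t"
  shows "cauchy_singular_integral g (\<lambda>\<tau>. (\<tau> - c) * f \<tau>) t - (t - c) * cauchy_singular_integral g f t =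
    1 / (complex_of_real pi * \<i>) * (LINT s:{0..L}|lebesgue. f (G s) * arc.D s)"
proof -
  let ?u = "\<lambda>\<tau>. (\<tau> - c) * f \<tau>" and ?k = "1 / (complex_of_real pi * \<i>)"
  obtain lf where lf: "(truncated_cauchy_integral g f t \<longlongrightarrow> lf) (at_right 0)"
    using ex by (auto simp: cauchy_singular_integral_exists_def)
  obtain lu where lu: "(truncated_cauchy_integral g ?u t \<longlongrightarrow> lu) (at_right 0)"
    using ex by (auto simp: cauchy_singular_integral_exists_def)
  have Lim: "cauchy_singular_integral g f t = lf" "cauchy_singular_integral g ?u t = lu"
    unfolding cauchy_singular_integral_def using lf lu by (auto intro!: tendsto_Lim)
  have trunc: "truncated_cauchy_integral g ?u t R - (t - c) * truncated_cauchy_integral g f t R =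
      ?k * (LINT s:truncated_domain g t R|lebesgue. f (G s) * arc.D s)" if R: "0 < R" for R
  proof -
    let ?T = "truncated_domain g t R"
    have i1: "set_integrable lebesgue ?T (cauchy_integrand g f t)"
      and i2: "set_integrable lebesgue ?T (cauchy_integrand g ?u t)"
      using ex R by (auto simp: cauchy_singular_integral_exists_def)
    have "(LINT s:?T|lebesgue. cauchy_integrand g ?u t s) - (t - c) * (LINT s:?T|lebesgue. cauchy_integrand g f t s)
        = (LINT s:?T|lebesgue. cauchy_integrand g ?u t s - (t - c) * cauchy_integrand g f t s)"
      using i1 i2 by (simp add: set_integral_diff)
    also have "\<dots> = (LINT s:?T|lebesgue. f (G s) * arc.D s)"
    proof (rule set_lebesgue_integral_cong)
      show "\<forall>s. s \<in> ?T \<longrightarrow> cauchy_integrand g ?u t s - (t - c) * cauchy_integrand g f t s = f (G s) * arc.D s"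
      proof (intro allI impI)
        fix s assume "s \<in> ?T"
        then have "G s - t \<noteq> 0" using R by (auto simp: truncated_domain_eq)
        then show "cauchy_integrand g ?u t s - (t - c) * cauchy_integrand g f t s = f (G s) * arc.D s"
        proof -
          have "cauchy_integrand g ?u t s - (t - c) * cauchy_integrand g f t s
              = ((G s - c) - (t - c)) * (f (G s) / (G s - t) * arc.D s)"
            unfolding cauchy_integrand_def left_diff_distrib[of "G s - c" "t - c"]
            by (simp only: times_divide_eq_right times_divide_eq_left mult.assoc)
          also have "(G s - c) - (t - c) = G s - t" by simp
          finally show ?thesis using \<open>G s - t \<noteq> 0\<close> by simp
        qed
      qed
    qed (use truncated_domain_sets in auto)
    finally have "(LINT s:?T|lebesgue. cauchy_integrand g ?u t s) - (t - c) * (LINT s:?T|lebesgue. cauchy_integrand g f t s)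
        = (LINT s:?T|lebesgue. f (G s) * arc.D s)" .
    moreover have "k * x - y * (k * z) = k * (x - y * z)" for k x y z :: complex
      by (simp add: algebra_simps)
    ultimately show ?thesis
      unfolding truncated_cauchy_integral_def by (simp only:)
  qed
  have R: "filterlim (\<lambda>n. 1 / real (Suc n)) (at_right 0) sequentially"
    unfolding filterlim_at using lim_inverse_n' filterlim_compose[OF lim_inverse_n' filterlim_Suc]
    by (auto simp: o_def)
  have "((\<lambda>R. truncated_cauchy_integral g ?u t R - (t - c) * truncated_cauchy_integral g f t R)
      \<longlongrightarrow> lu - (t - c) * lf) (at_right 0)"
    by (intro tendsto_intros lf lu)
  from filterlim_compose[OF this R]
  have lim1: "(\<lambda>n. ?k * (LINT s:truncated_domain g t (1 / Suc n)|lebesgue. f (G s) * arc.D s))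
      \<longlonglongrightarrow> lu - (t - c) * lf"
    by (subst (asm) trunc) auto
  have meas: "(\<lambda>s. indicator {0..L} s *\<^sub>R (f (G s) * arc.D s)) \<in> borel_measurable lebesgue"
  proof -
    have "(\<lambda>s. f (arc.clamped s)) \<in> borel_measurable borel"
      using measurable_compose[OF borel_measurable_continuous_onI[OF arc.continuous_clamped] f] .
    then have "(\<lambda>s. f (arc.clamped s)) \<in> borel_measurable lebesgue"
      by (intro measurable_completion) simp
    then have "(\<lambda>s. f (arc.clamped s) * (indicator {0..L} s *\<^sub>R arc.D s)) \<in> borel_measurable lebesgue"
      by (rule borel_measurable_times[OF _ arc.D_measurable])
    moreover have "(\<lambda>s. f (arc.clamped s) * (indicator {0..L} s *\<^sub>R arc.D s)) =
        (\<lambda>s. indicator {0..L} s *\<^sub>R (f (G s) * arc.D s))"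
      using arc.clamped_eq by (intro ext) (auto simp: indicator_def)
    ultimately show ?thesis by simp
  qed
  have T_sub: "truncated_domain g t R \<subseteq> {0..L}" for R
    by (auto simp: truncated_domain_eq)
  have B0: "0 \<le> B" using B[of 0] norm_ge_zero order_trans by blast
  have lim2: "(\<lambda>n. LINT s:truncated_domain g t (1 / Suc n)|lebesgue. f (G s) * arc.D s)
      \<longlonglongrightarrow> (LINT s:{0..L}|lebesgue. f (G s) * arc.D s)"
    unfolding set_lebesgue_integral_def
  proof (rule integral_dominated_convergence)
    show "(\<lambda>s. indicator (truncated_domain g t (1 / Suc n)) s *\<^sub>R (f (G s) * arc.D s)) \<in> borel_measurable lebesgue" for n
    proof -
      have "(\<lambda>s. indicator (truncated_domain g t (1 / Suc n)) s *\<^sub>R (indicator {0..L} s *\<^sub>R (f (G s) * arc.D s)))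
          \<in> borel_measurable lebesgue"
        using truncated_domain_sets[of t "1 / Suc n"]
        by (intro borel_measurable_scaleR[OF measurable_completion meas] borel_measurable_indicator) simp
      moreover have "(\<lambda>s. indicator (truncated_domain g t (1 / Suc n)) s *\<^sub>R (indicator {0..L} s *\<^sub>R (f (G s) * arc.D s)))
          = (\<lambda>s. indicator (truncated_domain g t (1 / Suc n)) s *\<^sub>R (f (G s) * arc.D s))"
        by (intro ext) (auto simp: truncated_domain_eq indicator_def)
      ultimately show ?thesis by simp
    qed
    show "integrable lebesgue (\<lambda>s. B * indicator {0..L} s)"
      using L_pos by (intro integrable_completion[THEN iffD2] integrable_mult_right integrable_real_indicator) auto
    show "AE s in lebesgue. norm (indicator (truncated_domain g t (1 / Suc n)) s *\<^sub>R (f (G s) * arc.D s)) \<le> B * indicator {0..L} s" for n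
      using arc.norm_D_le
    proof eventually_elim
      case (elim s)
      show ?case
      proof (cases "s \<in> truncated_domain g t (1 / Suc n)")
        case True
        then have "s \<in> {0..L}" using T_sub by blast
        then show ?thesis
          using elim mult_mono[OF B[of "G s"], of "norm (arc.D s)" 1] True B0 by (simp add: norm_mult)
      qed (use B0 in auto)
    qed
    show "AE s in lebesgue. (\<lambda>n. indicator (truncated_domain g t (1 / Suc n)) s *\<^sub>R (f (G s) * arc.D s))
        \<longlonglongrightarrow> indicator {0..L} s *\<^sub>R (f (G s) * arc.D s)"
    proof -
      have "finite {s \<in> {0..L}. G s = t}"
      proof (cases "\<exists>s\<in>{0..L}. G s = t")
        case True
        then obtain s0 where "s0 \<in> {0..L}" "G s0 = t" by blast
        then have "{s \<in> {0..L}. G s = t} \<subseteq> {s0, 0, L}" using G_inj[of s0] by force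
        then show ?thesis by (rule finite_subset) simp
      next
        case False
        then have "{s \<in> {0..L}. G s = t} = {}" by blast
        then show ?thesis by (simp only: finite.emptyI)
      qed
      then have "AE s in lebesgue. s \<notin> {s \<in> {0..L}. G s = t}"
        by (intro AE_not_in) (simp add: negligible_finite flip: negligible_iff_null_sets)
      then show ?thesis
      proof eventually_elim
        case (elim s)
        show ?case
        proof (cases "s \<in> {0..L}")
          case True
          then have pos: "0 < cmod (G s - t)" using elim by auto
          have "\<forall>\<^sub>F n in sequentially. 1 / real (Suc n) < cmod (G s - t)"
            using R pos unfolding filterlim_at by (intro order_tendstoD(2)) auto
          then have "\<forall>\<^sub>F n in sequentially. indicator {0..L} s *\<^sub>R (f (G s) * arc.D s) =
              indicator (truncated_domain g t (1 / Suc n)) s *\<^sub>R (f (G s) * arc.D s)"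
            by eventually_elim (use True in \<open>auto simp: truncated_domain_eq indicator_def\<close>)
          then show ?thesis by (rule Lim_transform_eventually[OF tendsto_const])
        next
          case False
          then show ?thesis by (auto simp: truncated_domain_eq indicator_def)
        qed
      qed
    qed
  qed (use meas in auto)
  show ?thesis
    unfolding Lim using LIMSEQ_unique[OF lim1 tendsto_mult_left[OF lim2]] .
qed

end

section \<open>A localized inequality for a bounded operator\<close>

locale weighted_curve = jordan_arclength +
  fixes p :: "complex \<Rightarrow> real" and w :: "complex \<Rightarrow> ennreal"
  assumes p_measurable: "p \<in> borel_measurable (restrict_space borel (path_image g))"
    and w_measurable: "(\<lambda>\<tau>. enn2real (w \<tau>)) \<in> borel_measurable (restrict_space borel (path_image g))"
    and p_ge_1: "\<And>\<tau>. \<tau> \<in> path_image g \<Longrightarrow> 1 \<le> p \<tau>"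
begin

lemma modular_measurable:
  assumes "f \<in> borel_measurable \<mu>"
  shows "(\<lambda>\<tau>. ennreal ((cmod (f \<tau>) * enn2real (w \<tau>) / r) powr p \<tau>)) \<in> borel_measurable \<mu>"
  using assms length_measure_measurable[OF p_measurable] length_measure_measurable[OF w_measurable]
  by measurable

lemma modular_antimono:
  assumes "0 < r" "r \<le> r'"
  shows "modular g p w f r' \<le> modular g p w f r"
  unfolding modular_def
proof (intro nn_integral_mono ennreal_leI powr_mono2 divide_left_mono)
  fix \<tau> assume "\<tau> \<in> space \<mu>"
  then show "0 \<le> p \<tau>" using p_ge_1[of \<tau>] by (simp add: space_length_measure)
qed (use assms in auto)

text \<open>
  The set in the definition of the norm is nonempty: since the exponent is at least \<open>1\<close>, dividing the
  function by \<open>k \<ge> 1\<close> divides the modular by at least \<open>k\<close>.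
\<close>
lemma modular_le_1_exists:
  assumes f: "f \<in> variable_Lp g p w"
  shows "\<exists>r>0. modular g p w f r \<le> 1"
proof -
  obtain r where r: "r > 0" "modular g p w f r < \<infinity>" and fm: "f \<in> borel_measurable \<mu>"
    using f by (auto simp: variable_Lp_def)
  then obtain m where m: "modular g p w f r = ennreal m" "0 \<le> m"
    by (cases "modular g p w f r") auto
  define k where "k = max 1 m"
  have k: "1 \<le> k" "m \<le> k" by (auto simp: k_def)
  have "modular g p w f (r * k) \<le> (\<integral>\<^sup>+\<tau>. ennreal (1 / k) * ennreal ((cmod (f \<tau>) * enn2real (w \<tau>) / r) powr p \<tau>) \<partial>\<mu>)"
    unfolding modular_def
  proof (intro nn_integral_mono)
    fix \<tau> assume "\<tau> \<in> space \<mu>"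
    then have p: "1 \<le> p \<tau>" using p_ge_1 by (simp add: space_length_measure)
    define x where "x = cmod (f \<tau>) * enn2real (w \<tau>) / r"
    have x: "0 \<le> x" using r by (simp add: x_def)
    have "(1 / k) powr p \<tau> \<le> (1 / k) powr 1"
      using k p by (intro powr_mono') auto
    then have "(1 / k) powr p \<tau> * x powr p \<tau> \<le> 1 / k * x powr p \<tau>"
      using k by (intro mult_right_mono) auto
    moreover have "(1 / k * x) powr p \<tau> = (1 / k) powr p \<tau> * x powr p \<tau>"
      using k x by (simp only: powr_mult)
    moreover have "cmod (f \<tau>) * enn2real (w \<tau>) / (r * k) = 1 / k * x"
      by (simp add: x_def)
    ultimately show "ennreal ((cmod (f \<tau>) * enn2real (w \<tau>) / (r * k)) powr p \<tau>)
        \<le> ennreal (1 / k) * ennreal ((cmod (f \<tau>) * enn2real (w \<tau>) / r) powr p \<tau>)"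
      using k by (simp add: x_def[symmetric] ennreal_mult[symmetric] ennreal_leI del: times_divide_eq_left)
  qed
  also have "\<dots> = ennreal (1 / k) * modular g p w f r"
    unfolding modular_def using modular_measurable[OF fm] by (rule nn_integral_cmult)
  also have "\<dots> = ennreal (m / k)"
    using m k by (simp add: ennreal_mult[symmetric])
  also have "\<dots> \<le> 1" using m k by (simp add: divide_le_eq)
  finally show ?thesis using r k by (intro exI[of _ "r * k"]) simp
qed

lemma norm_nonneg:
  assumes "f \<in> variable_Lp g p w"
  shows "0 \<le> variable_Lp_norm g p w f"
  unfolding variable_Lp_norm_def using modular_le_1_exists[OF assms]
  by (intro cInf_greatest) auto

lemma norm_le:
  assumes "0 < r" "modular g p w f r \<le> 1"
  shows "variable_Lp_norm g p w f \<le> r"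
  unfolding variable_Lp_norm_def using assms
  by (intro cInf_lower bdd_belowI[of _ 0]) auto

lemma modular_le_1:
  assumes f: "f \<in> variable_Lp g p w" and r: "variable_Lp_norm g p w f < r"
  shows "modular g p w f r \<le> 1"
proof -
  obtain s where "0 < s" "modular g p w f s \<le> 1" "s < r"
    using cInf_lessD[of "{r. 0 < r \<and> modular g p w f r \<le> 1}" r] modular_le_1_exists[OF f] r
    by (auto simp: variable_Lp_norm_def)
  then show ?thesis using modular_antimono[of s r f] by (meson less_imp_le order_trans)
qed

lemma variable_LpI:
  assumes "f \<in> borel_measurable borel" "0 < r" "modular g p w f r \<le> 1"
  shows "f \<in> variable_Lp g p w"
  unfolding variable_Lp_def using assms length_measure_borel_measurable[OF assms(1)]
  by (auto intro!: exI[of _ r] intro: le_less_trans)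

lemma powr_average_le:
  fixes x y e :: real
  assumes "0 \<le> x" "0 \<le> y" "0 \<le> e"
  shows "((x + y) / 2) powr e \<le> x powr e + y powr e"
proof (cases "x \<le> y")
  case True
  then have "((x + y) / 2) powr e \<le> y powr e" using assms by (intro powr_mono2) auto
  then show ?thesis using powr_ge_zero[of x e] by linarith
next
  case False
  then have "((x + y) / 2) powr e \<le> x powr e" using assms by (intro powr_mono2) auto
  then show ?thesis using powr_ge_zero[of y e] by linarith
qed

text \<open>
  By the commutator identity the constant \<open>\<integral> f d\<tau>\<close> is bounded on \<open>ball c R\<close> by
  \<open>\<pi>\<close> times \<open>\<bar>S u\<bar> + R \<bar>S f\<bar>\<close>, where \<open>u = (\<tau> - c) f\<close> satisfies \<open>\<bar>u\<bar> \<le> R \<bar>f\<bar>\<close>. Working with modulars instead of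
  norms replaces the triangle inequality by an elementary pointwise estimate, at the cost of the
  bound \<open>2\<close> instead of \<open>1\<close>.
\<close>
lemma bounded_operator_localized:
  assumes bounded: "cauchy_singular_operator_bounded g p w"
  obtains C where "1 \<le> C"
    "\<And>f B \<kappa> R c. f \<in> borel_measurable borel \<Longrightarrow> (\<And>\<tau>. cmod (f \<tau>) \<le> B) \<Longrightarrow> 0 < \<kappa> \<Longrightarrow> 0 < R \<Longrightarrow>
      (\<And>\<tau>. f \<tau> \<noteq> 0 \<Longrightarrow> cmod (\<tau> - c) \<le> R) \<Longrightarrow> modular g p w f \<kappa> \<le> 1 \<Longrightarrow>
      modular g p w (\<lambda>\<tau>. indicator (ball c R) \<tau> * (LINT s:{0..L}|lebesgue. f (G s) * arc.D s)) (C * \<kappa> * R) \<le> 2"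
proof -
  let ?S = "cauchy_singular_integral g"
  obtain C0 where C0: "\<And>f. f \<in> variable_Lp g p w \<Longrightarrow> (AE t in \<mu>. cauchy_singular_integral_exists g f t)"
    "\<And>f. f \<in> variable_Lp g p w \<Longrightarrow> ?S f \<in> variable_Lp g p w"
    "\<And>f. f \<in> variable_Lp g p w \<Longrightarrow> variable_Lp_norm g p w (?S f) \<le> C0 * variable_Lp_norm g p w f"
    using bounded unfolding cauchy_singular_operator_bounded_def by blast
  \<comment> \<open>The norm is an infimum that need not be attained a priori, so the constant is enlarged to get a strict inequality.\<close>
  define C1 where "C1 = \<bar>C0\<bar> + 1"
  have C1: "1 \<le> C1" by (simp add: C1_def)
  have S_modular: "modular g p w (?S f) (C1 * r) \<le> 1"
    if f: "f \<in> variable_Lp g p w" and r: "0 < r" "modular g p w f r \<le> 1" for f r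
  proof (rule modular_le_1[OF C0(2)[OF f]])
    have "variable_Lp_norm g p w (?S f) \<le> C0 * variable_Lp_norm g p w f" by (rule C0(3)[OF f])
    also have "\<dots> \<le> \<bar>C0\<bar> * r"
      using norm_nonneg[OF f] norm_le[OF r] by (intro mult_mono) auto
    also have "\<dots> < C1 * r" using r by (simp add: C1_def)
    finally show "variable_Lp_norm g p w (?S f) < C1 * r" .
  qed
  define C where "C = 2 * pi * C1"
  have C: "1 \<le> C"
  proof -
    have "1 * 1 \<le> (2 * pi) * C1" using C1 pi_gt3 by (intro mult_mono) auto
    then show ?thesis by (simp add: C_def)
  qed
  show thesis
  proof (rule that[OF C])
    fix f :: "complex \<Rightarrow> complex" and B \<kappa> R :: real and c :: complex
    assume f: "f \<in> borel_measurable borel" and B: "\<And>\<tau>. cmod (f \<tau>) \<le> B" and pos: "0 < \<kappa>" "0 < R"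
      and supp: "\<And>\<tau>. f \<tau> \<noteq> 0 \<Longrightarrow> cmod (\<tau> - c) \<le> R" and f1: "modular g p w f \<kappa> \<le> 1"
    define u where "u = (\<lambda>\<tau>. (\<tau> - c) * f \<tau>)"
    define H where "H = (LINT s:{0..L}|lebesgue. f (G s) * arc.D s)"
    have u_le: "cmod (u \<tau>) \<le> R * cmod (f \<tau>)" for \<tau>
      using supp[of \<tau>] by (cases "f \<tau> = 0") (auto simp: u_def norm_mult intro!: mult_right_mono)
    have u: "u \<in> borel_measurable borel"
      unfolding u_def using f by (intro borel_measurable_times borel_measurable_diff) auto
    have "modular g p w u (R * \<kappa>) \<le> modular g p w f \<kappa>"
      unfolding modular_def
    proof (intro nn_integral_mono ennreal_leI powr_mono2)
      fix \<tau> assume "\<tau> \<in> space \<mu>"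
      then show "0 \<le> p \<tau>" using p_ge_1[of \<tau>] by (simp add: space_length_measure)
      have "cmod (u \<tau>) * enn2real (w \<tau>) \<le> R * cmod (f \<tau>) * enn2real (w \<tau>)"
        using u_le by (intro mult_right_mono) auto
      then show "cmod (u \<tau>) * enn2real (w \<tau>) / (R * \<kappa>) \<le> cmod (f \<tau>) * enn2real (w \<tau>) / \<kappa>"
        using pos by (simp add: field_simps)
    qed (use pos in auto)
    then have u1: "modular g p w u (R * \<kappa>) \<le> 1" using f1 by simp
    have fL: "f \<in> variable_Lp g p w" and uL: "u \<in> variable_Lp g p w"
      using variable_LpI[OF f _ f1] variable_LpI[OF u _ u1] pos by auto
    have Sf: "modular g p w (?S f) (C1 * \<kappa>) \<le> 1" and Su: "modular g p w (?S u) (C1 * (R * \<kappa>)) \<le> 1"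
      using S_modular[OF fL _ f1] S_modular[OF uL _ u1] pos by auto
    have Sm: "?S f \<in> borel_measurable \<mu>" "?S u \<in> borel_measurable \<mu>"
      using C0(2)[OF fL] C0(2)[OF uL] by (auto simp: variable_Lp_def)
    let ?N = "\<lambda>h r \<tau>. (cmod (h \<tau>) * enn2real (w \<tau>) / r) powr p \<tau>"
    have "modular g p w (\<lambda>\<tau>. indicator (ball c R) \<tau> * H) (C * \<kappa> * R)
        \<le> (\<integral>\<^sup>+\<tau>. ennreal (?N (?S u) (C1 * (R * \<kappa>)) \<tau>) + ennreal (?N (?S f) (C1 * \<kappa>) \<tau>) \<partial>\<mu>)"
      unfolding modular_def
    proof (rule nn_integral_mono_AE)
      show "AE \<tau> in \<mu>. ennreal (?N (\<lambda>\<tau>. indicator (ball c R) \<tau> * H) (C * \<kappa> * R) \<tau>)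
          \<le> ennreal (?N (?S u) (C1 * (R * \<kappa>)) \<tau>) + ennreal (?N (?S f) (C1 * \<kappa>) \<tau>)"
        using C0(1)[OF fL] C0(1)[OF uL] AE_space
      proof eventually_elim
        case (elim \<tau>)
        have p: "1 \<le> p \<tau>" using elim p_ge_1 by (simp add: space_length_measure)
        show ?case
        proof (cases "\<tau> \<in> ball c R")
          case True
          then have dist: "cmod (\<tau> - c) \<le> R" by (simp add: dist_norm norm_minus_commute)
          have "?S u \<tau> - (\<tau> - c) * ?S f \<tau> = 1 / (complex_of_real pi * \<i>) * H"
            using cauchy_singular_integral_commutator[OF f B elim(1), of c] elim(2) by (simp add: u_def H_def)
          then have "cmod H / pi = cmod (?S u \<tau> - (\<tau> - c) * ?S f \<tau>)"
            by (simp add: norm_mult norm_divide)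
          also have "\<dots> \<le> cmod (?S u \<tau>) + R * cmod (?S f \<tau>)"
            using norm_triangle_ineq4[of "?S u \<tau>" "(\<tau> - c) * ?S f \<tau>"] mult_right_mono[OF dist, of "cmod (?S f \<tau>)"]
            by (simp add: norm_mult)
          finally have H: "cmod H / pi \<le> cmod (?S u \<tau>) + R * cmod (?S f \<tau>)" .
          define x where "x = cmod (?S u \<tau>) * enn2real (w \<tau>) / (C1 * (R * \<kappa>))"
          define y where "y = cmod (?S f \<tau>) * enn2real (w \<tau>) / (C1 * \<kappa>)"
          have xy: "0 \<le> x" "0 \<le> y" using pos C1 by (auto simp: x_def y_def)
          have "cmod H * enn2real (w \<tau>) / (C * \<kappa> * R) = (cmod H / pi) * (enn2real (w \<tau>) / (2 * C1 * \<kappa> * R))"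
            by (simp add: C_def)
          also have "\<dots> \<le> (cmod (?S u \<tau>) + R * cmod (?S f \<tau>)) * (enn2real (w \<tau>) / (2 * C1 * \<kappa> * R))"
            using H pos C1 by (intro mult_right_mono) auto
          also have "\<dots> = (x + y) / 2"
            using pos C1 by (simp add: x_def y_def field_simps)
          finally have "?N (\<lambda>\<tau>. indicator (ball c R) \<tau> * H) (C * \<kappa> * R) \<tau> \<le> ((x + y) / 2) powr p \<tau>"
            using p pos C True by (intro powr_mono2) auto
          also have "\<dots> \<le> x powr p \<tau> + y powr p \<tau>"
            using xy p by (intro powr_average_le) auto
          finally show ?thesis
            by (simp add: x_def y_def ennreal_leI flip: ennreal_plus)
        qed auto
      qed
    qed
    also have "\<dots> = modular g p w (?S u) (C1 * (R * \<kappa>)) + modular g p w (?S f) (C1 * \<kappa>)"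
      unfolding modular_def by (intro nn_integral_add modular_measurable Sm)
    also have "\<dots> \<le> 1 + 1" by (rule add_mono[OF Su Sf])
    finally show "modular g p w (\<lambda>\<tau>. indicator (ball c R) \<tau> * (LINT s:{0..L}|lebesgue. f (G s) * arc.D s)) (C * \<kappa> * R) \<le> 2"
      by (simp add: H_def one_add_one)
  qed
qed

end

section \<open>Matuszewska--Orlicz indices of radial weights\<close>

text \<open>
  The quantitative form in which membership in \<open>class_WW\<close> enters: the exponents \<open>\<alpha>\<close> and \<open>\<beta>\<close> of either
  sign are merged into a single \<open>a \<ge> 0\<close>.
\<close>
definition power_comparable :: "real \<Rightarrow> real \<Rightarrow> real \<Rightarrow> (real \<Rightarrow> real) \<Rightarrow> bool" where
  "power_comparable L a K r \<longleftrightarrow> 0 < L \<and> 0 \<le> a \<and> 1 \<le> K \<and> (\<forall>x. 0 < x \<and> x \<le> L \<longrightarrow> 0 < r x) \<and>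
     (\<forall>x y. 0 < x \<and> x \<le> y \<and> y \<le> L \<longrightarrow>
        r x \<le> K * (y / x) powr a * r y \<and> r y \<le> K * (y / x) powr a * r x)"

lemma class_WW_real:
  assumes "\<rho> \<in> class_WW L" and L: "0 < L"
  obtains r a K where "power_comparable L a K r"
    "\<And>x. 0 < x \<Longrightarrow> x \<le> L \<Longrightarrow> \<rho> x = ennreal (r x)" "continuous_on {0<..L} r"
proof -
  obtain \<alpha> \<beta> \<phi> \<psi> where \<phi>: "\<phi> \<in> class_W L" and \<psi>: "\<psi> \<in> class_W L"
    and \<rho>: "\<And>x. 0 < x \<Longrightarrow> x \<le> L \<Longrightarrow> ennreal (\<phi> x) = ennreal (x powr \<alpha>) * \<rho> x"
       "\<And>x. 0 < x \<Longrightarrow> x \<le> L \<Longrightarrow> ennreal (\<psi> x) = ennreal (x powr \<beta>) / \<rho> x"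
    using assms unfolding class_WW_def by blast
  define r where "r x = \<phi> x / x powr \<alpha>" for x
  have pos: "0 < \<phi> x" "0 < \<psi> x" if "0 < x" "x \<le> L" for x
    using \<phi> \<psi> that by (auto simp: class_W_def)
  have rpos: "0 < r x" if "0 < x" "x \<le> L" for x
    using pos that by (simp add: r_def)
  have \<rho>r: "\<rho> x = ennreal (r x)" if x: "0 < x" "x \<le> L" for x
  proof -
    have "\<rho> x \<noteq> \<infinity>"
    proof
      assume "\<rho> x = \<infinity>"
      then have "ennreal (\<phi> x) = \<infinity>" using \<rho>(1)[OF x] x by (simp add: ennreal_mult_top)
      then show False by simp
    qed
    then obtain t where t: "\<rho> x = ennreal t" "0 \<le> t"
      by (cases "\<rho> x") auto
    then have "\<phi> x = x powr \<alpha> * t"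
      using \<rho>(1)[OF x] pos[OF x] by (simp flip: ennreal_mult)
    then show ?thesis using t x by (simp add: r_def)
  qed
  have \<psi>r: "\<psi> x = x powr \<beta> / r x" if x: "0 < x" "x \<le> L" for x
    using \<rho>(2)[OF x] \<rho>r[OF x] rpos[OF x] pos[OF x] x
    by (simp add: divide_ennreal ennreal_inj)
  obtain C1 where C1: "C1 > 0" "\<And>x y. 0 \<le> x \<Longrightarrow> x \<le> y \<Longrightarrow> y \<le> L \<Longrightarrow> \<phi> x \<le> C1 * \<phi> y"
    using \<phi> unfolding class_W_def by blast
  obtain C2 where C2: "C2 > 0" "\<And>x y. 0 \<le> x \<Longrightarrow> x \<le> y \<Longrightarrow> y \<le> L \<Longrightarrow> \<psi> x \<le> C2 * \<psi> y"
    using \<psi> unfolding class_W_def by blast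
  define a where "a = max \<bar>\<alpha>\<bar> \<bar>\<beta>\<bar>"
  define K where "K = max 1 (max C1 C2)"
  have "r x \<le> K * (y / x) powr a * r y" "r y \<le> K * (y / x) powr a * r x" if xy: "0 < x" "x \<le> y" "y \<le> L" for x y
  proof -
    have x: "0 < x" "x \<le> L" and y: "0 < y" "y \<le> L" using xy by auto
    have 1: "1 \<le> y / x" using xy by simp
    have "r x = \<phi> x / x powr \<alpha>" by (simp add: r_def)
    also have "\<dots> \<le> C1 * \<phi> y / x powr \<alpha>"
      using C1(2)[of x y] xy by (intro divide_right_mono) auto
    also have "\<dots> = C1 * (y / x) powr \<alpha> * r y"
      using x y by (simp add: r_def powr_divide)
    also have "\<dots> \<le> K * (y / x) powr a * r y"
      using rpos[OF y] 1 C1 by (intro mult_right_mono mult_mono powr_mono) (auto simp: K_def a_def)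
    finally show "r x \<le> K * (y / x) powr a * r y" .
    have "x powr \<beta> / r x \<le> C2 * (y powr \<beta> / r y)"
      using C2(2)[of x y] xy \<psi>r[OF x] \<psi>r[OF y] by simp
    then have "r y \<le> C2 * (y / x) powr \<beta> * r x"
      using rpos[OF x] rpos[OF y] x y by (simp add: field_simps powr_divide)
    also have "\<dots> \<le> K * (y / x) powr a * r x"
      using rpos[OF x] 1 C2 by (intro mult_right_mono mult_mono powr_mono) (auto simp: K_def a_def)
    finally show "r y \<le> K * (y / x) powr a * r x" .
  qed
  moreover have "0 \<le> a" "1 \<le> K" by (auto simp: a_def K_def)
  ultimately have "power_comparable L a K r"
    unfolding power_comparable_def using rpos L by blast
  moreover have "continuous_on {0<..L} r"
    unfolding r_def using \<phi>
    by (intro continuous_intros) (auto simp: class_W_def elim: continuous_on_subset)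
  ultimately show thesis using \<rho>r that by blast
qed

locale radial_weight =
  fixes L a K :: real and r :: "real \<Rightarrow> real" and \<rho> :: "real \<Rightarrow> ennreal"
  assumes comp: "power_comparable L a K r"
    and \<rho>: "\<And>x. 0 < x \<Longrightarrow> x \<le> L \<Longrightarrow> \<rho> x = ennreal (r x)"
begin

lemma L_pos: "0 < L" and a_nonneg: "0 \<le> a" and K_ge_1: "1 \<le> K"
  and r_pos: "0 < x \<Longrightarrow> x \<le> L \<Longrightarrow> 0 < r x"
  using comp by (auto simp: power_comparable_def)

lemma comparable:
  assumes "0 < x" "x \<le> y" "y \<le> L"
  shows "r x \<le> K * (y / x) powr a * r y" "r y \<le> K * (y / x) powr a * r x"
  using comp assms unfolding power_comparable_def by blast+

definition \<Phi> :: "real \<Rightarrow> real" where "\<Phi> x = enn2real (Phi0 \<rho> x)"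

lemma eventually_small: "0 < x \<Longrightarrow> \<forall>\<^sub>F y in at_right 0. 0 < y \<and> y \<le> L \<and> x * y \<le> (L::real) \<and> 0 < x * y"
  unfolding eventually_at_right_field using L_pos
  by (intro exI[of _ "min L (L / x)"]) (auto simp: field_simps)

lemma ratio:
  assumes "0 < x" "0 < y" "y \<le> L" "x * y \<le> L"
  shows "\<rho> (x * y) / \<rho> y = ennreal (r (x * y) / r y)"
  using assms \<rho>[of "x * y"] \<rho>[of y] r_pos[of y] r_pos[of "x * y"] by (simp add: divide_ennreal)

definition bound :: "real \<Rightarrow> real" where "bound x = K * max x (1 / x) powr a"

lemma bound_pos: "0 < x \<Longrightarrow> 0 < bound x"
  using K_ge_1 by (auto simp: bound_def max_def)

lemma ratio_bounds:
  assumes x: "0 < x" and y: "0 < y" "y \<le> L" "x * y \<le> L"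
  shows "1 / bound x \<le> r (x * y) / r y" "r (x * y) / r y \<le> bound x"
proof -
  have *: "r (x * y) \<le> bound x * r y \<and> r y \<le> bound x * r (x * y)"
  proof (cases "1 \<le> x")
    case True
    then have "1 / x \<le> 1" by simp
    with True have "max x (1 / x) = x" by (intro max_absorb1) linarith
    then show ?thesis using comparable[of y "x * y"] True x y by (simp add: bound_def)
  next
    case False
    then have "1 \<le> 1 / x" using x by simp
    then have "x \<le> 1 / x" using False by linarith
    then have "max x (1 / x) = 1 / x" by simp
    then show ?thesis using comparable[of "x * y" y] False x y by (simp add: bound_def)
  qed
  have "0 < r y" "0 < r (x * y)" using r_pos x y by auto
  then show "1 / bound x \<le> r (x * y) / r y" "r (x * y) / r y \<le> bound x"
    using * bound_pos[OF x] by (simp_all add: field_simps)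
qed

lemma Phi0_bounds:
  assumes x: "0 < x"
  shows "ennreal (1 / bound x) \<le> Phi0 \<rho> x" "Phi0 \<rho> x \<le> ennreal (bound x)"
proof -
  show "ennreal (1 / bound x) \<le> Phi0 \<rho> x"
    unfolding Phi0_def
  proof (rule le_Limsup)
    show "\<forall>\<^sub>F y in at_right 0. ennreal (1 / bound x) \<le> \<rho> (x * y) / \<rho> y"
      using eventually_small[OF x]
      by eventually_elim (use ratio ratio_bounds x in \<open>auto intro!: ennreal_leI\<close>)
  qed simp
  show "Phi0 \<rho> x \<le> ennreal (bound x)"
    unfolding Phi0_def
  proof (rule Limsup_bounded)
    show "\<forall>\<^sub>F y in at_right 0. \<rho> (x * y) / \<rho> y \<le> ennreal (bound x)"
      using eventually_small[OF x]
      by eventually_elim (use ratio ratio_bounds x in \<open>auto intro!: ennreal_leI\<close>)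
  qed
qed

lemma Phi0_eq: "0 < x \<Longrightarrow> Phi0 \<rho> x = ennreal (\<Phi> x)"
  unfolding \<Phi>_def using le_less_trans[OF Phi0_bounds(2) ennreal_less_top] by simp

lemma \<Phi>_bounds:
  assumes "0 < x"
  shows "1 / bound x \<le> \<Phi> x" "\<Phi> x \<le> bound x"
proof -
  have "0 \<le> \<Phi> x" by (simp add: \<Phi>_def)
  then show "1 / bound x \<le> \<Phi> x" "\<Phi> x \<le> bound x"
    using Phi0_bounds[OF assms] bound_pos[OF assms] Phi0_eq[OF assms] by (simp_all add: ennreal_le_iff)
qed

lemma \<Phi>_pos: "0 < x \<Longrightarrow> 0 < \<Phi> x"
  using \<Phi>_bounds(1)[of x] bound_pos[of x] by (meson divide_pos_pos less_le_trans zero_less_one)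

lemma \<Phi>_le:
  assumes x: "0 < x" and c: "0 \<le> c" and ev: "\<forall>\<^sub>F y in at_right 0. r (x * y) \<le> c * r y"
  shows "\<Phi> x \<le> c"
proof -
  have "Phi0 \<rho> x \<le> ennreal c"
    unfolding Phi0_def
  proof (rule Limsup_bounded)
    show "\<forall>\<^sub>F y in at_right 0. \<rho> (x * y) / \<rho> y \<le> ennreal c"
      using eventually_small[OF x] ev
      by eventually_elim (use ratio r_pos x in \<open>auto intro!: ennreal_leI simp: divide_le_eq\<close>)
  qed
  then show ?thesis using Phi0_eq[OF x] c by (simp add: ennreal_le_iff)
qed

lemma eventually_less_of_\<Phi>_less:
  assumes x: "0 < x" and c: "\<Phi> x < c"
  shows "\<forall>\<^sub>F y in at_right 0. r (x * y) < c * r y"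
proof -
  have "Phi0 \<rho> x < ennreal c"
    using Phi0_eq[OF x] c \<Phi>_pos[OF x] by (simp add: ennreal_less_iff)
  then have "\<forall>\<^sub>F y in at_right 0. \<rho> (x * y) / \<rho> y < ennreal c"
    unfolding Phi0_def by (rule Limsup_lessD)
  then show ?thesis
    using eventually_small[OF x]
  proof eventually_elim
    case (elim y)
    then have "ennreal (r (x * y) / r y) < ennreal c"
      using ratio[of x y] x by simp
    then have "r (x * y) / r y < c"
      by (meson ennreal_leI not_le)
    then show ?case using r_pos[of y] elim by (simp add: divide_less_eq)
  qed
qed

text \<open>
  Split \<open>r (x z y) / r y\<close> into \<open>r (x (z y)) / r (z y)\<close> and \<open>r (z y) / r y\<close>; as \<open>y\<close> tends to \<open>0\<close>, so does
  \<open>z y\<close>.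
\<close>
lemma \<Phi>_submultiplicative:
  assumes x: "0 < x" and z: "0 < z"
  shows "\<Phi> (x * z) \<le> \<Phi> x * \<Phi> z"
proof -
  have *: "\<Phi> (x * z) \<le> c * d" if c: "\<Phi> x < c" and d: "\<Phi> z < d" for c d
  proof (rule \<Phi>_le)
    have cd: "0 < c" "0 < d" using c d \<Phi>_pos x z by (meson less_trans)+
    show "0 \<le> c * d" using cd by simp
    have "filterlim (\<lambda>y. z * y) (at_right 0) (at_right 0)"
      using z unfolding filterlim_at
      by (auto intro!: tendsto_eq_intros simp: eventually_at_right_field intro: exI[of _ 1])
    from eventually_compose_filterlim[OF eventually_less_of_\<Phi>_less[OF x c] this]
    have "\<forall>\<^sub>F y in at_right 0. r (x * (z * y)) < c * r (z * y)" .
    then show "\<forall>\<^sub>F y in at_right 0. r (x * z * y) \<le> c * d * r y"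
      using eventually_less_of_\<Phi>_less[OF z d]
    proof eventually_elim
      case (elim y)
      have "r (x * z * y) \<le> c * r (z * y)" using elim by (simp add: mult.assoc)
      also have "\<dots> \<le> c * (d * r y)" using elim cd by (intro mult_left_mono) auto
      finally show ?case by (simp add: mult.assoc)
    qed
  qed (use x z in auto)
  have "((\<lambda>e. (\<Phi> x + e) * (\<Phi> z + e)) \<longlongrightarrow> (\<Phi> x + 0) * (\<Phi> z + 0)) (at_right 0)"
    by (intro tendsto_intros)
  moreover have "\<forall>\<^sub>F e in at_right 0. \<Phi> (x * z) \<le> (\<Phi> x + e) * (\<Phi> z + e)"
    unfolding eventually_at_right_field by (intro exI[of _ 1]) (auto intro!: *)
  ultimately have "\<Phi> (x * z) \<le> (\<Phi> x + 0) * (\<Phi> z + 0)"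
    by (rule tendsto_lowerbound) simp
  then show ?thesis by simp
qed

end

text \<open>
  Fekete's lemma for a function of a positive real variable. The bound on \<open>F\<close> controls the
  remainder when \<open>u\<close> is divided by a fixed \<open>u\<^sub>0\<close>.
\<close>
lemma subadditive_quotient_limit:
  fixes F :: "real \<Rightarrow> real"
  assumes sub: "\<And>u v. 0 < u \<Longrightarrow> 0 < v \<Longrightarrow> F (u + v) \<le> F u + F v"
    and bound: "\<And>u. 0 < u \<Longrightarrow> \<bar>F u\<bar> \<le> A * u + B"
  obtains l where "((\<lambda>u. F u / u) \<longlongrightarrow> l) at_top" "\<And>u. 0 < u \<Longrightarrow> l \<le> F u / u"
proof -
  define S where "S = (\<lambda>u. F u / u) ` {1..}"
  define l where "l = Inf S"
  have B: "0 \<le> A + B" using bound[of 1] by simp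
  have B0: "0 \<le> B"
  proof (rule ccontr)
    assume "\<not> 0 \<le> B"
    define u where "u = min 1 (- B / (2 * (\<bar>A\<bar> + 1)))"
    have u: "0 < u" "u \<le> - B / (2 * (\<bar>A\<bar> + 1))" using \<open>\<not> 0 \<le> B\<close> by (auto simp: u_def field_simps)
    have "A * u \<le> (\<bar>A\<bar> + 1) * u" using u by (intro mult_right_mono) auto
    also have "\<dots> \<le> - B / 2" using u(2) by (simp add: field_simps)
    finally show False using bound[OF u(1)] \<open>\<not> 0 \<le> B\<close> by (smt (verit) field_sum_of_halves)
  qed
  have low: "- (A + B) \<le> F u / u" if "1 \<le> u" for u
  proof -
    have "- (A * u + B) \<le> F u" using bound[of u] that by linarith
    moreover have "B \<le> B * u" using that B0 by (simp add: mult_le_cancel_left1)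
    ultimately have "- (A + B) * u \<le> F u" by (simp add: algebra_simps)
    then show ?thesis using that by (simp add: le_divide_eq)
  qed
  have bdd: "bdd_below S" unfolding S_def bdd_below_def using low by auto
  have F_mult: "F (real (Suc n) * u) \<le> real (Suc n) * F u" if "0 < u" for n u
  proof (induction n)
    case (Suc n)
    have "F (real (Suc (Suc n)) * u) = F (real (Suc n) * u + u)" by (simp add: algebra_simps)
    also have "\<dots> \<le> F (real (Suc n) * u) + F u" using that by (intro sub) auto
    finally show ?case using Suc by (simp add: algebra_simps)
  qed simp
  have l_le: "l \<le> F u / u" if u: "0 < u" for u
  proof -
    obtain n where n: "1 / u \<le> real n" using real_arch_simple by blast
    have "1 \<le> real (Suc n) * u" using n u by (simp add: field_simps)
    then have "l \<le> F (real (Suc n) * u) / (real (Suc n) * u)"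
      unfolding l_def S_def using bdd[unfolded S_def] by (intro cInf_lower) auto
    also have "\<dots> \<le> real (Suc n) * F u / (real (Suc n) * u)"
      using F_mult[OF u] u by (intro divide_right_mono) auto
    also have "\<dots> = F u / u" by simp
    finally show ?thesis .
  qed
  have "((\<lambda>u. F u / u) \<longlongrightarrow> l) at_top"
  proof (rule order_tendstoI)
    fix c assume "c < l"
    show "\<forall>\<^sub>F u in at_top. c < F u / u"
      using eventually_gt_at_top[of 0] by eventually_elim (use l_le \<open>c < l\<close> in \<open>meson less_le_trans\<close>)
  next
    fix c assume c: "l < c"
    then obtain u0 where u0: "1 \<le> u0" "F u0 / u0 < c"
      using cInf_lessD[of S c] by (auto simp: S_def l_def)
    define t where "t = F u0 / u0"
    define E where "E = 2 * u0 * \<bar>t\<bar> + \<bar>A\<bar> * (2 * u0) + B"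
    have ev: "F u / u \<le> t + E / u" if u: "2 * u0 \<le> u" for u
    proof -
      \<comment> \<open>One less than the integer quotient, so that the remainder \<open>v\<close> is positive and subadditivity applies.\<close>
      define n where "n = nat \<lfloor>u / u0\<rfloor> - 1"
      have fl: "2 \<le> \<lfloor>u / u0\<rfloor>" using u u0 by (simp add: le_floor_iff field_simps)
      then have n1: "1 \<le> n" and rn: "real n = of_int \<lfloor>u / u0\<rfloor> - 1" unfolding n_def by linarith+
      define v where "v = u - real n * u0"
      have "real n + 1 \<le> u / u0" "u / u0 < real n + 2"
        using floor_correct[of "u / u0"] rn by linarith+
      then have "(real n + 1) * u0 \<le> u" "u < (real n + 2) * u0"
        using u0 by (simp_all add: le_divide_eq divide_less_eq)
      then have v: "u0 \<le> v" "v < 2 * u0" by (auto simp: v_def algebra_simps)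
      have "F u = F (real n * u0 + v)" by (simp add: v_def)
      also have "\<dots> \<le> F (real n * u0) + F v" using n1 u0 v by (intro sub) auto
      also have "F (real n * u0) \<le> real n * F u0" using F_mult[of u0 "n - 1"] n1 u0 by simp
      also have "real n * F u0 = (u - v) * t" using u0 by (simp add: t_def v_def)
      also have "(u - v) * t \<le> u * t + 2 * u0 * \<bar>t\<bar>"
      proof -
        have "- (v * t) \<le> v * \<bar>t\<bar>" using v u0 by (simp add: abs_if mult_nonneg_nonneg)
        also have "\<dots> \<le> 2 * u0 * \<bar>t\<bar>" using v by (intro mult_right_mono) auto
        finally show ?thesis by (simp add: algebra_simps)
      qed
      also have "F v \<le> \<bar>A\<bar> * (2 * u0) + B"
      proof -
        have "F v \<le> A * v + B" using bound[of v] v u0 by auto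
        also have "A * v \<le> \<bar>A\<bar> * v" using v u0 by (intro mult_right_mono) auto
        also have "\<bar>A\<bar> * v \<le> \<bar>A\<bar> * (2 * u0)" using v by (intro mult_left_mono) auto
        finally show ?thesis by simp
      qed
      finally have "F u \<le> u * t + E" by (simp add: E_def)
      then show ?thesis using u u0 by (simp add: field_simps)
    qed
    have "((\<lambda>u. t + E / u) \<longlongrightarrow> t + 0) at_top"
      by (intro tendsto_intros real_tendsto_divide_at_top[OF tendsto_const] filterlim_ident)
    then have "\<forall>\<^sub>F u in at_top. t + E / u < c"
      using u0 by (auto simp: t_def dest!: order_tendstoD(2))
    then show "\<forall>\<^sub>F u in at_top. F u / u < c"
      using eventually_ge_at_top[of "2 * u0"] by eventually_elim (use ev in \<open>meson le_less_trans\<close>)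
  qed
  then show thesis using l_le that by blast
qed

context radial_weight
begin

lemma ln_\<Phi>_bound:
  assumes "0 < u" shows "\<bar>ln (\<Phi> (exp u))\<bar> \<le> a * u + ln K" "\<bar>ln (\<Phi> (exp (- u)))\<bar> \<le> a * u + ln K"
proof -
  have b: "bound (exp u) = K * exp (a * u)" "bound (exp (- u)) = K * exp (a * u)"
  proof -
    have "1 / exp u = exp (- u)" "1 / exp (- u) = exp u" by (auto simp: exp_minus divide_inverse)
    moreover have "max (exp u) (exp (- u)) = exp u" "max (exp (- u)) (exp u) = exp u"
      using assms by auto
    ultimately show "bound (exp u) = K * exp (a * u)" "bound (exp (- u)) = K * exp (a * u)"
      by (simp_all add: bound_def powr_def)
  qed
  have *: "\<bar>ln t\<bar> \<le> a * u + ln K" if "0 < t" "1 / (K * exp (a * u)) \<le> t" "t \<le> K * exp (a * u)" for t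
  proof -
    have "ln t \<le> ln (K * exp (a * u))" using that by (intro ln_mono) auto
    moreover have "ln (1 / (K * exp (a * u))) \<le> ln t" using that K_ge_1 by (intro ln_mono) auto
    ultimately show ?thesis using K_ge_1 by (simp add: ln_mult ln_div)
  qed
  show "\<bar>ln (\<Phi> (exp u))\<bar> \<le> a * u + ln K" "\<bar>ln (\<Phi> (exp (- u)))\<bar> \<le> a * u + ln K"
    using \<Phi>_bounds[of "exp u"] \<Phi>_bounds[of "exp (- u)"] \<Phi>_pos[of "exp u"] \<Phi>_pos[of "exp (- u)"]
    unfolding b by (auto intro!: *)
qed

lemma upper_index_less:
  assumes x: "1 < x" and c: "\<Phi> x < x powr c"
  shows "upper_index \<rho> < c"
proof -
  define F where "F u = ln (\<Phi> (exp u))" for u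
  have "F (u + v) \<le> F u + F v" for u v
  proof -
    have "F (u + v) \<le> ln (\<Phi> (exp u) * \<Phi> (exp v))"
      unfolding F_def exp_add using \<Phi>_pos by (intro ln_mono \<Phi>_submultiplicative) auto
    then show ?thesis using \<Phi>_pos[of "exp u"] \<Phi>_pos[of "exp v"] by (simp add: F_def ln_mult)
  qed
  moreover have "\<bar>F u\<bar> \<le> a * u + ln K" if "0 < u" for u
    using ln_\<Phi>_bound[OF that] by (simp add: F_def)
  ultimately obtain l where l: "((\<lambda>u. F u / u) \<longlongrightarrow> l) at_top" "\<And>u. 0 < u \<Longrightarrow> l \<le> F u / u"
    using subadditive_quotient_limit[of F a "ln K"] by blast
  have "((\<lambda>x. F (ln x) / ln x) \<longlongrightarrow> l) at_top"
    using filterlim_compose[OF l(1) ln_at_top] .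
  moreover have "\<forall>\<^sub>F x in at_top. F (ln x) / ln x = ln (enn2real (Phi0 \<rho> x)) / ln x"
    using eventually_gt_at_top[of 0] by eventually_elim (simp add: F_def \<Phi>_def)
  ultimately have "((\<lambda>x. ln (enn2real (Phi0 \<rho> x)) / ln x) \<longlongrightarrow> l) at_top"
    by (rule Lim_transform_eventually)
  then have "upper_index \<rho> = l"
    unfolding upper_index_def by (rule tendsto_Lim[rotated]) simp
  also have "l \<le> F (ln x) / ln x" using x by (intro l(2)) simp
  also have "\<dots> < c"
  proof -
    have "ln (\<Phi> x) < ln (x powr c)" using c \<Phi>_pos[of x] x by (subst ln_less_cancel_iff) auto
    then show ?thesis using x by (simp add: F_def divide_less_eq ln_powr)
  qed
  finally show ?thesis .
qed

lemma lower_index_greater: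
  assumes x: "0 < x" "x < 1" and c: "\<Phi> x < x powr c"
  shows "c < lower_index \<rho>"
proof -
  define F where "F u = ln (\<Phi> (exp (- u)))" for u
  have "F (u + v) \<le> F u + F v" for u v
  proof -
    have "F (u + v) \<le> ln (\<Phi> (exp (- u)) * \<Phi> (exp (- v)))"
      unfolding F_def minus_add_distrib exp_add using \<Phi>_pos by (intro ln_mono \<Phi>_submultiplicative) auto
    then show ?thesis using \<Phi>_pos[of "exp (- u)"] \<Phi>_pos[of "exp (- v)"] by (simp add: F_def ln_mult)
  qed
  moreover have "\<bar>F u\<bar> \<le> a * u + ln K" if "0 < u" for u
    using ln_\<Phi>_bound[OF that] by (simp add: F_def)
  ultimately obtain l where l: "((\<lambda>u. F u / u) \<longlongrightarrow> l) at_top" "\<And>u. 0 < u \<Longrightarrow> l \<le> F u / u"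
    using subadditive_quotient_limit[of F a "ln K"] by blast
  have "filterlim (\<lambda>x::real. - ln x) at_top (at_right 0)"
    using ln_at_0 by (simp add: filterlim_uminus_at_top)
  from filterlim_compose[OF l(1) this]
  have "((\<lambda>x. - (F (- ln x) / (- ln x))) \<longlongrightarrow> - l) (at_right 0)" by (intro tendsto_minus)
  moreover have "\<forall>\<^sub>F x in at_right 0. - (F (- ln x) / (- ln x)) = ln (enn2real (Phi0 \<rho> x)) / ln x"
    unfolding eventually_at_right_field by (intro exI[of _ 1]) (simp add: F_def \<Phi>_def)
  ultimately have "((\<lambda>x. ln (enn2real (Phi0 \<rho> x)) / ln x) \<longlongrightarrow> - l) (at_right 0)"
    by (rule Lim_transform_eventually)
  then have "lower_index \<rho> = - l"
    unfolding lower_index_def by (rule tendsto_Lim[rotated]) simp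
  moreover have "l \<le> F (- ln x) / (- ln x)" using x by (intro l(2)) simp
  moreover have "F (- ln x) / (- ln x) < - c"
  proof -
    have "ln (\<Phi> x) < ln (x powr c)" using c \<Phi>_pos[of x] x by (subst ln_less_cancel_iff) auto
    then have "c < ln (\<Phi> x) / ln x" using x by (subst neg_less_divide_eq) (auto simp: ln_powr)
    then show ?thesis using x by (simp add: F_def)
  qed
  ultimately show ?thesis by simp
qed

end

text \<open>
  The number of steps after which \<open>\<psi>\<close> is halved depends on the point but is at most \<open>m\<close>; iterating
  gives decay like \<open>(1/2) ^ (s div m)\<close> after \<open>s\<close> steps, up to the factor \<open>K\<close>, and a fixed number \<open>N\<close> of
  steps absorbs \<open>K\<close>.
\<close>
lemma halving_iterate:
  fixes \<psi> :: "real \<Rightarrow> real"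
  assumes m: "\<And>y. 0 < y \<Longrightarrow> y < R \<Longrightarrow> \<exists>i\<in>{1..m}. \<psi> (y / 2 ^ i) \<le> \<psi> y / 2"
    and K: "\<And>y i. 0 < y \<Longrightarrow> y < R \<Longrightarrow> i \<le> m \<Longrightarrow> \<psi> (y / 2 ^ i) \<le> K * \<psi> y"
    and pos: "\<And>y. 0 < y \<Longrightarrow> y < R \<Longrightarrow> 0 < \<psi> y" and "0 < R"
  obtains N where "1 \<le> N" "\<And>y. 0 < y \<Longrightarrow> y < R \<Longrightarrow> \<psi> (y / 2 ^ N) \<le> \<psi> y / 2"
proof -
  have m1: "1 \<le> m" using m[of "R / 2"] \<open>0 < R\<close> by auto
  have K0: "0 < K" 
    using K[of "R / 2" 0] pos[of "R / 2"] \<open>0 < R\<close> by (simp add: mult_le_cancel_right1)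
  have step: "\<psi> (y / 2 ^ s) \<le> K * (1 / 2) ^ (s div m) * \<psi> y" if "0 < y" "y < R" for s y
    using that
  proof (induction s arbitrary: y rule: less_induct)
    case (less s)
    show ?case
    proof (cases "s < m")
      case True
      then show ?thesis using K[of y s] less.prems by simp
    next
      case False
      obtain i where i: "1 \<le> i" "i \<le> m" "\<psi> (y / 2 ^ i) \<le> \<psi> y / 2"
        using m[OF less.prems] by auto
      have le_y: "y / 2 ^ i \<le> y" using less.prems by (simp add: field_simps)
      have "\<psi> (y / 2 ^ s) = \<psi> (y / 2 ^ i / 2 ^ (s - i))"
        using i False by (simp flip: power_add)
      also have "\<dots> \<le> K * (1 / 2) ^ ((s - i) div m) * \<psi> (y / 2 ^ i)"
        using i False m1 less.prems le_y by (intro less.IH) auto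
      also have "\<dots> \<le> K * (1 / 2) ^ ((s - i) div m) * (\<psi> y / 2)"
        using i K0 by (intro mult_left_mono) auto
      also have "\<dots> = K * (1 / 2) ^ Suc ((s - i) div m) * \<psi> y" by simp
      also have "\<dots> \<le> K * (1 / 2) ^ (s div m) * \<psi> y"
      proof -
        have "s div m \<le> (s - i + m) div m" using i False by (intro div_le_mono) auto
        also have "\<dots> = Suc ((s - i) div m)" using m1 by simp
        finally show ?thesis
          using K0 pos[OF less.prems] by (intro mult_right_mono mult_left_mono power_decreasing) auto
      qed
      finally show ?thesis .
    qed
  qed
  obtain n where n: "(1 / 2) ^ n < 1 / (2 * K)"
    using real_arch_pow_inv[of "1 / (2 * K)" "1 / 2"] K0 by auto
  have small: "K * (1 / 2) ^ Suc n \<le> 1 / 2"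
    using n K0 by (simp add: field_simps)
  show thesis
  proof
    show "1 \<le> Suc n * m" using m1 by simp
    fix y assume y: "0 < y" "y < R"
    have "\<psi> (y / 2 ^ (Suc n * m)) \<le> K * (1 / 2) ^ Suc n * \<psi> y"
      using step[OF y, of "Suc n * m"] m1 by (simp del: mult_Suc)
    also have "\<dots> \<le> 1 / 2 * \<psi> y" using small pos[OF y] by (intro mult_right_mono) auto
    finally show "\<psi> (y / 2 ^ (Suc n * m)) \<le> \<psi> y / 2" by simp
  qed
qed

context radial_weight
begin

lemma comparable_dyadic:
  assumes "0 < y" "y \<le> L" "i \<le> m"
  shows "r (y / 2 ^ i) \<le> K * (2 ^ m) powr a * r y" "r y \<le> K * (2 ^ m) powr a * r (y / 2 ^ i)"
proof -
  have y: "0 < y / 2 ^ i" "y / 2 ^ i \<le> y" using assms by (auto simp: field_simps)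
  have "(2 ^ i :: real) powr a \<le> (2 ^ m) powr a"
    using assms a_nonneg by (intro powr_mono2 power_increasing) auto
  moreover have "y / (y / 2 ^ i) = 2 ^ i" using assms by simp
  ultimately have *: "K * (y / (y / 2 ^ i)) powr a * t \<le> K * (2 ^ m) powr a * t" if "0 < t" for t
    using K_ge_1 that by (intro mult_right_mono mult_left_mono) auto
  show "r (y / 2 ^ i) \<le> K * (2 ^ m) powr a * r y" "r y \<le> K * (2 ^ m) powr a * r (y / 2 ^ i)"
    using comparable[OF y assms(2)] * r_pos assms y
    by (meson order_trans)+
qed

text \<open>
  The hypothesis \<open>key\<close> with \<open>I = {0}\<close> and \<open>J = {1..m}\<close> shows that \<open>\<psi>\<close> is halved within \<open>m\<close> dyadic
  steps; with \<open>I = {1..m}\<close> and \<open>J = {0}\<close> it shows the same for \<open>y / \<psi> y\<close>, because \<open>m powr (1/q)\<close> grows more slowly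
  than \<open>m\<close>.
\<close>
lemma index_bounds_from_dyadic:
  fixes p0 q P M R0 :: real
  defines "\<psi> \<equiv> \<lambda>x. r x * x powr (1 / p0)"
  assumes p0: "1 < p0" and q: "1 < q" and P: "1 \<le> P" and R0: "0 < R0" "R0 \<le> L"
    and key: "\<And>R I J X. 0 < R \<Longrightarrow> R < R0 \<Longrightarrow> finite I \<Longrightarrow> I \<noteq> {} \<Longrightarrow> finite J \<Longrightarrow> 0 < X \<Longrightarrow>
        (\<And>j. j \<in> J \<Longrightarrow> X * real (card I) powr (1 / q) * R \<le> (\<Sum>i\<in>I. (R / 2 ^ i) / \<psi> (R / 2 ^ i)) * \<psi> (R / 2 ^ j)) \<Longrightarrow>
        real (card J) * min (X powr P) X \<le> M"
  shows "0 < 1 / p0 + lower_index \<rho>" "1 / p0 + upper_index \<rho> < 1"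
proof -
  have \<psi>_pos: "0 < \<psi> y" if "0 < y" "y < R0" for y
    using r_pos[of y] that R0 by (simp add: \<psi>_def)
  have div2: "0 < y / 2 ^ i" "y / 2 ^ i < R0" "y / 2 ^ i \<le> y" if "0 < y" "y < R0" for y :: real and i :: nat
  proof -
    show "0 < y / 2 ^ i" "y / 2 ^ i \<le> y" using that by (auto simp: field_simps)
    then show "y / 2 ^ i < R0" using that by linarith
  qed
  show "0 < 1 / p0 + lower_index \<rho>"
  proof -
    define c where "c = min ((1/2) powr P) (1/2::real)"
    have c: "0 < c" by (simp add: c_def)
    obtain m where m: "M / c < real m" using reals_Archimedean2 by blast
    have half: "\<exists>i\<in>{1..m}. \<psi> (y / 2 ^ i) \<le> \<psi> y / 2" if y: "0 < y" "y < R0" for y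
    proof (rule ccontr)
      assume "\<not> ?thesis"
      then have "\<psi> y \<le> 2 * \<psi> (y / 2 ^ i)" if "i \<in> {1..m}" for i using that by force
      then have "real (card {1..m}) * min ((1/2) powr P) (1/2) \<le> M"
        using y \<psi>_pos[OF y] by (intro key[of y "{0}"]) (auto simp: field_simps)
      then show False using m c by (simp add: c_def[symmetric] field_simps)
    qed
    have "\<psi> (y / 2 ^ i) \<le> K * (2 ^ m) powr a * \<psi> y" if y: "0 < y" "y < R0" and i: "i \<le> m" for y i
    proof -
      have "r (y / 2 ^ i) * (y / 2 ^ i) powr (1 / p0) \<le> (K * (2 ^ m) powr a * r y) * y powr (1 / p0)"
        using comparable_dyadic[of y i m] y i R0 div2[OF y, of i] p0 K_ge_1 r_pos[of y]
        by (intro mult_mono powr_mono2) auto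
      then show ?thesis by (simp add: \<psi>_def mult.assoc)
    qed
    with half \<psi>_pos R0(1) obtain N where N: "1 \<le> N" "\<And>y. 0 < y \<Longrightarrow> y < R0 \<Longrightarrow> \<psi> (y / 2 ^ N) \<le> \<psi> y / 2"
      using halving_iterate[of R0 m \<psi> "K * (2 ^ m) powr a"] by blast
    define x where "x = (1 / 2 ^ N :: real)"
    have x: "0 < x" "x < 1" using N(1) by (auto simp: x_def field_simps)
    have "\<Phi> x \<le> x powr (- (1 / p0)) / 2"
    proof (rule \<Phi>_le[OF x(1)])
      show "\<forall>\<^sub>F y in at_right 0. r (x * y) \<le> x powr (- (1 / p0)) / 2 * r y"
        unfolding eventually_at_right_field
      proof (intro exI[of _ R0] conjI allI impI R0)
        fix y assume y: "0 < y" "y < R0"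
        have "r (x * y) * (x powr (1 / p0) * y powr (1 / p0)) \<le> r y * y powr (1 / p0) / 2"
          using N(2)[OF y] x y by (simp add: \<psi>_def x_def powr_mult[symmetric])
        then show "r (x * y) \<le> x powr (- (1 / p0)) / 2 * r y"
          using x y by (simp add: powr_minus field_simps)
      qed
    qed auto
    also have "\<dots> < x powr (- (1 / p0))" using x by simp
    finally show ?thesis using lower_index_greater[OF x, of "- (1 / p0)"] by simp
  qed
  show "1 / p0 + upper_index \<rho> < 1"
  proof -
    define b where "b = (\<lambda>y. y / \<psi> y)"
    have b_pos: "0 < b y" if "0 < y" "y < R0" for y
      using \<psi>_pos[OF that] that by (simp add: b_def)
    have b_eq: "b y = y powr (1 - 1 / p0) / r y" if "0 < y" for y
      using that by (simp add: b_def \<psi>_def powr_diff field_simps)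
    define \<delta> where "\<delta> = 1 - 1 / q"
    have \<delta>: "0 < \<delta>" using q by (simp add: \<delta>_def)
    obtain m where m0: "(2 * (max M 1 + 1)) powr (1 / \<delta>) < real m" using reals_Archimedean2 by blast
    have "((2 * (max M 1 + 1)) powr (1 / \<delta>)) powr \<delta> \<le> real m powr \<delta>"
      using m0 \<delta> by (intro powr_mono2) auto
    then have m: "max M 1 + 1 \<le> (1/2) * real m powr (1 - 1 / q)" "1 \<le> m"
      using \<delta> m0 by (auto simp: powr_powr \<delta>_def[symmetric]) (use less_le_trans in \<open>fastforce simp: not_less_eq_eq\<close>)
    define X where "X = (1/2) * real m powr (1 - 1 / q)"
    have X: "1 < X" "M < X" using m by (auto simp: X_def)
    have half: "\<exists>i\<in>{1..m}. b (y / 2 ^ i) \<le> b y / 2" if y: "0 < y" "y < R0" for y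
    proof (rule ccontr)
      assume "\<not> ?thesis"
      then have *: "b y / 2 \<le> b (y / 2 ^ i)" if "i \<in> {1..m}" for i using that by force
      have "real m * (b y / 2) \<le> (\<Sum>i\<in>{1..m}. b (y / 2 ^ i))"
        using sum_mono[OF *, of "{1..m}" "\<lambda>i. i"] by simp
      then have "real m * (b y / 2) * \<psi> y \<le> (\<Sum>i\<in>{1..m}. b (y / 2 ^ i)) * \<psi> y"
        using \<psi>_pos[OF y] by (intro mult_right_mono) auto
      also have "real m * (b y / 2) * \<psi> y = real m / 2 * y"
        using \<psi>_pos[OF y] by (simp add: b_def)
      also have "real m / 2 = X * real m powr (1 / q)"
        using m by (simp add: X_def powr_add[symmetric])
      finally have "real (card {0::nat}) * min (X powr P) X \<le> M"
        using y m X by (intro key[of y "{1..m}"]) (auto simp: b_def)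
      moreover have "X powr 1 \<le> X powr P" using X P by (intro powr_mono) auto
      ultimately show False using X by simp
    qed
    have "b (y / 2 ^ i) \<le> K * (2 ^ m) powr a * b y" if y: "0 < y" "y < R0" and i: "i \<le> m" for y i
    proof -
      have pos2: "0 < r (y / 2 ^ i)" using r_pos[of "y / 2 ^ i"] div2[OF y, of i] R0 by linarith
      have "r y \<le> K * (2 ^ m) powr a * r (y / 2 ^ i)"
        using comparable_dyadic[of y i m] y i R0 by auto
      then have "1 / r (y / 2 ^ i) \<le> K * (2 ^ m) powr a / r y"
        using r_pos[of y] pos2 y R0 by (simp add: pos_divide_le_eq pos_le_divide_eq mult_ac)
      then have "(y / 2 ^ i) powr (1 - 1 / p0) * (1 / r (y / 2 ^ i)) \<le> y powr (1 - 1 / p0) * (K * (2 ^ m) powr a / r y)"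
        using div2[OF y, of i] p0 r_pos[of "y / 2 ^ i"] R0 by (intro mult_mono powr_mono2) auto
      then show ?thesis using y div2[OF y, of i] by (simp add: b_eq mult_ac)
    qed
    with half b_pos R0(1) obtain N where N: "1 \<le> N" "\<And>y. 0 < y \<Longrightarrow> y < R0 \<Longrightarrow> b (y / 2 ^ N) \<le> b y / 2"
      using halving_iterate[of R0 m b "K * (2 ^ m) powr a"] by blast
    define x where "x = (2 ^ N :: real)"
    have x: "1 < x" using N(1) by (auto simp: x_def)
    have "\<Phi> x \<le> x powr (1 - 1 / p0) / 2"
    proof (rule \<Phi>_le)
      show "\<forall>\<^sub>F y in at_right 0. r (x * y) \<le> x powr (1 - 1 / p0) / 2 * r y"
        unfolding eventually_at_right_field
      proof (intro exI[of _ "R0 / x"] conjI allI impI)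
        fix y assume y: "0 < y" "y < R0 / x"
        have xy: "0 < x * y" "x * y < R0" "y \<le> L" "x * y \<le> L"
          using x y R0 by (auto simp: field_simps) (smt (verit) mult_le_cancel_right1 mult.commute)
        have "b (x * y / x) \<le> b (x * y) / 2" using N(2)[OF xy(1,2)] by (simp add: x_def)
        then have "y powr (1 - 1 / p0) / r y \<le> x powr (1 - 1 / p0) * y powr (1 - 1 / p0) / r (x * y) / 2"
          using x y xy by (simp add: b_eq powr_mult)
        then show "r (x * y) \<le> x powr (1 - 1 / p0) / 2 * r y"
          using x y r_pos[of y] r_pos[of "x * y"] xy by (simp add: field_simps)
      qed (use x R0 in auto)
    qed (use x in auto)
    also have "\<dots> < x powr (1 - 1 / p0)" using x by simp
    finally have "upper_index \<rho> < 1 - 1 / p0" using upper_index_less[OF x, of "1 - 1 / p0"] by simp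
    then show ?thesis by simp
  qed
qed

end

section \<open>Testing the operator on dyadic arcs\<close>

context jordan_arclength
begin

text \<open>
  Follow the curve from \<open>t0\<close>. The arc ends where it first meets the circle of radius \<open>R\<close>
  and starts where it last meets the circle of radius \<open>R / 2\<close> before that.
\<close>
lemma crossing_arcs:
  assumes t0: "t0 \<in> \<Gamma>"
  obtains d a b where "0 < d"
    "\<And>R. 0 < R \<Longrightarrow> R < d \<Longrightarrow> 0 \<le> a R \<and> a R < b R \<and> b R \<le> L \<and>
      cmod (G (a R) - t0) = R / 2 \<and> cmod (G (b R) - t0) = R \<and>
      (\<forall>s\<in>{a R<..<b R}. R / 2 < cmod (G s - t0) \<and> cmod (G s - t0) < R)"
proof -
  obtain s0 where s0: "0 \<le> s0" "s0 < L" "G s0 = t0"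
  proof -
    obtain s where s: "s \<in> {0..L}" "G s = t0" using t0 image_G by (metis imageE)
    show thesis
      using that[of s] that[of 0] s G_closed L_pos by (cases "s = L") auto
  qed
  \<comment> \<open>Stopping halfway to the end of the parameter interval avoids returning to \<open>t0\<close>.\<close>
  define s1 where "s1 = (s0 + L) / 2"
  have s1: "s0 < s1" "s1 < L" using s0 by (auto simp: s1_def)
  define \<phi> where "\<phi> s = cmod (G s - t0)" for s
  have "G s1 \<noteq> t0" using G_inj[of s1 s0] s0 s1 by auto
  then have d: "0 < \<phi> s1" by (simp add: \<phi>_def)
  have \<phi>0: "\<phi> s0 = 0" by (simp add: \<phi>_def s0)
  have cont: "continuous_on {x..y} \<phi>" if "s0 \<le> x" "y \<le> s1" for x y
    unfolding \<phi>_def using that s0 s1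
    by (intro continuous_intros continuous_on_subset[OF continuous_on_G]) auto
  have "\<exists>ab. 0 \<le> fst ab \<and> fst ab < snd ab \<and> snd ab \<le> L \<and> \<phi> (fst ab) = R / 2 \<and> \<phi> (snd ab) = R \<and>
      (\<forall>s\<in>{fst ab<..<snd ab}. R / 2 < \<phi> s \<and> \<phi> s < R)" if R: "0 < R" "R < \<phi> s1" for R
  proof -
    have level_compact: "compact {s \<in> {x..y}. \<phi> s = c}" if "s0 \<le> x" "y \<le> s1" for x y c
    proof -
      have "compact ({x..y} \<inter> \<phi> -` {c})"
        using continuous_closed_preimage[OF cont[OF that], of "{c}"]
        by (intro compact_eq_bounded_closed[THEN iffD2] conjI) (auto intro: bounded_subset[of "{x..y}"])
      moreover have "{x..y} \<inter> \<phi> -` {c} = {s \<in> {x..y}. \<phi> s = c}" by auto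
      ultimately show ?thesis by simp
    qed
    have "\<exists>x\<ge>s0. x \<le> s1 \<and> \<phi> x = R"
      using R s1 \<phi>0 cont by (intro IVT') auto
    then obtain b where b: "b \<in> {s \<in> {s0..s1}. \<phi> s = R}" "\<And>s. s \<in> {s \<in> {s0..s1}. \<phi> s = R} \<Longrightarrow> b \<le> s"
      using compact_attains_inf[OF level_compact[of s0 s1 R]] by auto
    have below: "\<phi> s < R" if s: "s0 \<le> s" "s < b" for s
    proof (rule ccontr)
      assume "\<not> \<phi> s < R"
      then have "\<exists>x\<ge>s0. x \<le> s \<and> \<phi> x = R"
        using s b R \<phi>0 cont by (intro IVT') auto
      then show False using b s by force
    qed
    have "\<exists>x\<ge>s0. x \<le> b \<and> \<phi> x = R / 2"
      using R b \<phi>0 cont by (intro IVT') auto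
    then obtain a where a: "a \<in> {s \<in> {s0..b}. \<phi> s = R / 2}" "\<And>s. s \<in> {s \<in> {s0..b}. \<phi> s = R / 2} \<Longrightarrow> s \<le> a"
      using compact_attains_sup[OF level_compact[of s0 b "R / 2"]] b by auto
    have above: "R / 2 < \<phi> s" if s: "a < s" "s \<le> b" for s
    proof (rule ccontr)
      assume "\<not> R / 2 < \<phi> s"
      then have "\<exists>x\<ge>s. x \<le> b \<and> \<phi> x = R / 2"
        using s a b R cont by (intro IVT') auto
      then obtain x where "s \<le> x" "x \<le> b" "\<phi> x = R / 2" by blast
      then show False using a(1) a(2)[of x] s by auto
    qed
    have "a \<noteq> b" using a b R by auto
    then show ?thesis
      using a b above below s0 s1 by (intro exI[of _ "(a, b)"]) auto
  qed
  then have "\<forall>R. \<exists>ab. 0 < R \<longrightarrow> R < \<phi> s1 \<longrightarrow> 0 \<le> fst ab \<and> fst ab < snd ab \<and> snd ab \<le> L \<and> \<phi> (fst ab) = R / 2 \<and>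
      \<phi> (snd ab) = R \<and> (\<forall>s\<in>{fst ab<..<snd ab}. R / 2 < \<phi> s \<and> \<phi> s < R)" by blast
  then obtain ab where "\<forall>R. 0 < R \<longrightarrow> R < \<phi> s1 \<longrightarrow> 0 \<le> fst (ab R) \<and> fst (ab R) < snd (ab R) \<and> snd (ab R) \<le> L \<and>
      \<phi> (fst (ab R)) = R / 2 \<and> \<phi> (snd (ab R)) = R \<and> (\<forall>s\<in>{fst (ab R)<..<snd (ab R)}. R / 2 < \<phi> s \<and> \<phi> s < R)"
    by metis
  then show thesis
    using that[of "\<phi> s1" "\<lambda>R. fst (ab R)" "\<lambda>R. snd (ab R)"] d unfolding \<phi>_def by blast
qed

lemma G_in_open_arc:
  assumes "0 \<le> a" "b \<le> L" "s \<in> {0..L}"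
  shows "G s \<in> G ` {a<..<b} \<longleftrightarrow> s \<in> {a<..<b}"
proof
  assume "G s \<in> G ` {a<..<b}"
  then obtain s' where s': "s' \<in> {a<..<b}" "G s = G s'" by auto
  then show "s \<in> {a<..<b}" using G_inj[of s s'] assms by auto
qed auto

lemma open_arc:
  assumes ab: "0 \<le> a" "a \<le> b" "b \<le> L"
  shows "G ` {a<..<b} \<in> sets borel" "G ` {a<..<b} \<subseteq> \<Gamma>" "G ` {a<..<b} \<in> sets \<mu>"
    "emeasure \<mu> (G ` {a<..<b}) = ennreal (b - a)"
proof -
  have "G ` {a<..<b} = G ` {a..b} - {G a, G b}"
  proof (intro equalityI subsetI)
    fix z assume "z \<in> G ` {a<..<b}"
    then obtain s where s: "s \<in> {a<..<b}" "z = G s" by auto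
    then show "z \<in> G ` {a..b} - {G a, G b}"
      using G_inj[of s a] G_inj[of s b] ab by auto
  next
    fix z assume "z \<in> G ` {a..b} - {G a, G b}"
    then obtain s where s: "s \<in> {a..b}" "z = G s" "z \<noteq> G a" "z \<noteq> G b" by blast
    then have "s \<noteq> a" "s \<noteq> b" by auto
    with s show "z \<in> G ` {a<..<b}" by (intro image_eqI[of _ _ s]) auto
  qed
  moreover have "compact (G ` {a..b})"
    using ab by (intro compact_continuous_image continuous_on_subset[OF continuous_on_G]) auto
  ultimately show borel: "G ` {a<..<b} \<in> sets borel"
    by (auto intro: borel_compact)
  have "G ` {a<..<b} \<subseteq> G ` {0..L}" using ab by (intro image_mono) auto
  then show sub: "G ` {a<..<b} \<subseteq> \<Gamma>" using image_G by simp
  show "G ` {a<..<b} \<in> sets \<mu>" by (rule emeasure_length_measure(2)[OF borel sub])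
  have "{s \<in> {0..L}. G s \<in> G ` {a<..<b}} = {a<..<b}"
  proof (intro equalityI subsetI)
    fix s assume "s \<in> {a<..<b}"
    then show "s \<in> {s \<in> {0..L}. G s \<in> G ` {a<..<b}}" using ab by auto
  next
    fix s assume "s \<in> {s \<in> {0..L}. G s \<in> G ` {a<..<b}}"
    then show "s \<in> {a<..<b}" using G_in_open_arc[of a b s] ab by blast
  qed
  then show "emeasure \<mu> (G ` {a<..<b}) = ennreal (b - a)"
    using emeasure_length_measure(1)[OF borel sub] ab by simp
qed

lemma integral_step_function:
  assumes I: "finite I" and ab: "\<And>i. i \<in> I \<Longrightarrow> 0 \<le> a i \<and> a i \<le> b i \<and> b i \<le> L"
  shows "(LINT s:{0..L}|lebesgue. (\<Sum>i\<in>I. e i * indicator (G ` {a i<..<b i}) (G s)) * arc.D s)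
      = (\<Sum>i\<in>I. e i * (G (b i) - G (a i)))"
proof -
  have D_int: "set_integrable lebesgue {0..L} arc.D"
    unfolding set_integrable_def
  proof (rule Bochner_Integration.integrable_bound)
    show "integrable lebesgue (\<lambda>s. indicator {0..L} s :: real)"
      using L_pos by (intro integrable_completion[THEN iffD2] integrable_real_indicator) auto
    show "AE s in lebesgue. norm (indicator {0..L} s *\<^sub>R arc.D s) \<le> norm (indicator {0..L} s :: real)"
      using arc.norm_D_le by eventually_elim (auto simp: indicator_def)
  qed (rule arc.D_measurable)
  have D_int_open: "set_integrable lebesgue {a i<..<b i} arc.D" if "i \<in> I" for i
    using ab[OF that] by (intro set_integrable_subset[OF D_int]) auto
  have int_open: "(LINT s:{a i<..<b i}|lebesgue. arc.D s) = G (b i) - G (a i)" if "i \<in> I" for i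
  proof -
    have "(LINT s:{a i<..<b i}|lebesgue. arc.D s) = (LINT s:{a i..b i}|lebesgue. arc.D s)"
      by (rule set_integral_discrete_difference[of "{a i, b i}"]) auto
    also have "\<dots> = G (b i) - G (a i)" using ab[OF that] by (intro arc.integral_D) auto
    finally show ?thesis .
  qed
  have "(LINT s:{0..L}|lebesgue. (\<Sum>i\<in>I. e i * indicator (G ` {a i<..<b i}) (G s)) * arc.D s)
      = (\<integral>s. (\<Sum>i\<in>I. e i * (indicator {a i<..<b i} s *\<^sub>R arc.D s)) \<partial>lebesgue)"
    unfolding set_lebesgue_integral_def
  proof (intro Bochner_Integration.integral_cong refl)
    fix s :: real
    show "indicator {0..L} s *\<^sub>R ((\<Sum>i\<in>I. e i * indicator (G ` {a i<..<b i}) (G s)) * arc.D s)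
        = (\<Sum>i\<in>I. e i * (indicator {a i<..<b i} s *\<^sub>R arc.D s))"
    proof (cases "s \<in> {0..L}")
      case True
      have "indicator (G ` {a i<..<b i}) (G s) = (indicator {a i<..<b i} s :: complex)" if "i \<in> I" for i
        using G_in_open_arc[of "a i" "b i" s] ab[OF that] True by (simp add: indicator_def)
      then show ?thesis
        using True by (auto simp: sum_distrib_right indicator_def intro!: sum.cong)
    next
      case False
      have "indicator {a i<..<b i} s = (0::real)" if "i \<in> I" for i
        using ab[OF that] False by (auto simp: indicator_def)
      then show ?thesis using False by simp
    qed
  qed
  also have "\<dots> = (\<Sum>i\<in>I. e i * (LINT s:{a i<..<b i}|lebesgue. arc.D s))"
  proof -
    have "integrable lebesgue (\<lambda>s. e i * (indicator {a i<..<b i} s *\<^sub>R arc.D s))" if "i \<in> I" for i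
      using D_int_open[OF that] unfolding set_integrable_def by (rule integrable_mult_right)
    then have "(\<integral>s. (\<Sum>i\<in>I. e i * (indicator {a i<..<b i} s *\<^sub>R arc.D s)) \<partial>lebesgue)
        = (\<Sum>i\<in>I. \<integral>s. e i * (indicator {a i<..<b i} s *\<^sub>R arc.D s) \<partial>lebesgue)"
      by (rule Bochner_Integration.integral_sum)
    then show ?thesis
      unfolding set_lebesgue_integral_def by (simp only: integral_mult_right_zero)
  qed
  also have "\<dots> = (\<Sum>i\<in>I. e i * (G (b i) - G (a i)))"
    using int_open by simp
  finally show ?thesis .
qed

end

text \<open>
  The local situation at a node \<open>t0\<close>: for every small \<open>R\<close> a subarc with parameters in \<open>{a R<..<b R}\<close>
  crosses the annulus of outer radius \<open>R\<close>, has length at most a multiple of \<open>R\<close>, and carries a weight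
  comparable to \<open>r R\<close>. The assumption \<open>log_holder\<close> is the form in which continuity of the exponent is
  used.
\<close>
locale weighted_arcs = weighted_curve +
  fixes t0 :: complex and p0 :: real and r :: "real \<Rightarrow> real" and a b :: "real \<Rightarrow> real"
    and d C W A q P :: real
  assumes d: "0 < d" "d \<le> 1" and p0: "1 \<le> p0"
    and arcs: "\<And>R. 0 < R \<Longrightarrow> R < d \<Longrightarrow> 0 \<le> a R \<and> a R < b R \<and> b R \<le> L \<and>
      cmod (G (a R) - t0) = R / 2 \<and> cmod (G (b R) - t0) = R \<and>
      (\<forall>s\<in>{a R<..<b R}. R / 2 < cmod (G s - t0) \<and> cmod (G s - t0) < R)"
    and arc_length: "\<And>R. 0 < R \<Longrightarrow> R < d \<Longrightarrow> b R - a R \<le> C * R"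
    and weight: "\<And>R s. 0 < R \<Longrightarrow> R < d \<Longrightarrow> s \<in> {a R<..<b R} \<Longrightarrow>
      r R / W \<le> enn2real (w (G s)) \<and> enn2real (w (G s)) \<le> W * r R"
    and r_pos: "\<And>R. 0 < R \<Longrightarrow> R < d \<Longrightarrow> 0 < r R"
    and exponent: "\<And>\<tau>. \<tau> \<in> path_image g \<Longrightarrow> q \<le> p \<tau> \<and> p \<tau> \<le> P"
    and log_holder: "\<And>R s. 0 < R \<Longrightarrow> R < d \<Longrightarrow> s \<in> {a R<..<b R} \<Longrightarrow> \<bar>p (G s) - p0\<bar> * (- ln R) \<le> A"
    and constants: "1 \<le> C" "1 \<le> W" "0 \<le> A" "1 \<le> q"
begin

abbreviation piece :: "real \<Rightarrow> complex set" where "piece R \<equiv> G ` {a R<..<b R}"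

text \<open>
  Up to constants, the weighted norm of the indicator of \<open>piece R\<close>.
\<close>
definition \<psi> :: "real \<Rightarrow> real" where "\<psi> R = r R * R powr (1 / p0)"

lemma \<psi>_pos: "0 < R \<Longrightarrow> R < d \<Longrightarrow> 0 < \<psi> R"
  using r_pos by (simp add: \<psi>_def)

lemma piece:
  assumes "0 < R" "R < d"
  shows "piece R \<in> sets borel" "piece R \<subseteq> \<Gamma>" "piece R \<in> sets \<mu>" "emeasure \<mu> (piece R) = ennreal (b R - a R)"
    "R / 2 \<le> b R - a R"
proof -
  have ab: "0 \<le> a R" "a R \<le> b R" "b R \<le> L" "cmod (G (a R) - t0) = R / 2" "cmod (G (b R) - t0) = R"
    using arcs[OF assms] by auto
  show "piece R \<in> sets borel" "piece R \<subseteq> \<Gamma>" "piece R \<in> sets \<mu>" "emeasure \<mu> (piece R) = ennreal (b R - a R)"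
    using open_arc[OF ab(1-3)] by auto
  have "R / 2 \<le> cmod (G (b R) - G (a R))"
    using norm_triangle_ineq2[of "G (b R) - t0" "G (a R) - t0"] ab by simp
  also have "\<dots> \<le> 1 * dist (b R) (a R)"
    using lipschitz_onD[OF G_lipschitz, of "b R" "a R"] ab by (simp add: dist_norm)
  finally show "R / 2 \<le> b R - a R" using ab by (simp add: dist_real_def)
qed

lemma pieceD:
  assumes "0 < R" "R < d" "\<tau> \<in> piece R"
  shows "R / 2 < cmod (\<tau> - t0)" "cmod (\<tau> - t0) < R" "\<tau> \<in> \<Gamma>"
    "r R / W \<le> enn2real (w \<tau>)" "enn2real (w \<tau>) \<le> W * r R" "\<bar>p \<tau> - p0\<bar> * (- ln R) \<le> A" "q \<le> p \<tau>" "p \<tau> \<le> P" "1 \<le> p \<tau>"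
proof -
  obtain s where s: "s \<in> {a R<..<b R}" "\<tau> = G s" using assms by auto
  show "\<tau> \<in> \<Gamma>" using piece(2)[OF assms(1,2)] assms(3) by blast
  then show "q \<le> p \<tau>" "p \<tau> \<le> P" "1 \<le> p \<tau>" using exponent p_ge_1 by auto
  show "R / 2 < cmod (\<tau> - t0)" "cmod (\<tau> - t0) < R"
    using arcs[OF assms(1,2)] s by auto
  show "r R / W \<le> enn2real (w \<tau>)" "enn2real (w \<tau>) \<le> W * r R" "\<bar>p \<tau> - p0\<bar> * (- ln R) \<le> A"
    using weight[OF assms(1,2) s(1)] log_holder[OF assms(1,2) s(1)] s(2) by auto
qed

text \<open>
  The quotient of the two powers of \<open>R\<close> with exponents \<open>p \<tau> / p0\<close> and \<open>1\<close> is the exponential of a number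
  of modulus at most \<open>A\<close>, by \<open>log_holder\<close>.
\<close>
lemma powr_exponent_bounds:
  assumes R: "0 < R" "R < d" and \<tau>: "\<tau> \<in> piece R"
  shows "(R powr (- (1 / p0))) powr p \<tau> \<le> exp A / R" "exp (- A) / R \<le> (R powr (- (1 / p0))) powr p \<tau>"
proof -
  define v where "v = (p \<tau> - p0) / p0 * (- ln R)"
  have lnR: "0 \<le> - ln R" using R d by (simp add: ln_le_zero_iff)
  have "\<bar>v\<bar> = \<bar>p \<tau> - p0\<bar> * (- ln R) / p0"
    using p0 lnR by (simp add: v_def abs_mult)
  also have "\<dots> \<le> A / 1"
    using pieceD(6)[OF R \<tau>] p0 constants lnR by (intro frac_le) auto
  finally have v: "- A \<le> v" "v \<le> A" by auto
  have "(R powr (- (1 / p0))) powr p \<tau> = exp v * exp (- ln R)"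
    using R p0 by (simp add: powr_def v_def field_simps flip: exp_add)
  also have "\<dots> = exp v / R" using R by (simp add: exp_minus divide_inverse)
  finally show "(R powr (- (1 / p0))) powr p \<tau> \<le> exp A / R" "exp (- A) / R \<le> (R powr (- (1 / p0))) powr p \<tau>"
    using v R by (auto intro!: divide_right_mono)
qed

lemma dyadic:
  assumes "0 < R" "R < d"
  shows "0 < R / 2 ^ i" "R / 2 ^ i < d" "R / 2 ^ i \<le> R"
proof -
  show "0 < R / 2 ^ i" "R / 2 ^ i \<le> R" using assms by (auto simp: field_simps)
  then show "R / 2 ^ i < d" using assms by linarith
qed

lemma pieces_disjoint:
  assumes R: "0 < R" "R < d" and "\<tau> \<in> piece (R / 2 ^ i)" "\<tau> \<in> piece (R / 2 ^ j)"
  shows "i = j"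
proof -
  have *: False if ij: "i < j" and i: "\<tau> \<in> piece (R / 2 ^ i)" and j: "\<tau> \<in> piece (R / 2 ^ j)" for i j
  proof -
    have "(2::real) ^ Suc i \<le> 2 ^ j" using ij by (intro power_increasing) auto
    then have "R / 2 ^ j \<le> R / 2 ^ Suc i" using R by (intro divide_left_mono) auto
    then show False
      using pieceD(1)[OF dyadic(1,2)[OF R] i] pieceD(2)[OF dyadic(1,2)[OF R] j] by simp
  qed
  show ?thesis using *[of i j] *[of j i] assms by (meson linorder_neqE_nat)
qed

text \<open>
  The pieces are disjoint and on each of them the integrand is at most a multiple of \<open>1 / (R / 2 ^ i)\<close>,
  while the piece has length at most \<open>C * (R / 2 ^ i)\<close>; so every piece contributes the same bound.
\<close>
lemma modular_step_le:
  assumes R: "0 < R" "R < d" and I: "finite I" and \<kappa>: "W \<le> \<kappa>"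
    and e: "\<And>i. i \<in> I \<Longrightarrow> cmod (e i) \<le> 1 / \<psi> (R / 2 ^ i)"
  shows "modular g p w (\<lambda>\<tau>. \<Sum>i\<in>I. e i * indicator (piece (R / 2 ^ i)) \<tau>) \<kappa>
      \<le> ennreal (real (card I) * (C * exp A * (W / \<kappa>) powr q))"
proof -
  define c where "c = exp A * (W / \<kappa>) powr q"
  let ?R = "\<lambda>i. R / 2 ^ i"
  have \<kappa>0: "0 < \<kappa>" "0 < W" using \<kappa> constants by auto
  have c0: "0 \<le> c" by (simp add: c_def)
  have "modular g p w (\<lambda>\<tau>. \<Sum>i\<in>I. e i * indicator (piece (?R i)) \<tau>) \<kappa>
      \<le> (\<integral>\<^sup>+\<tau>. (\<Sum>i\<in>I. ennreal (c / ?R i) * indicator (piece (?R i)) \<tau>) \<partial>\<mu>)"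
    unfolding modular_def
  proof (rule nn_integral_mono)
    fix \<tau>
    show "ennreal ((cmod (\<Sum>i\<in>I. e i * indicator (piece (?R i)) \<tau>) * enn2real (w \<tau>) / \<kappa>) powr p \<tau>)
        \<le> (\<Sum>i\<in>I. ennreal (c / ?R i) * indicator (piece (?R i)) \<tau>)"
    proof (cases "\<exists>i\<in>I. \<tau> \<in> piece (?R i)")
      case True
      then obtain i where i: "i \<in> I" "\<tau> \<in> piece (?R i)" by blast
      have Ri: "0 < ?R i" "?R i < d" using dyadic[OF R] by auto
      have ind: "indicator (piece (?R j)) \<tau> = (if j = i then 1 else 0 :: complex)" for j
      proof (cases "j = i")
        case False
        then have "\<tau> \<notin> piece (?R j)" using pieces_disjoint[OF R i(2), of j] by blast
        then show ?thesis using False by simp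
      qed (use i(2) in simp)
      have sum_e: "(\<Sum>i\<in>I. e i * indicator (piece (?R i)) \<tau>) = e i"
        unfolding ind using i I by (simp add: if_distrib cong: if_cong)
      have "cmod (e i) * enn2real (w \<tau>) / \<kappa> \<le> (1 / \<psi> (?R i)) * (W * r (?R i)) / \<kappa>"
        using e[OF i(1)] pieceD(5)[OF Ri i(2)] \<kappa>0 \<psi>_pos[OF Ri]
        by (intro divide_right_mono mult_mono) auto
      also have "\<dots> = W / \<kappa> * ?R i powr (- (1 / p0))"
      proof -
        have "?R i powr (- (1 / p0)) = 1 / ?R i powr (1 / p0)"
          by (simp only: powr_minus divide_inverse mult_1)
        moreover have "0 < r (?R i)" by (rule r_pos[OF Ri])
        moreover have "1 / (x * y) * (W * x) / \<kappa> = W / \<kappa> * (1 / y)" if "0 < x" for x y :: real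
          using that by simp
        ultimately show ?thesis unfolding \<psi>_def by metis
      qed
      finally have "(cmod (e i) * enn2real (w \<tau>) / \<kappa>) powr p \<tau> \<le> (W / \<kappa> * ?R i powr (- (1 / p0))) powr p \<tau>"
        using pieceD(9)[OF Ri i(2)] \<kappa>0 by (intro powr_mono2) auto
      also have "\<dots> = (W / \<kappa>) powr p \<tau> * (?R i powr (- (1 / p0))) powr p \<tau>"
        by (rule powr_mult)
      also have "\<dots> \<le> (W / \<kappa>) powr q * (exp A / ?R i)"
        using powr_exponent_bounds(1)[OF Ri i(2)] \<kappa>0 \<kappa> pieceD(7)[OF Ri i(2)]
        by (intro mult_mono powr_mono') auto
      also have "\<dots> = c / ?R i" by (simp add: c_def)
      finally have "ennreal ((cmod (e i) * enn2real (w \<tau>) / \<kappa>) powr p \<tau>)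
          \<le> ennreal (c / ?R i) * indicator (piece (?R i)) \<tau>"
        using i by (simp add: ennreal_leI)
      also have "\<dots> \<le> (\<Sum>i\<in>I. ennreal (c / ?R i) * indicator (piece (?R i)) \<tau>)"
        using I i by (intro member_le_sum) auto
      finally show ?thesis unfolding sum_e .
    next
      case False
      then have "(\<Sum>i\<in>I. e i * indicator (piece (?R i)) \<tau>) = 0" by (intro sum.neutral) auto
      then show ?thesis by simp
    qed
  qed
  also have "\<dots> = (\<Sum>i\<in>I. ennreal (c / ?R i) * emeasure \<mu> (piece (?R i)))"
    using piece(3)[OF dyadic(1,2)[OF R]] by (subst nn_integral_sum) (auto simp: nn_integral_cmult_indicator)
  also have "\<dots> \<le> (\<Sum>i\<in>I. ennreal (c * C))"
  proof (rule sum_mono)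
    fix i
    have Ri: "0 < ?R i" "?R i < d" using dyadic[OF R] by auto
    have q0: "0 \<le> c / ?R i" using c0 less_imp_le[OF Ri(1)] by (rule divide_nonneg_nonneg)
    have "c / ?R i * (b (?R i) - a (?R i)) \<le> c / ?R i * (C * ?R i)"
      by (rule mult_left_mono[OF arc_length[OF Ri] q0])
    also have "\<dots> = c * C" using R by simp
    finally have le: "c / ?R i * (b (?R i) - a (?R i)) \<le> c * C" .
    show "ennreal (c / ?R i) * emeasure \<mu> (piece (?R i)) \<le> ennreal (c * C)"
      unfolding piece(4)[OF Ri] ennreal_mult'[OF q0, symmetric] using le by (rule ennreal_leI)
  qed
  also have "\<dots> = ennreal (real (card I) * (C * exp A * (W / \<kappa>) powr q))"
    using c0 constants by (subst sum_ennreal) (auto simp: c_def mult_ac)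
  finally show ?thesis .
qed

lemma min_powr_le:
  assumes X: "0 < X" and e: "1 \<le> e" "e \<le> P"
  shows "min (X powr P) X \<le> X powr e"
proof (cases "X \<le> 1")
  case True
  then have "X powr P \<le> X powr e" using X e by (intro powr_mono') auto
  then show ?thesis by (simp add: min_le_iff_disj)
next
  case False
  then have "X powr 1 \<le> X powr e" using e by (intro powr_mono) auto
  then show ?thesis using X by (simp add: min_le_iff_disj)
qed

text \<open>
  Here the norm of the indicator of the ball is bounded from below by the contributions of finitely many disjoint pieces,
  each of length at least half of its radius.
\<close>
lemma modular_constant_ge:
  assumes R: "0 < R" "R < d" and J: "finite J" and X: "0 < X" and \<nu>: "0 < \<nu>"
    and H: "\<And>j. j \<in> J \<Longrightarrow> X * (R / 2 ^ j) powr (- (1 / p0)) \<le> cmod H * r (R / 2 ^ j) / (W * \<nu>)"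
  shows "ennreal (real (card J) * (exp (- A) / 2 * min (X powr P) X))
      \<le> modular g p w (\<lambda>\<tau>. indicator (ball t0 R) \<tau> * H) \<nu>"
proof -
  define c where "c = exp (- A) * min (X powr P) X"
  let ?R = "\<lambda>i. R / 2 ^ i"
  have c0: "0 \<le> c" using X by (simp add: c_def)
  have "ennreal (real (card J) * (exp (- A) / 2 * min (X powr P) X)) = (\<Sum>j\<in>J. ennreal (c / 2))"
    using c0 by (subst sum_ennreal) (auto simp: c_def)
  also have "\<dots> \<le> (\<Sum>j\<in>J. ennreal (c / ?R j) * emeasure \<mu> (piece (?R j)))"
  proof (rule sum_mono)
    fix j
    have Rj: "0 < ?R j" "?R j < d" using dyadic[OF R] by auto
    have q0: "0 \<le> c / ?R j" using c0 less_imp_le[OF Rj(1)] by (rule divide_nonneg_nonneg)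
    have "c / ?R j * (?R j / 2) \<le> c / ?R j * (b (?R j) - a (?R j))"
      by (rule mult_left_mono[OF piece(5)[OF Rj] q0])
    also have "c / ?R j * (?R j / 2) = c / 2" using R by simp
    finally have le: "c / 2 \<le> c / ?R j * (b (?R j) - a (?R j))" .
    show "ennreal (c / 2) \<le> ennreal (c / ?R j) * emeasure \<mu> (piece (?R j))"
      unfolding piece(4)[OF Rj] ennreal_mult'[OF q0, symmetric] using le by (rule ennreal_leI)
  qed
  also have "\<dots> = (\<integral>\<^sup>+\<tau>. (\<Sum>j\<in>J. ennreal (c / ?R j) * indicator (piece (?R j)) \<tau>) \<partial>\<mu>)"
    using piece(3)[OF dyadic(1,2)[OF R]] by (subst nn_integral_sum) (auto simp: nn_integral_cmult_indicator)
  also have "\<dots> \<le> modular g p w (\<lambda>\<tau>. indicator (ball t0 R) \<tau> * H) \<nu>"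
    unfolding modular_def
  proof (rule nn_integral_mono)
    fix \<tau>
    show "(\<Sum>j\<in>J. ennreal (c / ?R j) * indicator (piece (?R j)) \<tau>)
        \<le> ennreal ((cmod (indicator (ball t0 R) \<tau> * H) * enn2real (w \<tau>) / \<nu>) powr p \<tau>)"
    proof (cases "\<exists>j\<in>J. \<tau> \<in> piece (?R j)")
      case True
      then obtain j where j: "j \<in> J" "\<tau> \<in> piece (?R j)" by blast
      have Rj: "0 < ?R j" "?R j < d" using dyadic[OF R] by auto
      have ind: "indicator (piece (?R i)) \<tau> = (if i = j then 1 else 0 :: ennreal)" for i
      proof (cases "i = j")
        case False
        then have "\<tau> \<notin> piece (?R i)" using pieces_disjoint[OF R j(2), of i] by blast
        then show ?thesis using False by simp
      qed (use j(2) in simp)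
      have "(\<Sum>j\<in>J. ennreal (c / ?R j) * indicator (piece (?R j)) \<tau>) = ennreal (c / ?R j)"
        unfolding ind using j J by (simp add: if_distrib cong: if_cong)
      also have "\<dots> \<le> ennreal ((cmod (indicator (ball t0 R) \<tau> * H) * enn2real (w \<tau>) / \<nu>) powr p \<tau>)"
      proof (rule ennreal_leI)
        have in_ball: "\<tau> \<in> ball t0 R"
          using pieceD(2)[OF Rj j(2)] dyadic(3)[OF R, of j] by (simp add: dist_norm norm_minus_commute)
        have "c / ?R j = min (X powr P) X * (exp (- A) / ?R j)" by (simp add: c_def)
        also have "\<dots> \<le> X powr p \<tau> * (?R j powr (- (1 / p0))) powr p \<tau>"
          using min_powr_le[OF X pieceD(9,8)[OF Rj j(2)]] powr_exponent_bounds(2)[OF Rj j(2)] R(1)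
          by (intro mult_mono divide_nonneg_nonneg) simp_all
        also have "\<dots> = (X * ?R j powr (- (1 / p0))) powr p \<tau>"
          by (rule powr_mult[symmetric])
        also have "\<dots> \<le> (cmod H * enn2real (w \<tau>) / \<nu>) powr p \<tau>"
        proof (rule powr_mono2)
          have "X * ?R j powr (- (1 / p0)) \<le> cmod H * r (?R j) / (W * \<nu>)" by (rule H[OF j(1)])
          also have "\<dots> = cmod H * (r (?R j) / W) / \<nu>" by simp
          also have "\<dots> \<le> cmod H * enn2real (w \<tau>) / \<nu>"
            using pieceD(4)[OF Rj j(2)] \<nu> by (intro divide_right_mono mult_left_mono) auto
          finally show "X * ?R j powr (- (1 / p0)) \<le> cmod H * enn2real (w \<tau>) / \<nu>" .
        qed (use X pieceD(9)[OF Rj j(2)] in auto)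
        finally show "c / ?R j \<le> (cmod (indicator (ball t0 R) \<tau> * H) * enn2real (w \<tau>) / \<nu>) powr p \<tau>"
          using in_ball by simp
      qed
      finally show ?thesis .
    next
      case False
      then have "(\<Sum>j\<in>J. ennreal (c / ?R j) * indicator (piece (?R j)) \<tau>) = 0" by (intro sum.neutral) auto
      then show ?thesis by simp
    qed
  qed
  finally show ?thesis .
qed

text \<open>
  The test function is a step function on the pieces indexed by \<open>I\<close>, with coefficients of modulus
  at most \<open>1 / \<psi>\<close> whose phases turn the integrals of \<open>d\<tau>\<close> over the pieces into positive
  numbers, so that they add up. The pieces indexed by \<open>J\<close> measure the norm of the indicator of the
  ball.
\<close>
lemma dyadic_muckenhoupt:
  assumes bounded: "cauchy_singular_operator_bounded g p w"
  obtains M where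
    "\<And>R I J X. 0 < R \<Longrightarrow> R < d \<Longrightarrow> finite I \<Longrightarrow> I \<noteq> {} \<Longrightarrow> finite J \<Longrightarrow> 0 < X \<Longrightarrow>
      (\<And>j. j \<in> J \<Longrightarrow> X * real (card I) powr (1 / q) * R \<le> (\<Sum>i\<in>I. (R / 2 ^ i) / \<psi> (R / 2 ^ i)) * \<psi> (R / 2 ^ j)) \<Longrightarrow>
      real (card J) * min (X powr P) X \<le> M"
proof -
  obtain C1 where C1: "1 \<le> C1"
    "\<And>f B \<kappa> R c. f \<in> borel_measurable borel \<Longrightarrow> (\<And>\<tau>. cmod (f \<tau>) \<le> B) \<Longrightarrow> 0 < \<kappa> \<Longrightarrow> 0 < R \<Longrightarrow>
      (\<And>\<tau>. f \<tau> \<noteq> 0 \<Longrightarrow> cmod (\<tau> - c) \<le> R) \<Longrightarrow> modular g p w f \<kappa> \<le> 1 \<Longrightarrow>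
      modular g p w (\<lambda>\<tau>. indicator (ball c R) \<tau> * (LINT s:{0..L}|lebesgue. f (G s) * arc.D s)) (C1 * \<kappa> * R) \<le> 2"
    using bounded_operator_localized[OF bounded] by blast
  define E where "E = C * exp A"
  have E: "1 \<le> E"
  proof -
    have "1 * 1 \<le> C * exp A" using constants by (intro mult_mono) auto
    then show ?thesis by (simp add: E_def)
  qed
  define M0 where "M0 = 2 * W * W * C1 * E powr (1 / q)"
  have M0: "1 \<le> M0"
  proof -
    have "1 \<le> E powr (1 / q)" using E constants by (intro ge_one_powr_ge_zero) auto
    then have "1 * 1 * 1 * 1 * 1 \<le> M0"
      unfolding M0_def using constants C1 by (intro mult_mono) auto
    then show ?thesis by simp
  qed
  define M where "M = 4 * exp A * max 1 (M0 powr P) * M0"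
  show thesis
  proof (rule that[of M])
    fix R X :: real and I J :: "nat set"
    assume R: "0 < R" "R < d" and I: "finite I" "I \<noteq> {}" and J: "finite J" and X: "0 < X"
      and hyp: "\<And>j. j \<in> J \<Longrightarrow> X * real (card I) powr (1 / q) * R
          \<le> (\<Sum>i\<in>I. (R / 2 ^ i) / \<psi> (R / 2 ^ i)) * \<psi> (R / 2 ^ j)"
    let ?R = "\<lambda>i. R / 2 ^ i"
    note dy = dyadic[OF R]
    define n where "n = real (card I)"
    have n: "1 \<le> n" using I by (simp add: n_def Suc_le_eq card_gt_0_iff)
    define z where "z i = G (b (?R i)) - G (a (?R i))" for i
    define e where "e i = cnj (sgn (z i)) / complex_of_real (\<psi> (?R i))" for i
    define f where "f = (\<lambda>\<tau>. \<Sum>i\<in>I. e i * indicator (piece (?R i)) \<tau>)"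
    define H where "H = (LINT s:{0..L}|lebesgue. f (G s) * arc.D s)"
    \<comment> \<open>Chosen so that the bound of \<open>modular_step_le\<close> equals \<open>1\<close>.\<close>
    define \<kappa> where "\<kappa> = W * (E * n) powr (1 / q)"
    have En: "1 \<le> E * n" using mult_mono[OF E n] E by simp
    have "1 \<le> (E * n) powr (1 / q)" using En constants by (intro ge_one_powr_ge_zero) auto
    then have "W * 1 \<le> \<kappa>" unfolding \<kappa>_def using constants by (intro mult_left_mono) auto
    then have \<kappa>: "W \<le> \<kappa>" "0 < \<kappa>" using constants by auto
    have e_le: "cmod (e i) \<le> 1 / \<psi> (?R i)" for i
    proof -
      have "cmod (sgn (z i)) \<le> 1" by (simp add: norm_sgn)
      then show ?thesis
        using \<psi>_pos[OF dy(1,2), of i] by (simp add: e_def norm_divide divide_right_mono)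
    qed
    have f_borel: "f \<in> borel_measurable borel"
      unfolding f_def using piece(1)[OF dy(1,2)] by (intro borel_measurable_sum borel_measurable_times) auto
    have f_bound: "cmod (f \<tau>) \<le> (\<Sum>i\<in>I. cmod (e i))" for \<tau>
      unfolding f_def by (rule sum_norm_le) (auto simp: indicator_def norm_mult)
    have f_supp: "cmod (\<tau> - t0) \<le> R" if nz: "f \<tau> \<noteq> 0" for \<tau>
    proof -
      obtain i where "i \<in> I" "e i * indicator (piece (?R i)) \<tau> \<noteq> 0"
        using nz unfolding f_def by (meson sum.not_neutral_contains_not_neutral)
      then have "\<tau> \<in> piece (?R i)" by (auto simp: indicator_def split: if_splits)
      then show ?thesis using pieceD(2)[OF dy(1,2)] dy(3)[of i] by fastforce
    qed
    have "modular g p w f \<kappa> \<le> ennreal (n * (C * exp A * (W / \<kappa>) powr q))"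
      unfolding f_def n_def using R I(1) \<kappa>(1) e_le by (rule modular_step_le)
    also have "n * (C * exp A * (W / \<kappa>) powr q) = 1"
    proof -
      have "W / \<kappa> = (E * n) powr (- (1 / q))"
        using constants En by (simp add: \<kappa>_def powr_minus divide_inverse)
      then have "(W / \<kappa>) powr q = (E * n) powr (- 1)"
        using constants by (simp add: powr_powr)
      also have "\<dots> = 1 / (E * n)" using En by (simp add: powr_minus divide_inverse)
      finally show ?thesis using n E by (simp add: E_def[symmetric])
    qed
    finally have f1: "modular g p w f \<kappa> \<le> 1" by simp
    have H_eq: "H = of_real (\<Sum>i\<in>I. cmod (z i) / \<psi> (?R i))"
    proof -
      have ez: "e i * z i = of_real (cmod (z i) / \<psi> (?R i))" for i
      proof -
        have "cnj (sgn (z i)) * z i = of_real (cmod (z i))"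
        proof (cases "z i = 0")
          case False
          have "cnj (sgn (z i)) * z i = z i * cnj (z i) / of_real (cmod (z i))"
            by (simp add: sgn_eq)
          also have "\<dots> = of_real ((cmod (z i))\<^sup>2) / of_real (cmod (z i))"
            by (simp only: complex_norm_square)
          finally show ?thesis using False by (simp add: power2_eq_square)
        qed simp
        then show ?thesis by (simp add: e_def)
      qed
      have "H = (\<Sum>i\<in>I. e i * z i)"
        unfolding H_def f_def z_def using arcs[OF dy(1,2)] I
        by (intro integral_step_function) (auto intro: less_imp_le)
      also have "\<dots> = of_real (\<Sum>i\<in>I. cmod (z i) / \<psi> (?R i))"
        by (simp only: ez of_real_sum)
      finally show ?thesis .
    qed
    define S where "S = (\<Sum>i\<in>I. ?R i / \<psi> (?R i))"
    have H_ge: "S / 2 \<le> cmod H"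
    proof -
      have "S / 2 = (\<Sum>i\<in>I. (?R i / 2) / \<psi> (?R i))" by (simp add: S_def sum_divide_distrib mult_ac)
      also have "\<dots> \<le> (\<Sum>i\<in>I. cmod (z i) / \<psi> (?R i))"
      proof (intro sum_mono divide_right_mono)
        fix i
        show "?R i / 2 \<le> cmod (z i)"
          using norm_triangle_ineq2[of "G (b (?R i)) - t0" "G (a (?R i)) - t0"] arcs[OF dy(1,2), of i]
          by (simp add: z_def)
        show "0 \<le> \<psi> (?R i)" using \<psi>_pos[OF dy(1,2), of i] by simp
      qed
      also have "\<dots> \<le> cmod H" unfolding H_eq norm_of_real by (rule abs_ge_self)
      finally show ?thesis .
    qed
    define \<nu> where "\<nu> = C1 * \<kappa> * R"
    have \<nu>: "0 < \<nu>" using C1 \<kappa> R by (simp add: \<nu>_def)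
    have "ennreal (real (card J) * (exp (- A) / 2 * min ((X / M0) powr P) (X / M0)))
        \<le> modular g p w (\<lambda>\<tau>. indicator (ball t0 R) \<tau> * H) \<nu>"
    proof (rule modular_constant_ge[OF R J _ \<nu>])
      show "0 < X / M0" using X M0 by simp
      fix j assume j: "j \<in> J"
      have Rj: "0 < ?R j" "?R j < d" using dy by auto
      have "X / M0 * (W * \<nu>) = X * n powr (1 / q) * R / 2"
        using C1 constants En n E by (simp add: M0_def \<nu>_def \<kappa>_def powr_mult field_simps)
      also have "\<dots> \<le> S * \<psi> (?R j) / 2"
        using hyp[OF j] by (simp add: S_def n_def)
      also have "\<dots> \<le> cmod H * \<psi> (?R j)"
        using mult_right_mono[OF H_ge, of "\<psi> (?R j)"] \<psi>_pos[OF Rj] by simp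
      finally have "X / M0 * (W * \<nu>) * ?R j powr (- (1 / p0)) \<le> cmod H * \<psi> (?R j) * ?R j powr (- (1 / p0))"
        by (intro mult_right_mono) auto
      also have "\<dots> = cmod H * r (?R j)"
      proof -
        have cancel: "?R j powr (1 / p0) * ?R j powr (- (1 / p0)) = 1"
          using R(1) by (simp flip: powr_add)
        show ?thesis by (simp only: \<psi>_def mult.assoc cancel mult_1_right)
      qed
      finally show "X / M0 * ?R j powr (- (1 / p0)) \<le> cmod H * r (?R j) / (W * \<nu>)"
        using \<nu> constants by (simp add: pos_le_divide_eq mult_ac)
    qed
    also have "\<dots> \<le> ennreal 2"
      using C1(2)[OF f_borel f_bound \<kappa>(2) R(1) f_supp f1] by (simp add: H_def \<nu>_def)
    finally have le: "real (card J) * (exp (- A) / 2 * min ((X / M0) powr P) (X / M0)) \<le> 2"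
      by (subst (asm) ennreal_le_iff) auto
    have "min (X powr P) X \<le> max 1 (M0 powr P) * M0 * min ((X / M0) powr P) (X / M0)"
    proof -
      have XP: "(X / M0) powr P * M0 powr P = X powr P"
        using X M0 by (simp add: powr_mult[symmetric])
      have "X powr P \<le> max 1 (M0 powr P) * M0 * (X / M0) powr P"
      proof -
        have "X powr P = 1 * (M0 powr P * (X / M0) powr P)" using XP by (simp add: mult.commute)
        also have "\<dots> \<le> M0 * (max 1 (M0 powr P) * (X / M0) powr P)"
          using M0 by (intro mult_mono) auto
        finally show ?thesis by (simp add: mult_ac)
      qed
      moreover have "X \<le> max 1 (M0 powr P) * M0 * (X / M0)"
      proof -
        have "1 * X \<le> max 1 (M0 powr P) * X" using X by (intro mult_right_mono) auto
        then show ?thesis using M0 by simp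
      qed
      ultimately show ?thesis
        by (auto simp: min_def)
    qed
    then have "real (card J) * min (X powr P) X
        \<le> real (card J) * (max 1 (M0 powr P) * M0 * min ((X / M0) powr P) (X / M0))"
      by (intro mult_left_mono) auto
    also have "\<dots> = 2 * exp A * max 1 (M0 powr P) * M0 * (real (card J) * (exp (- A) / 2 * min ((X / M0) powr P) (X / M0)))"
      by (simp add: exp_minus field_simps)
    also have "\<dots> \<le> 2 * exp A * max 1 (M0 powr P) * M0 * 2"
      using le M0 by (intro mult_left_mono) auto
    finally show "real (card J) * min (X powr P) X \<le> M" by (simp add: M_def)
  qed
qed

end

section \<open>Products of radial weights\<close>

lemma power_comparable_bounded_away:
  assumes comp: "power_comparable L a K r" and \<delta>: "0 < \<delta>"
  obtains B where "1 \<le> B" "\<And>x. \<delta> \<le> x \<Longrightarrow> x \<le> L \<Longrightarrow> 1 / B \<le> r x \<and> r x \<le> B"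
proof -
  have pos: "0 < r x" if "0 < x" "x \<le> L" for x
    using comp that unfolding power_comparable_def by blast
  have Kr: "r x \<le> K * (L / x) powr a * r L" "r L \<le> K * (L / x) powr a * r x" if "0 < x" "x \<le> L" for x
    using comp that unfolding power_comparable_def by auto
  have L: "0 < L" "0 \<le> a" "1 \<le> K" using comp by (auto simp: power_comparable_def)
  define c where "c = K * (L / \<delta>) powr a"
  have c: "0 < c" using L \<delta> by (simp add: c_def)
  define B where "B = max 1 (max (c * r L) (c / r L))"
  have "1 / B \<le> r x \<and> r x \<le> B" if x: "\<delta> \<le> x" "x \<le> L" for x
  proof -
    have x0: "0 < x" using x \<delta> by simp
    have "K * (L / x) powr a \<le> c"
      unfolding c_def using x x0 \<delta> L by (intro mult_left_mono powr_mono2 divide_left_mono) auto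
    then have "r x \<le> c * r L" "r L \<le> c * r x"
      using Kr[OF x0 x(2)] pos[OF x0 x(2)] pos[of L] L
      by (meson order_trans mult_right_mono less_imp_le order_refl)+
    then have "r x \<le> B" "1 / (c / r L) \<le> r x"
      using pos[OF x0 x(2)] pos[of L] L c by (auto simp: B_def field_simps)
    moreover have "1 / B \<le> 1 / (c / r L)"
      using c pos[of L] L by (intro divide_left_mono) (auto simp: B_def)
    ultimately show ?thesis by linarith
  qed
  then show thesis using that[of B] by (simp add: B_def)
qed

context jordan_arclength
begin

lemma carleson_bound:
  assumes "carleson_curve g"
  obtains C where "1 \<le> C" "\<And>t R. t \<in> \<Gamma> \<Longrightarrow> 0 < R \<Longrightarrow> emeasure \<mu> (portion g t R) \<le> ennreal (C * R)"
proof -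
  obtain C where C: "\<And>t R. t \<in> \<Gamma> \<Longrightarrow> 0 < R \<Longrightarrow> measure \<mu> (portion g t R) / R \<le> C"
    using assms unfolding carleson_curve_def bdd_above_def by blast
  have "emeasure \<mu> (portion g t R) \<le> ennreal (max 1 C * R)" if t: "t \<in> \<Gamma>" "0 < R" for t R
  proof -
    have "portion g t R = \<Gamma> \<inter> ball t R"
      by (auto simp: portion_def dist_norm norm_minus_commute)
    moreover have "closed \<Gamma>" using rect cont_g by (simp add: closed_path_image path_def)
    ultimately have B: "portion g t R \<in> sets borel" "portion g t R \<subseteq> \<Gamma>" by auto
    have "emeasure \<mu> (portion g t R) \<le> emeasure lborel {0..L}"
      unfolding emeasure_length_measure(1)[OF B] by (intro emeasure_mono) auto
    also have "\<dots> < \<infinity>" using L_pos by simp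
    finally have "emeasure \<mu> (portion g t R) = ennreal (measure \<mu> (portion g t R))"
      by (intro emeasure_eq_ennreal_measure) auto
    also have "measure \<mu> (portion g t R) \<le> C * R"
      using C[OF t] t by (simp add: divide_le_eq)
    also have "C * R \<le> max 1 C * R" using t by (intro mult_right_mono) auto
    finally show ?thesis by (simp add: ennreal_leI)
  qed
  then show thesis using that[of "max 1 C"] by simp
qed

context
  fixes n :: nat and ts :: "nat \<Rightarrow> complex" and ws :: "nat \<Rightarrow> real \<Rightarrow> ennreal" and w :: "complex \<Rightarrow> ennreal"
    and r :: "nat \<Rightarrow> real \<Rightarrow> real" and a K :: "nat \<Rightarrow> real"
  assumes ts: "\<And>k. k \<in> {1..n} \<Longrightarrow> ts k \<in> path_image g"
    and comp: "\<And>k. k \<in> {1..n} \<Longrightarrow> power_comparable L (a k) (K k) (r k)"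
    and ws: "\<And>k x. k \<in> {1..n} \<Longrightarrow> 0 < x \<Longrightarrow> x \<le> L \<Longrightarrow> ws k x = ennreal (r k x)"
    and r_cont: "\<And>k. k \<in> {1..n} \<Longrightarrow> continuous_on {0<..L} (r k)"
    and w: "\<And>t. t \<in> path_image g \<Longrightarrow> w t = (\<Prod>k\<in>{1..n}. ws k (cmod (t - ts k)))"
begin

lemma r_positive: "k \<in> {1..n} \<Longrightarrow> 0 < x \<Longrightarrow> x \<le> L \<Longrightarrow> 0 < r k x"
  using comp[of k] by (simp add: power_comparable_def)

lemma dist_node:
  assumes "k \<in> {1..n}" "\<tau> \<in> \<Gamma>" "\<tau> \<noteq> ts k"
  shows "0 < cmod (\<tau> - ts k)" "cmod (\<tau> - ts k) \<le> L"
  using assms G_dist_le_L[of \<tau> "ts k"] ts[of k] by auto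

lemma product_weight_real:
  assumes \<tau>: "\<tau> \<in> \<Gamma>" "\<tau> \<notin> ts ` {1..n}"
  shows "enn2real (w \<tau>) = (\<Prod>k\<in>{1..n}. r k (cmod (\<tau> - ts k)))"
proof -
  have ne: "\<tau> \<noteq> ts k" if "k \<in> {1..n}" for k using \<tau> that by auto
  have "w \<tau> = (\<Prod>k\<in>{1..n}. ennreal (r k (cmod (\<tau> - ts k))))"
    unfolding w[OF \<tau>(1)] using ws dist_node[OF _ \<tau>(1) ne] by (intro prod.cong) auto
  also have "\<dots> = ennreal (\<Prod>k\<in>{1..n}. r k (cmod (\<tau> - ts k)))"
    using r_positive dist_node[OF _ \<tau>(1) ne] by (intro prod_ennreal) (auto intro: less_imp_le)
  moreover have "0 \<le> (\<Prod>k\<in>{1..n}. r k (cmod (\<tau> - ts k)))"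
  proof (rule prod_nonneg)
    fix k assume k: "k \<in> {1..n}"
    show "0 \<le> r k (cmod (\<tau> - ts k))"
      using r_positive[OF k dist_node[OF k \<tau>(1) ne[OF k]]] by (rule less_imp_le)
  qed
  ultimately show ?thesis by (simp only: enn2real_ennreal)
qed

lemma product_weight_measurable:
  "(\<lambda>\<tau>. enn2real (w \<tau>)) \<in> borel_measurable (restrict_space borel \<Gamma>)"
proof (rule measurable_discrete_difference)
  let ?T = "ts ` {1..n}"
  let ?h = "\<lambda>\<tau>. indicator (\<Gamma> - ?T) \<tau> *\<^sub>R (\<Prod>k\<in>{1..n}. r k (cmod (\<tau> - ts k)))"
  have "closed \<Gamma>" using cont_g by (simp add: closed_path_image path_def)
  moreover have "finite ?T" by simp
  ultimately have "\<Gamma> - ?T \<in> sets borel" by (intro sets.Diff borel_closed) (auto intro: finite_imp_closed)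
  moreover have "continuous_on (\<Gamma> - ?T) (\<lambda>\<tau>. \<Prod>k\<in>{1..n}. r k (cmod (\<tau> - ts k)))"
  proof (rule continuous_on_prod)
    fix k assume k: "k \<in> {1..n}"
    show "continuous_on (\<Gamma> - ?T) (\<lambda>\<tau>. r k (cmod (\<tau> - ts k)))"
    proof (intro continuous_on_compose2[OF r_cont[OF k]] continuous_intros)
      have "cmod (\<tau> - ts k) \<in> {0<..L}" if "\<tau> \<in> \<Gamma> - ?T" for \<tau>
      proof -
        have "\<tau> \<in> \<Gamma>" "\<tau> \<noteq> ts k" using that k by blast+
        then show ?thesis using dist_node[OF k] by simp
      qed
      then show "(\<lambda>\<tau>. cmod (\<tau> - ts k)) ` (\<Gamma> - ?T) \<subseteq> {0<..L}" by blast
    qed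
  qed
  ultimately show "?h \<in> borel_measurable (restrict_space borel \<Gamma>)"
    by (intro measurable_restrict_space1 borel_measurable_continuous_on_indicator)
  show "countable ?T" by simp
  show "\<And>\<tau>. \<tau> \<in> space (restrict_space borel \<Gamma>) \<Longrightarrow> \<tau> \<notin> ?T \<Longrightarrow> ?h \<tau> = enn2real (w \<tau>)"
    by (simp add: space_restrict_space product_weight_real)
  show "\<And>\<tau>. \<tau> \<in> ?T \<Longrightarrow> {\<tau>} \<in> sets (restrict_space borel \<Gamma>)"
    using ts by (auto simp: sets_restrict_space image_iff intro!: bexI[of _ "{_}"])
qed auto

text \<open>
  The nodes are distinct, so near \<open>ts k\<close> the distances to the other nodes stay away from \<open>0\<close> and the
  corresponding factors lie between positive constants.
\<close>
lemma product_weight_near_node: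
  assumes k: "k \<in> {1..n}" and inj: "inj_on ts {1..n}"
  obtains \<delta> W where "0 < \<delta>" "1 \<le> W"
    "\<And>\<tau>. \<tau> \<in> \<Gamma> \<Longrightarrow> \<tau> \<noteq> ts k \<Longrightarrow> cmod (\<tau> - ts k) < \<delta> \<Longrightarrow>
      r k (cmod (\<tau> - ts k)) / W \<le> enn2real (w \<tau>) \<and> enn2real (w \<tau>) \<le> W * r k (cmod (\<tau> - ts k))"
proof -
  let ?J = "{1..n} - {k}"
  have "\<exists>\<delta>>0. \<forall>z\<in>ts ` {1..n}. z \<noteq> ts k \<longrightarrow> \<delta> \<le> dist (ts k) z"
    by (rule finite_set_avoid) simp
  then obtain \<delta> where \<delta>: "0 < \<delta>" "\<And>j. j \<in> {1..n} \<Longrightarrow> ts j \<noteq> ts k \<Longrightarrow> \<delta> \<le> dist (ts k) (ts j)" by blast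
  have "\<forall>j\<in>?J. \<exists>B. 1 \<le> B \<and> (\<forall>x. \<delta> / 2 \<le> x \<longrightarrow> x \<le> L \<longrightarrow> 1 / B \<le> r j x \<and> r j x \<le> B)"
  proof
    fix j assume "j \<in> ?J"
    then obtain B where "1 \<le> B" "\<And>x. \<delta> / 2 \<le> x \<Longrightarrow> x \<le> L \<Longrightarrow> 1 / B \<le> r j x \<and> r j x \<le> B"
      using power_comparable_bounded_away[OF comp[of j], of "\<delta> / 2"] \<delta>(1) by auto
    then show "\<exists>B. 1 \<le> B \<and> (\<forall>x. \<delta> / 2 \<le> x \<longrightarrow> x \<le> L \<longrightarrow> 1 / B \<le> r j x \<and> r j x \<le> B)" by blast
  qed
  then obtain B where B: "\<And>j. j \<in> ?J \<Longrightarrow> 1 \<le> B j"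
    "\<And>j x. j \<in> ?J \<Longrightarrow> \<delta> / 2 \<le> x \<Longrightarrow> x \<le> L \<Longrightarrow> 1 / B j \<le> r j x \<and> r j x \<le> B j" by metis
  define W where "W = (\<Prod>j\<in>?J. B j)"
  have W1: "1 \<le> W" unfolding W_def using B(1) by (intro prod_ge_1) auto
  show thesis
  proof (rule that[of "\<delta> / 2" W])
    fix \<tau> assume \<tau>: "\<tau> \<in> \<Gamma>" "\<tau> \<noteq> ts k" "cmod (\<tau> - ts k) < \<delta> / 2"
    have away: "\<delta> / 2 \<le> cmod (\<tau> - ts j)" if j: "j \<in> ?J" for j
    proof -
      have "ts j \<noteq> ts k" using inj_onD[OF inj, of j k] j k by blast
      then have "\<delta> \<le> dist (ts k) (ts j)" using \<delta>(2)[of j] j by auto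
      also have "\<dots> \<le> dist (ts k) \<tau> + dist \<tau> (ts j)" by (rule dist_triangle)
      finally show ?thesis using \<tau>(3) by (simp add: dist_norm norm_minus_commute)
    qed
    have notin: "\<tau> \<notin> ts ` {1..n}"
    proof
      assume "\<tau> \<in> ts ` {1..n}"
      then obtain j where j: "j \<in> {1..n}" "\<tau> = ts j" by auto
      then have "j \<in> ?J" using \<tau>(2) by auto
      then show False using away[of j] j \<delta>(1) by simp
    qed
    define Q where "Q = (\<Prod>j\<in>?J. r j (cmod (\<tau> - ts j)))"
    have bounds: "1 / B j \<le> r j (cmod (\<tau> - ts j)) \<and> r j (cmod (\<tau> - ts j)) \<le> B j" if j: "j \<in> ?J" for j
    proof (rule B(2)[OF j away[OF j]])
      show "cmod (\<tau> - ts j) \<le> L" using G_dist_le_L \<tau>(1) ts[of j] j by auto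
    qed
    have "enn2real (w \<tau>) = r k (cmod (\<tau> - ts k)) * Q"
      unfolding product_weight_real[OF \<tau>(1) notin] Q_def using k by (simp add: prod.remove)
    moreover have "Q \<le> W"
      unfolding Q_def W_def
    proof (intro prod_mono conjI)
      fix j assume j: "j \<in> ?J"
      have "0 \<le> 1 / B j" using B(1)[OF j] by simp
      then show "0 \<le> r j (cmod (\<tau> - ts j))" "r j (cmod (\<tau> - ts j)) \<le> B j" using bounds[OF j] by linarith+
    qed
    moreover have "1 / W \<le> Q"
    proof -
      have "1 / W = (\<Prod>j\<in>?J. 1 / B j)" by (simp add: W_def prod_dividef)
      also have "\<dots> \<le> Q" unfolding Q_def using bounds B(1) by (intro prod_mono) force
      finally show ?thesis .
    qed
    moreover have "0 < r k (cmod (\<tau> - ts k))" using r_positive[OF k] dist_node[OF k \<tau>(1,2)] by auto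
    ultimately show "r k (cmod (\<tau> - ts k)) / W \<le> enn2real (w \<tau>) \<and> enn2real (w \<tau>) \<le> W * r k (cmod (\<tau> - ts k))"
      using mult_left_mono[of "1 / W" Q "r k (cmod (\<tau> - ts k))"] mult_left_mono[of Q W "r k (cmod (\<tau> - ts k))"]
      by (simp add: mult.commute)
  qed (use \<delta> W1 in auto)
qed

text \<open>
  It remains to check the assumptions of \<open>weighted_arcs\<close> at the node, with the minimum and the maximum
  of the exponent as \<open>q\<close> and \<open>P\<close>.
\<close>
lemma node_index_bounds:
  fixes p :: "complex \<Rightarrow> real" and A :: real
  assumes carleson: "carleson_curve g"
    and p_cont: "continuous_on \<Gamma> p" and p_gt_1: "\<And>\<tau>. \<tau> \<in> \<Gamma> \<Longrightarrow> 1 < p \<tau>" and A: "0 < A"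
    and log_holder: "\<And>\<tau> t. \<tau> \<in> \<Gamma> \<Longrightarrow> t \<in> \<Gamma> \<Longrightarrow> cmod (\<tau> - t) \<le> 1 / 2 \<Longrightarrow> \<bar>p \<tau> - p t\<bar> \<le> - A / ln (cmod (\<tau> - t))"
    and inj: "inj_on ts {1..n}"
    and bounded: "cauchy_singular_operator_bounded g p w"
    and k: "k \<in> {1..n}"
  shows "0 < 1 / p (ts k) + lower_index (ws k)" "1 / p (ts k) + upper_index (ws k) < 1"
proof -
  define t0 where "t0 = ts k"
  define p0 where "p0 = p t0"
  have t0: "t0 \<in> \<Gamma>" using ts[OF k] by (simp add: t0_def)
  have compact: "compact \<Gamma>" using cont_g by (simp add: compact_path_image path_def)
  obtain \<tau>1 where \<tau>1: "\<tau>1 \<in> \<Gamma>" "\<And>\<tau>. \<tau> \<in> \<Gamma> \<Longrightarrow> p \<tau>1 \<le> p \<tau>"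
    using continuous_attains_inf[OF compact _ p_cont] t0 by blast
  obtain \<tau>2 where \<tau>2: "\<tau>2 \<in> \<Gamma>" "\<And>\<tau>. \<tau> \<in> \<Gamma> \<Longrightarrow> p \<tau> \<le> p \<tau>2"
    using continuous_attains_sup[OF compact _ p_cont] t0 by blast
  obtain d1 \<alpha> \<beta> where d1: "0 < d1"
    and arcs: "\<And>R. 0 < R \<Longrightarrow> R < d1 \<Longrightarrow> 0 \<le> \<alpha> R \<and> \<alpha> R < \<beta> R \<and> \<beta> R \<le> L \<and>
      cmod (G (\<alpha> R) - t0) = R / 2 \<and> cmod (G (\<beta> R) - t0) = R \<and>
      (\<forall>s\<in>{\<alpha> R<..<\<beta> R}. R / 2 < cmod (G s - t0) \<and> cmod (G s - t0) < R)"
    using crossing_arcs[OF t0] by blast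
  obtain C where C: "1 \<le> C" "\<And>t R. t \<in> \<Gamma> \<Longrightarrow> 0 < R \<Longrightarrow> emeasure \<mu> (portion g t R) \<le> ennreal (C * R)"
    using carleson_bound[OF carleson] by blast
  obtain \<delta> W0 where \<delta>: "0 < \<delta>" "1 \<le> W0"
    "\<And>\<tau>. \<tau> \<in> \<Gamma> \<Longrightarrow> \<tau> \<noteq> ts k \<Longrightarrow> cmod (\<tau> - ts k) < \<delta> \<Longrightarrow>
      r k (cmod (\<tau> - ts k)) / W0 \<le> enn2real (w \<tau>) \<and> enn2real (w \<tau>) \<le> W0 * r k (cmod (\<tau> - ts k))"
    using product_weight_near_node[OF k inj] by blast
  interpret rw: radial_weight L "a k" "K k" "r k" "ws k"
    using comp[OF k] ws[OF k] by unfold_locales auto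
  define d where "d = Min {d1, \<delta>, L, 1/2}"
  have d_le: "0 < d" "d \<le> d1" "d \<le> \<delta>" "d \<le> L" "d \<le> 1/2"
    using d1 \<delta>(1) L_pos by (auto simp: d_def)
  define W where "W = W0 * (K k * 2 powr a k)"
  have K2: "1 \<le> K k * 2 powr a k"
  proof -
    have "1 \<le> (2::real) powr a k" using rw.a_nonneg by (intro ge_one_powr_ge_zero) auto
    then have "1 * 1 \<le> K k * 2 powr a k" using rw.K_ge_1 by (intro mult_mono) auto
    then show ?thesis by simp
  qed
  have piece: "G s \<in> \<Gamma>" "R / 2 < cmod (G s - t0)" "cmod (G s - t0) < R"
    if "0 < R" "R < d" "s \<in> {\<alpha> R<..<\<beta> R}" for R s
  proof -
    have "s \<in> {0..L}" using arcs[of R] that d_le by auto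
    then show "G s \<in> \<Gamma>" using image_G by blast
    show "R / 2 < cmod (G s - t0)" "cmod (G s - t0) < R" using arcs[of R] that d_le by auto
  qed
  interpret weighted_arcs g p w t0 p0 "r k" \<alpha> \<beta> d C W A "p \<tau>1" "p \<tau>2"
  proof unfold_locales
    show "p \<in> borel_measurable (restrict_space borel \<Gamma>)"
      by (rule borel_measurable_continuous_on_restrict[OF p_cont])
    show "(\<lambda>\<tau>. enn2real (w \<tau>)) \<in> borel_measurable (restrict_space borel \<Gamma>)"
      by (rule product_weight_measurable)
    show "\<And>\<tau>. \<tau> \<in> \<Gamma> \<Longrightarrow> 1 \<le> p \<tau>" "1 \<le> p0" "1 \<le> p \<tau>1"
      using p_gt_1 t0 \<tau>1 by (auto simp: p0_def intro: less_imp_le)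
    show "0 < d" "d \<le> 1" "1 \<le> C" "0 \<le> A" using d_le C A by auto
    show "1 \<le> W" unfolding W_def using mult_mono[OF \<delta>(2) K2] \<delta>(2) by simp
    show "\<And>\<tau>. \<tau> \<in> \<Gamma> \<Longrightarrow> p \<tau>1 \<le> p \<tau> \<and> p \<tau> \<le> p \<tau>2" using \<tau>1 \<tau>2 by auto
    fix R assume R: "0 < R" "R < d"
    show arcR: "0 \<le> \<alpha> R \<and> \<alpha> R < \<beta> R \<and> \<beta> R \<le> L \<and>
      cmod (G (\<alpha> R) - t0) = R / 2 \<and> cmod (G (\<beta> R) - t0) = R \<and>
      (\<forall>s\<in>{\<alpha> R<..<\<beta> R}. R / 2 < cmod (G s - t0) \<and> cmod (G s - t0) < R)"
      using R d_le by (intro arcs) auto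
    show "0 < r k R" using R d_le by (intro rw.r_pos) auto
    show "\<beta> R - \<alpha> R \<le> C * R"
    proof -
      have sub: "G ` {\<alpha> R<..<\<beta> R} \<subseteq> portion g t0 R"
        using piece[OF R] by (auto simp: portion_def)
      have "closed \<Gamma>" using cont_g by (simp add: closed_path_image path_def)
      moreover have "portion g t0 R = \<Gamma> \<inter> ball t0 R"
        by (auto simp: portion_def dist_norm norm_minus_commute)
      ultimately have "portion g t0 R \<in> sets \<mu>"
        by (intro emeasure_length_measure(2)) auto
      then have "emeasure \<mu> (G ` {\<alpha> R<..<\<beta> R}) \<le> emeasure \<mu> (portion g t0 R)"
        using sub by (rule emeasure_mono[rotated])
      also have "\<dots> \<le> ennreal (C * R)" using C(2)[OF t0 R(1)] .
      finally have "ennreal (\<beta> R - \<alpha> R) \<le> ennreal (C * R)"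
        using open_arc(4)[of "\<alpha> R" "\<beta> R"] arcR by simp
      then show ?thesis using C(1) R by (subst (asm) ennreal_le_iff) auto
    qed
    fix s assume s: "s \<in> {\<alpha> R<..<\<beta> R}"
    define x where "x = cmod (G s - t0)"
    have x: "0 < x" "R / 2 < x" "x < R" using piece[OF R s] R by (auto simp: x_def)
    have ne: "G s \<noteq> t0" using x by (auto simp: x_def)
    have "r k x / W0 \<le> enn2real (w (G s)) \<and> enn2real (w (G s)) \<le> W0 * r k x"
      using \<delta>(3)[OF piece(1)[OF R s]] ne x R d_le by (auto simp: x_def t0_def)
    moreover have "r k x \<le> K k * 2 powr a k * r k R \<and> r k R \<le> K k * 2 powr a k * r k x"
    proof -
      have "R / x \<le> 2" using x by (simp add: divide_le_eq)
      then have "(R / x) powr a k \<le> 2 powr a k" using x R rw.a_nonneg by (intro powr_mono2) auto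
      then have "K k * (R / x) powr a k * y \<le> K k * 2 powr a k * y" if "0 < y" for y
        using that rw.K_ge_1 by (intro mult_right_mono mult_left_mono) auto
      then show ?thesis
        using rw.comparable[of x R] rw.r_pos[of x] rw.r_pos[of R] x R d_le by (meson less_imp_le order_trans less_le_trans)
    qed
    ultimately show "r k R / W \<le> enn2real (w (G s)) \<and> enn2real (w (G s)) \<le> W * r k R"
    proof (intro conjI)
      assume 1: "r k x / W0 \<le> enn2real (w (G s)) \<and> enn2real (w (G s)) \<le> W0 * r k x"
        and 2: "r k x \<le> K k * 2 powr a k * r k R \<and> r k R \<le> K k * 2 powr a k * r k x"
      have "r k R / W \<le> K k * 2 powr a k * r k x / W"
        using 2 \<delta>(2) K2 by (intro divide_right_mono) (auto simp: W_def)
      also have "\<dots> = r k x / W0" using K2 \<delta>(2) rw.K_ge_1 by (simp add: W_def)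
      finally show "r k R / W \<le> enn2real (w (G s))" using 1 by simp
      have "W0 * r k x \<le> W0 * (K k * 2 powr a k * r k R)"
        using 2 \<delta>(2) by (intro mult_left_mono) auto
      then show "enn2real (w (G s)) \<le> W * r k R" using 1 by (simp add: W_def mult.assoc)
    qed
    show "\<bar>p (G s) - p0\<bar> * (- ln R) \<le> A"
    proof -
      have ln: "ln x \<le> ln R" "ln R < 0" using x R d_le by auto
      have "\<bar>p (G s) - p0\<bar> \<le> - A / ln x"
        unfolding x_def p0_def using x R d_le by (intro log_holder piece(1)[OF R s] t0) (auto simp: x_def)
      then have "\<bar>p (G s) - p0\<bar> * (- ln R) \<le> - A / ln x * (- ln R)"
        using ln by (intro mult_right_mono) auto
      also have "\<dots> = A * (ln R / ln x)" by simp
      also have "\<dots> \<le> A * 1" using ln A by (intro mult_left_mono) (auto simp: divide_le_eq)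
      finally show ?thesis by simp
    qed
  qed
  obtain M where M: "\<And>R I J X. 0 < R \<Longrightarrow> R < d \<Longrightarrow> finite I \<Longrightarrow> I \<noteq> {} \<Longrightarrow> finite J \<Longrightarrow> 0 < X \<Longrightarrow>
      (\<And>j. j \<in> J \<Longrightarrow> X * real (card I) powr (1 / p \<tau>1) * R \<le> (\<Sum>i\<in>I. (R / 2 ^ i) / \<psi> (R / 2 ^ i)) * \<psi> (R / 2 ^ j)) \<Longrightarrow>
      real (card J) * min (X powr p \<tau>2) X \<le> M"
    using dyadic_muckenhoupt[OF bounded] by blast
  have gt: "1 < p0" "1 < p \<tau>1" "1 \<le> p \<tau>2"
    using p_gt_1 t0 \<tau>1(1) \<tau>2(1) by (auto simp: p0_def intro: less_imp_le)
  have "0 < 1 / p0 + lower_index (ws k)" "1 / p0 + upper_index (ws k) < 1"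
    using rw.index_bounds_from_dyadic[OF gt d_le(1,4), of M] M unfolding \<psi>_def by blast+
  then show "0 < 1 / p (ts k) + lower_index (ws k)" "1 / p (ts k) + upper_index (ws k) < 1"
    by (simp_all add: p0_def t0_def)
qed

end

end

theorem corollary4p3:
  fixes g :: "real \<Rightarrow> complex"
    and p :: "complex \<Rightarrow> real"
    and n :: nat
    and ts :: "nat \<Rightarrow> complex"
    and ws :: "nat \<Rightarrow> real \<Rightarrow> ennreal"
    and w :: "complex \<Rightarrow> ennreal"
    and A :: real
  assumes "rectifiable_jordan_curve g"
    and "counterclockwise g"
    and "carleson_curve g"
    and "continuous_on (path_image g) p"
    and "\<forall>\<tau>\<in>path_image g. 1 < p \<tau>"
    and "0 < A"
    and "\<forall>\<tau>\<in>path_image g. \<forall>t\<in>path_image g. cmod (\<tau> - t) \<le> 1/2 \<longrightarrow>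
           \<bar>p \<tau> - p t\<bar> \<le> - A / ln (cmod (\<tau> - t))"
    and "\<forall>k\<in>{1..n}. ts k \<in> path_image g"
    and "inj_on ts {1..n}"
    and "\<forall>k\<in>{1..n}. ws k \<in> class_WW (curve_length g)"
    and "\<forall>t\<in>path_image g. w t = (\<Prod>k\<in>{1..n}. ws k (cmod (t - ts k)))"
    and "cauchy_singular_operator_bounded g p w"
  shows "\<forall>k\<in>{1..n}. 0 < 1 / p (ts k) + lower_index (ws k) \<and>
                    1 / p (ts k) + upper_index (ws k) < 1"
proof
  interpret jordan_arclength g by unfold_locales (rule assms)
  fix k assume k: "k \<in> {1..n}"
  \<comment> \<open>The comparison data of all factors are chosen at once, as triples \<open>(r, a, K)\<close>.\<close>
  have "\<forall>j\<in>{1..n}. \<exists>raK. power_comparable L (fst (snd raK)) (snd (snd raK)) (fst raK) \<and>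
      (\<forall>x. 0 < x \<longrightarrow> x \<le> L \<longrightarrow> ws j x = ennreal (fst raK x)) \<and> continuous_on {0<..L} (fst raK)"
  proof
    fix j assume "j \<in> {1..n}"
    then have "ws j \<in> class_WW L" using assms(10) by blast
    then obtain r a K where "power_comparable L a K r"
      "\<And>x. 0 < x \<Longrightarrow> x \<le> L \<Longrightarrow> ws j x = ennreal (r x)" "continuous_on {0<..L} r"
      using class_WW_real[of "ws j" L] L_pos by metis
    then show "\<exists>raK. power_comparable L (fst (snd raK)) (snd (snd raK)) (fst raK) \<and>
      (\<forall>x. 0 < x \<longrightarrow> x \<le> L \<longrightarrow> ws j x = ennreal (fst raK x)) \<and> continuous_on {0<..L} (fst raK)"
      by (intro exI[of _ "(r, a, K)"]) simp
  qed
  then obtain raK where raK: "\<And>j. j \<in> {1..n} \<Longrightarrow> power_comparable L (fst (snd (raK j))) (snd (snd (raK j))) (fst (raK j)) \<and>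
      (\<forall>x. 0 < x \<longrightarrow> x \<le> L \<longrightarrow> ws j x = ennreal (fst (raK j) x)) \<and> continuous_on {0<..L} (fst (raK j))"
    by metis
  have comp: "\<And>j. j \<in> {1..n} \<Longrightarrow> power_comparable L (fst (snd (raK j))) (snd (snd (raK j))) (fst (raK j))"
    and ws: "\<And>j x. j \<in> {1..n} \<Longrightarrow> 0 < x \<Longrightarrow> x \<le> L \<Longrightarrow> ws j x = ennreal (fst (raK j) x)"
    and cont: "\<And>j. j \<in> {1..n} \<Longrightarrow> continuous_on {0<..L} (fst (raK j))"
    using raK by blast+
  have ts: "\<And>j. j \<in> {1..n} \<Longrightarrow> ts j \<in> \<Gamma>"
    and w: "\<And>t. t \<in> \<Gamma> \<Longrightarrow> w t = (\<Prod>k\<in>{1..n}. ws k (cmod (t - ts k)))"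
    and p1: "\<And>\<tau>. \<tau> \<in> \<Gamma> \<Longrightarrow> 1 < p \<tau>"
    and lh: "\<And>\<tau> t. \<tau> \<in> \<Gamma> \<Longrightarrow> t \<in> \<Gamma> \<Longrightarrow> cmod (\<tau> - t) \<le> 1 / 2 \<Longrightarrow> \<bar>p \<tau> - p t\<bar> \<le> - A / ln (cmod (\<tau> - t))"
    using assms by blast+
  note node = node_index_bounds[OF ts comp ws cont w assms(3,4) p1 assms(6) lh assms(9,12) k]
  show "0 < 1 / p (ts k) + lower_index (ws k) \<and> 1 / p (ts k) + upper_index (ws k) < 1"
    using node by blast
qed

end
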